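(* Let $n\ge2$, $\mathbf d=(d_1,\dots,d_n)\in\mathbb{N}^n$ and $\boldsymbol\gamma=(\gamma_1,\dots,\gamma_n)\in\mathbb{C}^n$ with $\Re(\gamma_j)>0$ for all $j$. Assume that for all $j=1,\dots,n$ and all $\varepsilon_{j+1},\dots,\varepsilon_n\in\{0,1\}$, $\frac1{d_j}+\sum_{k=j+1}^n\frac{\varepsilon_k}{d_k}\notin\mathbb{N}$. Then for all $\mathbf N=(N_1,\dots,N_n)\in\mathbb{Z}^n$ with $N_n\le0$, $$\zeta_{n,\mathbf d,\boldsymbol\gamma}(\mathbf N)=-\frac12\,\zeta_{n-1,\mathbf d',\boldsymbol\gamma'}(N_1,\dots,N_{n-2},N_{n-1}+N_n) -\sum_{\substack{1\le k\le[(1-d_nN_n)/2]\\ d_n\mid 2k-1}}\frac{B_{2k}}{2k}\binom{-N_n}{(2k-1)/d_n}\gamma_n^{(2k-1)/d_n}\,\zeta_{n-1,\mathbf d',\boldsymbol\gamma'}\Big(N_1,\dots,N_{n-2},N_{n-1}+N_n+\tfrac{2k-1}{d_n}\Big),$$ where $\mathbf d'=(d_1,\dots,d_{n-1})$, $\boldsymbol\gamma'=(\gamma_1,\dots,\gamma_{n-1})$.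
   Context: For $m\in\mathbb{N}$, $\mathbf e\in\mathbb{N}^m$, $\boldsymbol\eta\in\mathbb{C}^m$ with $\Re\eta_j>0$, $\zeta_{m,\mathbf e,\boldsymbol\eta}(\mathbf s)$ denotes the meromorphic continuation to $\mathbb{C}^m$ of $\sum_{m_1,\dots,m_m\ge1}\prod_{j=1}^m(\eta_1m_1^{e_1}+\dots+\eta_jm_j^{e_j})^{-s_j}$ (principal branch of powers; the series converges for $\Re(s_j+\dots+s_m)>\frac1{e_j}+\dots+\frac1{e_m}$ for all $j$). Under the stated non-integrality hypothesis all points of $\mathbb{Z}^n$ are regular points, and the values are those of the continuation. $B_k$ are the Bernoulli numbers defined by $X/(e^X-1)=\sum_{k\ge0}B_kX^k/k!$; $[x]$ is the integer part; $\binom{M}{r}=M(M-1)\cdots(M-r+1)/r!$. *)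

theory Defs
  imports "HOL-Complex_Analysis.Complex_Analysis"
begin

(* Points of C^m are the extensional functions on {1..m}, i.e. the elements of
   {1..m} \<rightarrow>\<^sub>E UNIV; this is the topspace of the product topology below. *)

abbreviation complex_space :: "nat \<Rightarrow> (nat \<Rightarrow> complex) topology" where
  "complex_space m \<equiv> product_topology (\<lambda>_. euclidean) {1..m}"

(* Holomorphic functions of m variables: continuous and holomorphic in each
   variable separately (equivalent to complex differentiability by Osgood's lemma). *)

definition holomorphic_several ::
    "nat \<Rightarrow> ((nat \<Rightarrow> complex) \<Rightarrow> complex) \<Rightarrow> (nat \<Rightarrow> complex) set \<Rightarrow> bool" where
  "holomorphic_several m f U \<longleftrightarrow>
     openin (complex_space m) U \<and>
     continuous_map (subtopology (complex_space m) U) euclidean f \<and>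
     (\<forall>s\<in>U. \<forall>j\<in>{1..m}. (\<lambda>z. f (s(j := z))) field_differentiable (at (s j)))"

(* A meromorphic function on C^m, given together with an open dense set D on which
   it is holomorphic: near every point of C^m it is a quotient g / h of holomorphic
   functions, where h is not identically zero on any non-empty open set. *)

definition meromorphic_several ::
    "nat \<Rightarrow> ((nat \<Rightarrow> complex) \<Rightarrow> complex) \<Rightarrow> (nat \<Rightarrow> complex) set \<Rightarrow> bool" where
  "meromorphic_several m f D \<longleftrightarrow>
     holomorphic_several m f D \<and>
     complex_space m closure_of D = topspace (complex_space m) \<and>
     (\<forall>p\<in>topspace (complex_space m). \<exists>U g h. p \<in> U \<and>
        holomorphic_several m g U \<and> holomorphic_several m h U \<and>
        (\<forall>V. openin (complex_space m) V \<and> V \<noteq> {} \<and> V \<subseteq> U \<longrightarrow> (\<exists>s\<in>V. h s \<noteq> 0)) \<and>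
        (\<forall>s\<in>U \<inter> D. f s * h s = g s))"

(* In the following definitions only the values e j and \<eta> j for j in {1..m} matter. *)

definition multizeta_series ::
    "nat \<Rightarrow> (nat \<Rightarrow> nat) \<Rightarrow> (nat \<Rightarrow> complex) \<Rightarrow> (nat \<Rightarrow> complex) \<Rightarrow> complex" where
  "multizeta_series m e \<eta> s =
     (\<Sum>\<^sub>\<infinity>a\<in>{1..m} \<rightarrow>\<^sub>E {1..}. \<Prod>j\<in>{1..m}. (\<Sum>i\<in>{1..j}. \<eta> i * of_nat (a i) ^ e i) powr (- s j))"

definition multizeta_region :: "nat \<Rightarrow> (nat \<Rightarrow> nat) \<Rightarrow> (nat \<Rightarrow> complex) set" where
  "multizeta_region m e =
     {s \<in> topspace (complex_space m).
        \<forall>j\<in>{1..m}. Re (\<Sum>i\<in>{j..m}. s i) > (\<Sum>i\<in>{j..m}. 1 / real (e i))}"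

definition multizeta_continuation ::
    "nat \<Rightarrow> (nat \<Rightarrow> nat) \<Rightarrow> (nat \<Rightarrow> complex) \<Rightarrow>
     ((nat \<Rightarrow> complex) \<Rightarrow> complex) \<Rightarrow> (nat \<Rightarrow> complex) set \<Rightarrow> bool" where
  "multizeta_continuation m e \<eta> f D \<longleftrightarrow>
     meromorphic_several m f D \<and> multizeta_region m e \<subseteq> D \<and>
     (\<forall>s\<in>multizeta_region m e. f s = multizeta_series m e \<eta> s)"

(* The value of the meromorphic continuation at a regular point. A point is regular
   if some continuation (f, D) has it in its domain D of holomorphy; at all other
   points the value is left unspecified. The argument s is cut down to {1..m}. *)

definition multizeta ::
    "nat \<Rightarrow> (nat \<Rightarrow> nat) \<Rightarrow> (nat \<Rightarrow> complex) \<Rightarrow> (nat \<Rightarrow> complex) \<Rightarrow> complex" where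
  "multizeta m e \<eta> s =
     (THE w. \<exists>f D. multizeta_continuation m e \<eta> f D \<and>
        restrict s {1..m} \<in> D \<and> f (restrict s {1..m}) = w)"

definition bernoulli :: "nat \<Rightarrow> real" where
  "bernoulli k = fact k * fps_nth (fps_X / (fps_exp 1 - 1)) k"

end

theory Submission
  imports Defs
begin

text \<open>
  Apply Euler-Maclaurin summation to the innermost sum over \<open>k = m_n\<close> of \<open>(A + \<gamma> k^d)^(-w)\<close>, where
  \<open>w = s_n\<close>, \<open>d = d_n\<close>, \<open>\<gamma> = \<gamma>_n\<close> and \<open>A = \<gamma>_1 m_1^{d_1} + \<dots> + \<gamma>_{n-1} m_{n-1}^{d_{n-1}}\<close>. The integral is
  \<open>c(w) A^(1/d - w)\<close>, the derivatives at 0 are multiples of \<open>binom(-w, l) A^(-w-l)\<close>, and the remainder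
  decays in \<open>A\<close> as fast as desired. Summation over \<open>m_1, \<dots>, m_{n-1}\<close> expresses the zeta function of \<open>n\<close>
  variables through translates of the one of \<open>n - 1\<close> variables, with \<open>s_{n-1}\<close> replaced by
  \<open>s_{n-1} + s_n - 1/d\<close>, \<open>s_{n-1} + s_n\<close> and \<open>s_{n-1} + s_n + l\<close>. By induction this gives the continuation,
  together with an entire function that cancels all its poles and is nonzero at integer points under
  the hypothesis. At \<open>s_n = N_n \<le> 0\<close> the summand is a polynomial in \<open>k\<close>: the remainder vanishes,
  and so does \<open>c(w)\<close>, which is a multiple of \<open>1 / \<Gamma>(w)\<close>; what remains is the stated formula.
\<close>

subsection \<open>Uniqueness of the continuation\<close>

text \<open>The pole set is never determined exactly: everything is carried by entire functions, and
  the value at \<open>s\<close> is \<open>E s / polar_factor e m s\<close> as soon as the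
  denominator is nonzero there. The recursion doubles this denominator: one copy clears the poles of
  the translate by \<open>0\<close>, one those of the translate by \<open>- 1/d\<close>, and
  \<open>1 / \<Gamma>(w - 1/d)\<close> clears those of \<open>c(w)\<close>. The translates by
  \<open>l\<close>, whose number grows with the order of the expansion, cost nothing, because
  \<open>1 / \<Gamma>(z)\<close> is a polynomial times \<open>1 / \<Gamma>(z + l)\<close>. A
  remainder of fixed order converges only on a restricted range, so the order must grow as the point
  moves left; hence the exhaustion by half-boxes and the gluing. The glued function equals the
  explicit expansion on every half-box, so the expansion itself may be evaluated at the integer
  point, outside the region of convergence. The recursion starts with one variable and not with
  none: without outer variables \<open>A = 0\<close>, and the expansion in powers of
  \<open>A\<close> makes no sense.\<close>

text \<open>The zero set is enlarged from \<open>V\<close> to \<open>B\<close> in one coordinate at a time, so that only the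
  one-variable identity theorem is needed.\<close>

lemma identity_box:
  fixes F :: "('i \<Rightarrow> complex) \<Rightarrow> complex"
  assumes fin: "finite I"
    and B: "\<And>i. i \<in> I \<Longrightarrow> open (B i)" "\<And>i. i \<in> I \<Longrightarrow> connected (B i)"
    and V: "\<And>i. i \<in> I \<Longrightarrow> open (V i)" "\<And>i. i \<in> I \<Longrightarrow> V i \<noteq> {}" "\<And>i. i \<in> I \<Longrightarrow> V i \<subseteq> B i"
    and hol: "\<And>s j. j \<in> I \<Longrightarrow> (\<And>i. i \<in> I \<Longrightarrow> s i \<in> B i) \<Longrightarrow> (\<lambda>z. F (s(j := z))) holomorphic_on B j"
    and zero: "\<And>s. (\<And>i. i \<in> I \<Longrightarrow> s i \<in> V i) \<Longrightarrow> F s = 0"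
    and s: "\<And>i. i \<in> I \<Longrightarrow> s i \<in> B i"
  shows "F s = 0"
proof -
  have "\<forall>s. (\<forall>i\<in>I. s i \<in> (if i \<in> J then B i else V i)) \<longrightarrow> F s = 0"
    if "finite J" "J \<subseteq> I" for J
    using that
  proof (induction J)
    case empty
    then show ?case using zero by auto
  next
    case (insert j J)
    show ?case
    proof (intro allI impI)
      fix s assume s: "\<forall>i\<in>I. s i \<in> (if i \<in> insert j J then B i else V i)"
      have jI: "j \<in> I" using insert.prems by auto
      have sB: "s i \<in> B i" if "i \<in> I" for i
        using s that V(3)[OF that] by (auto split: if_splits)
      obtain z0 where z0: "z0 \<in> V j" using V(2)[OF jI] by auto
      have van: "F (s(j := z)) = 0" if "z \<in> V j" for z
      proof -
        have "\<forall>i\<in>I. (s(j := z)) i \<in> (if i \<in> J then B i else V i)"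
          using s insert.hyps that by auto
        then show ?thesis using insert by auto
      qed
      have "F (s(j := s j)) = 0"
      proof (rule analytic_continuation_open[where f = "\<lambda>z. F (s(j := z))" and g = "\<lambda>_. 0"
            and s' = "B j" and s = "V j"])
        show "(\<lambda>z. F (s(j := z))) holomorphic_on B j" using hol[OF jI] sB by blast
      qed (use B V jI van sB in auto)
      then show "F s = 0" by simp
    qed
  qed
  from this[of I] fin s show ?thesis by auto
qed

lemma complex_space_box:
  assumes "openin (complex_space m) U" "p \<in> U"
  obtains B where "\<And>i. i \<in> {1..m} \<Longrightarrow> open (B i)" "\<And>i. i \<in> {1..m} \<Longrightarrow> connected (B i)"
    "p \<in> Pi\<^sub>E {1..m} B" "Pi\<^sub>E {1..m} B \<subseteq> U" "openin (complex_space m) (Pi\<^sub>E {1..m} B)"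
proof -
  from assms obtain V where V: "\<forall>i\<in>{1..m}. open (V i)" "p \<in> Pi\<^sub>E {1..m} V" "Pi\<^sub>E {1..m} V \<subseteq> U"
    unfolding openin_product_topology_alt by auto
  have "\<forall>i\<in>{1..m}. \<exists>r>0. ball (p i) r \<subseteq> V i"
    using V by (auto simp: open_contains_ball PiE_iff)
  then obtain r where r: "\<And>i. i \<in> {1..m} \<Longrightarrow> r i > 0" "\<And>i. i \<in> {1..m} \<Longrightarrow> ball (p i) (r i) \<subseteq> V i"
    by metis
  show ?thesis
  proof (rule that[of "\<lambda>i. ball (p i) (r i)"])
    show "p \<in> Pi\<^sub>E {1..m} (\<lambda>i. ball (p i) (r i))" using V(2) r by (auto simp: PiE_iff)
    have "Pi\<^sub>E {1..m} (\<lambda>i. ball (p i) (r i)) \<subseteq> Pi\<^sub>E {1..m} V" by (rule PiE_mono) (use r in auto)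
    then show "Pi\<^sub>E {1..m} (\<lambda>i. ball (p i) (r i)) \<subseteq> U" using V(3) by blast
    show "openin (complex_space m) (Pi\<^sub>E {1..m} (\<lambda>i. ball (p i) (r i)))"
      by (subst openin_PiE_gen) simp_all
  qed (auto simp: connected_ball)
qed

lemma holomorphic_several_slice:
  assumes g: "holomorphic_several m g U" and sub: "Pi\<^sub>E {1..m} B \<subseteq> U"
    and s: "s \<in> Pi\<^sub>E {1..m} B" and j: "j \<in> {1..m}"
  shows "(\<lambda>z. g (s(j := z))) holomorphic_on B j"
  unfolding holomorphic_on_def
proof
  fix z assume z: "z \<in> B j"
  have "s(j := z) \<in> Pi\<^sub>E {1..m} B" using s j z by (auto simp: PiE_iff extensional_def)
  then have "s(j := z) \<in> U" using sub by auto
  then have "(\<lambda>z'. g ((s(j := z))(j := z'))) field_differentiable (at ((s(j := z)) j))"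
    using g j unfolding holomorphic_several_def by blast
  then show "(\<lambda>z. g (s(j := z))) field_differentiable (at z within B j)"
    by (simp add: field_differentiable_at_within)
qed

lemma openin_neq:
  assumes "continuous_map (subtopology X U) euclidean f" "continuous_map (subtopology X U) euclidean g"
    "openin X U"
  shows "openin X {s \<in> U. f s \<noteq> (g s :: complex)}"
proof -
  have "continuous_map (subtopology X U) euclidean (\<lambda>s. f s - g s)"
    using assms by (intro continuous_map_diff)
  then have "openin (subtopology X U) {s \<in> topspace (subtopology X U). f s - g s \<in> - {0}}"
    by (rule openin_continuous_map_preimage) (simp add: open_Compl)
  then have "openin X {s \<in> topspace (subtopology X U). f s - g s \<in> - {0}}"
    using assms(3) openin_open_subtopology by blast
  moreover have "{s \<in> topspace (subtopology X U). f s - g s \<in> - {0}} = {s \<in> U. f s \<noteq> g s}"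
    using openin_subset[OF assms(3)] by auto
  ultimately show ?thesis by simp
qed

lemma dense_meets:
  assumes "X closure_of D = topspace X" "openin X U" "U \<noteq> {}"
  shows "U \<inter> D \<noteq> {}"
  using assms by (metis dense_intersects_open inf.commute)

text \<open>As \<open>1 / e i \<le> 1\<close> (also for \<open>e i = 0\<close>, where the quotient
  is \<open>0\<close>), the box \<open>Re (s i) > 1\<close> lies in every region of convergence. It
  is the open set from which the identity theorem starts, here and when gluing.\<close>

lemma region_box:
  fixes s :: "nat \<Rightarrow> complex"
  assumes "\<And>i. i \<in> {1..m} \<Longrightarrow> Re (s i) > 1" "j \<in> {1..m}"
  shows "Re (\<Sum>i\<in>{j..m}. s i) > (\<Sum>i\<in>{j..m}. 1 / real (e i))"
proof -
  have "(\<Sum>i\<in>{j..m}. 1 / real (e i)) < (\<Sum>i\<in>{j..m}. Re (s i))"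
  proof (rule sum_strict_mono)
    fix i assume i: "i \<in> {j..m}"
    have "1 / real (e i) \<le> 1" by (cases "e i") auto
    moreover have "i \<in> {1..m}" using i assms(2) by auto
    then have "1 < Re (s i)" by (rule assms(1))
    ultimately show "1 / real (e i) < Re (s i)" by linarith
  qed (use assms(2) in auto)
  then show ?thesis by simp
qed

lemma meromorphic_several_quotient:
  assumes "meromorphic_several m f D" "p \<in> topspace (complex_space m)"
  obtains U g h where "p \<in> U" "holomorphic_several m g U" "holomorphic_several m h U"
    "\<And>V. openin (complex_space m) V \<Longrightarrow> V \<noteq> {} \<Longrightarrow> V \<subseteq> U \<Longrightarrow> \<exists>s\<in>V. h s \<noteq> 0"
    "\<And>s. s \<in> U \<inter> D \<Longrightarrow> f s * h s = g s"
proof -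
  from assms(1) have "\<forall>p\<in>topspace (complex_space m). \<exists>U g h. p \<in> U \<and>
        holomorphic_several m g U \<and> holomorphic_several m h U \<and>
        (\<forall>V. openin (complex_space m) V \<and> V \<noteq> {} \<and> V \<subseteq> U \<longrightarrow> (\<exists>s\<in>V. h s \<noteq> 0)) \<and>
        (\<forall>s\<in>U \<inter> D. f s * h s = g s)"
    unfolding meromorphic_several_def by (elim conjE)
  from bspec[OF this assms(2)] show thesis
    by (elim exE conjE) (rule that, assumption+, simp+)
qed

text \<open>The set \<open>W\<close> of points near which \<open>f\<close> and \<open>f'\<close>
  agree is open, closed and nonempty in a connected space. Nothing is known about the connectedness
  of \<open>D \<inter> D'\<close>, so agreement has to be carried across points outside the two
  domains; the local quotients \<open>g / h\<close> do this.\<close>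

lemma continuation_unique:
  assumes c1: "multizeta_continuation m e \<eta> f D" and c2: "multizeta_continuation m e \<eta> f' D'"
    and pD: "p \<in> D" "p \<in> D'"
  shows "f p = f' p"
proof -
  define X where "X = complex_space m"
  define agree where "agree = (\<lambda>U. \<forall>s\<in>U \<inter> D \<inter> D'. f s = f' s)"
  define W where "W = {p. \<exists>U. openin X U \<and> p \<in> U \<and> agree U}"
  have mer1: "meromorphic_several m f D" and mer2: "meromorphic_several m f' D'"
    using c1 c2 by (auto simp: multizeta_continuation_def)
  have hD: "holomorphic_several m f D" and hD': "holomorphic_several m f' D'"
    using c1 c2 by (auto simp: multizeta_continuation_def meromorphic_several_def)
  have oD: "openin X D" "openin X D'" using hD hD' by (auto simp: holomorphic_several_def X_def)
  have dD: "X closure_of D = topspace X" "X closure_of D' = topspace X"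
    using c1 c2 by (auto simp: multizeta_continuation_def meromorphic_several_def X_def)
  have oW: "openin X W"
    by (subst openin_subopen) (auto simp: W_def)
  \<comment> \<open>Agreement near one point of a suitable neighbourhood of \<open>p\<close> spreads
    to the whole neighbourhood. This gives closedness of \<open>W\<close>.\<close>
  have local_ext: "\<exists>U. openin X U \<and> p \<in> U \<and> (U \<inter> W \<noteq> {} \<longrightarrow> agree U)" if p: "p \<in> topspace X" for p
  proof -
    obtain U1 g1 h1 where U1: "p \<in> U1" "holomorphic_several m g1 U1" "holomorphic_several m h1 U1"
      "\<And>V. openin X V \<Longrightarrow> V \<noteq> {} \<Longrightarrow> V \<subseteq> U1 \<Longrightarrow> \<exists>s\<in>V. h1 s \<noteq> 0"
      "\<And>s. s \<in> U1 \<inter> D \<Longrightarrow> f s * h1 s = g1 s"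
      using meromorphic_several_quotient[OF mer1, of p] p unfolding X_def by metis
    obtain U2 g2 h2 where U2: "p \<in> U2" "holomorphic_several m g2 U2" "holomorphic_several m h2 U2"
      "\<And>V. openin X V \<Longrightarrow> V \<noteq> {} \<Longrightarrow> V \<subseteq> U2 \<Longrightarrow> \<exists>s\<in>V. h2 s \<noteq> 0"
      "\<And>s. s \<in> U2 \<inter> D' \<Longrightarrow> f' s * h2 s = g2 s"
      using meromorphic_several_quotient[OF mer2, of p] p unfolding X_def by metis
    have "openin X (U1 \<inter> U2)" using U1(2) U2(2) by (auto simp: holomorphic_several_def X_def)
    then obtain B where B: "\<And>i. i \<in> {1..m} \<Longrightarrow> open (B i)" "\<And>i. i \<in> {1..m} \<Longrightarrow> connected (B i)"
      "p \<in> Pi\<^sub>E {1..m} B" "Pi\<^sub>E {1..m} B \<subseteq> U1 \<inter> U2" "openin X (Pi\<^sub>E {1..m} B)"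
      using complex_space_box[of m "U1 \<inter> U2" p] U1(1) U2(1) unfolding X_def by blast
    let ?U = "Pi\<^sub>E {1..m} B"
    have "agree ?U" if meet: "?U \<inter> W \<noteq> {}"
    proof -
      obtain q Q where q: "q \<in> ?U" "openin X Q" "q \<in> Q" "agree Q"
        using meet by (auto simp: W_def)
      have "openin X (?U \<inter> Q)" "?U \<inter> Q \<noteq> {}" using q B by auto
      then have "?U \<inter> Q \<inter> D \<noteq> {}" using dense_meets[OF dD(1)] by blast
      moreover have "openin X (?U \<inter> Q \<inter> D)" using q B oD by blast
      ultimately have ne: "?U \<inter> Q \<inter> D \<inter> D' \<noteq> {}" using dense_meets[OF dD(2)] by blast
      then obtain q' where q': "q' \<in> ?U \<inter> Q \<inter> D \<inter> D'" by blast
      have "openin X (?U \<inter> Q \<inter> D \<inter> D')" using q B oD by blast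
      then obtain V where V: "\<And>i. i \<in> {1..m} \<Longrightarrow> open (V i)" "q' \<in> Pi\<^sub>E {1..m} V"
        "Pi\<^sub>E {1..m} V \<subseteq> ?U \<inter> Q \<inter> D \<inter> D'"
        using complex_space_box[of m "?U \<inter> Q \<inter> D \<inter> D'" q'] q' unfolding X_def by metis
      have VB: "V i \<subseteq> B i" if "i \<in> {1..m}" for i
      proof
        fix z assume "z \<in> V i"
        then have "q'(i := z) \<in> Pi\<^sub>E {1..m} V" using V(2) that by (auto simp: PiE_iff extensional_def)
        then have "q'(i := z) \<in> ?U" using V(3) by blast
        then have "(q'(i := z)) i \<in> B i" using that by (rule PiE_mem)
        then show "z \<in> B i" by simp
      qed
      \<comment> \<open>The cross product of the two fractions is holomorphic on the whole box,
        poles included. The restriction makes it a function on all of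
        \<open>nat \<Rightarrow> complex\<close>, as \<open>identity_box\<close> requires.\<close>
      define F where "F = (\<lambda>s. let s = restrict s {1..m} in g1 s * h2 s - g2 s * h1 s)"
      have F0: "F s = 0" if s: "\<And>i. i \<in> {1..m} \<Longrightarrow> s i \<in> B i" for s
      proof (rule identity_box[where I = "{1..m}" and B = B and V = V and F = F and s = s])
        fix s j assume j: "j \<in> {1..m}" and s: "\<And>i. i \<in> {1..m} \<Longrightarrow> s i \<in> B i"
        have r: "restrict s {1..m} \<in> ?U" using s by auto
        have upd: "restrict (s(j := z)) {1..m} = (restrict s {1..m})(j := z)" for z
          using j by (auto simp: fun_eq_iff)
        show "(\<lambda>z. F (s(j := z))) holomorphic_on B j"
          unfolding F_def Let_def upd
          by (intro holomorphic_intros holomorphic_several_slice[OF U1(2) _ r j]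
              holomorphic_several_slice[OF U1(3) _ r j] holomorphic_several_slice[OF U2(2) _ r j]
              holomorphic_several_slice[OF U2(3) _ r j]) (use B(4) in auto)
      next
        fix s assume s: "\<And>i. i \<in> {1..m} \<Longrightarrow> s i \<in> V i"
        define s' where "s' = restrict s {1..m}"
        have "s' \<in> Pi\<^sub>E {1..m} V" using s by (auto simp: s'_def)
        then have s': "s' \<in> U1" "s' \<in> U2" "s' \<in> D" "s' \<in> D'" "s' \<in> Q" using V(3) B(4) by auto
        have "f s' = f' s'" using q(4) s' by (auto simp: agree_def)
        moreover have "f s' * h1 s' = g1 s'" "f' s' * h2 s' = g2 s'" using U1(5) U2(5) s' by auto
        ultimately have "g1 s' * h2 s' - g2 s' * h1 s' = 0" by (metis diff_self mult.assoc mult.commute)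
        then show "F s = 0" by (simp add: F_def Let_def s'_def)
      next
        fix i assume i: "i \<in> {1..m}"
        have "q' i \<in> V i" using V(2) i by (rule PiE_mem)
        then show "V i \<noteq> {}" by auto
      qed (fact finite_atLeastAtMost B(1) B(2) V(1) VB s | assumption)+
      show "agree ?U" unfolding agree_def
      proof (rule ccontr)
        assume "\<not> (\<forall>s\<in>?U \<inter> D \<inter> D'. f s = f' s)"
        then obtain t where t: "t \<in> ?U" "t \<in> D" "t \<in> D'" "f t \<noteq> f' t" by blast
        have cont: "continuous_map (subtopology X (D \<inter> D')) euclidean f"
          "continuous_map (subtopology X (D \<inter> D')) euclidean f'"
          using hD hD' unfolding holomorphic_several_def X_def
          by (meson continuous_map_from_subtopology_mono inf_le1 inf_le2)+
        \<comment> \<open>Back from \<open>g1 * h2 = g2 * h1\<close> to \<open>f = f'\<close>: a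
          point of disagreement would give an open set of them, which contains a point where neither
          \<open>h1\<close> nor \<open>h2\<close> vanishes, and there one can divide.\<close>
        define Y where "Y = ?U \<inter> {s \<in> D \<inter> D'. f s \<noteq> f' s}"
        have oY: "openin X Y" unfolding Y_def using openin_neq[OF cont] oD B(5) by blast
        have "Y \<noteq> {}" using t by (auto simp: Y_def)
        moreover have "Y \<subseteq> U1" using B(4) by (auto simp: Y_def)
        ultimately obtain t1 where t1: "t1 \<in> Y" "h1 t1 \<noteq> 0" using U1(4) oY by blast
        define Y1 where "Y1 = Y \<inter> {s \<in> U1. h1 s \<noteq> 0}"
        have "openin X {s \<in> U1. h1 s \<noteq> 0}"
          by (rule openin_neq) (use U1(3) in \<open>auto simp: holomorphic_several_def X_def\<close>)
        then have "openin X Y1" unfolding Y1_def using oY by blast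
        moreover have "Y1 \<noteq> {}" using t1 \<open>Y \<subseteq> U1\<close> by (auto simp: Y1_def)
        moreover have "Y1 \<subseteq> U2" using B(4) by (auto simp: Y1_def Y_def)
        ultimately obtain t2 where t2: "t2 \<in> Y1" "h2 t2 \<noteq> 0" using U2(4) by blast
        have t2': "h1 t2 \<noteq> 0" "t2 \<in> ?U" "t2 \<in> D" "t2 \<in> D'" "f t2 \<noteq> f' t2"
          using t2 by (auto simp: Y1_def Y_def)
        have "restrict t2 {1..m} = t2" using t2'(2) by (auto simp: PiE_iff extensional_restrict)
        then have "g1 t2 * h2 t2 = g2 t2 * h1 t2"
          using F0[of t2] t2'(2) by (auto simp: F_def PiE_iff)
        moreover have "f t2 * h1 t2 = g1 t2" "f' t2 * h2 t2 = g2 t2"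
          using U1(5) U2(5) t2' B(4) by auto
        ultimately have "f t2 * (h1 t2 * h2 t2) = f' t2 * (h1 t2 * h2 t2)"
          by (metis mult.assoc mult.commute)
        then show False using t2 t2' by simp
      qed
    qed
    then show ?thesis using B by blast
  qed
  have "closedin X W"
  proof -
    have "X closure_of W \<subseteq> W"
    proof
      fix p assume p: "p \<in> X closure_of W"
      then have "p \<in> topspace X" by (simp add: in_closure_of)
      then obtain U where U: "openin X U" "p \<in> U" "U \<inter> W \<noteq> {} \<longrightarrow> agree U"
        using local_ext by blast
      then have "U \<inter> W \<noteq> {}" using p by (auto simp: in_closure_of)
      then show "p \<in> W" using U by (auto simp: W_def)
    qed
    moreover have "W \<subseteq> topspace X" using oW openin_subset by blast
    ultimately show ?thesis using closure_of_subset_eq by blast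
  qed
  moreover have "connected_space X"
    unfolding X_def using connectedin_topspace[of "euclidean :: complex topology"]
    by (auto simp: connected_space_product_topology)
  moreover have "W \<noteq> {}"
  proof -
    define V where "V = Pi\<^sub>E {1..m} (\<lambda>_. {z. Re z > 1})"
    have "openin X V" unfolding V_def X_def
      by (subst openin_PiE_gen) (simp_all add: open_halfspace_Re_gt)
    moreover have "restrict (\<lambda>_. 2) {1..m} \<in> V" by (auto simp: V_def)
    moreover have "V \<subseteq> multizeta_region m e"
    proof
      fix s assume s: "s \<in> V"
      have "Re (s i) > 1" if "i \<in> {1..m}" for i using s PiE_mem[OF _ that] by (fastforce simp: V_def)
      from region_box[OF this, of m] s show "s \<in> multizeta_region m e"
        unfolding multizeta_region_def by (simp add: V_def PiE_iff del: Re_sum)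
    qed
    then have "agree V" using c1 c2 by (auto simp: agree_def multizeta_continuation_def)
    ultimately show ?thesis by (auto simp: W_def)
  qed
  ultimately have "W = topspace X" using oW connected_space_clopen_in by blast
  moreover have "p \<in> topspace X" using pD oD openin_subset by blast
  ultimately obtain U where "p \<in> U" "agree U" by (auto simp: W_def)
  then show ?thesis using pD by (auto simp: agree_def)
qed

lemma multizeta_eqI:
  assumes "multizeta_continuation m e \<eta> f D" "restrict s {1..m} \<in> D"
  shows "multizeta m e \<eta> s = f (restrict s {1..m})"
  unfolding multizeta_def
proof (rule the_equality)
  show "\<exists>f' D. multizeta_continuation m e \<eta> f' D \<and> restrict s {1..m} \<in> D \<and>
      f' (restrict s {1..m}) = f (restrict s {1..m})"
    using assms by blast
  show "w = f (restrict s {1..m})" if "\<exists>f D. multizeta_continuation m e \<eta> f D \<and> restrict s {1..m} \<in> D \<and>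
      f (restrict s {1..m}) = w" for w
    using that continuation_unique assms by blast
qed

subsection \<open>Holomorphic functions of several variables\<close>

text \<open>It is convenient to work on the whole type \<open>nat \<Rightarrow> complex\<close> and to let a function of \<open>m\<close> variables
  be one that ignores all coordinates outside \<open>{1..m}\<close>; this avoids extensional functions and lets
  a function of \<open>m\<close> variables be used as one of \<open>m + 1\<close> variables.\<close>

definition depends_upto :: "nat \<Rightarrow> ((nat \<Rightarrow> complex) \<Rightarrow> complex) \<Rightarrow> bool" where
  "depends_upto m F \<longleftrightarrow> (\<forall>s s'. (\<forall>i\<in>{1..m}. s i = s' i) \<longrightarrow> F s = F s')"

definition mhol :: "nat \<Rightarrow> ((nat \<Rightarrow> complex) \<Rightarrow> complex) \<Rightarrow> (nat \<Rightarrow> complex) set \<Rightarrow> bool" where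
  "mhol m F \<Omega> \<longleftrightarrow> open \<Omega> \<and> continuous_on \<Omega> F \<and>
     (\<forall>s\<in>\<Omega>. \<forall>j. (\<lambda>z. F (s(j := z))) field_differentiable (at (s j))) \<and> depends_upto m F"

lemma mholD:
  assumes "mhol m F \<Omega>"
  shows "open \<Omega>" "continuous_on \<Omega> F"
    "s \<in> \<Omega> \<Longrightarrow> (\<lambda>z. F (s(j := z))) field_differentiable (at (s j))" "depends_upto m F"
  using assms by (auto simp: mhol_def)

lemma depends_uptoD:
  "depends_upto m F \<Longrightarrow> (\<And>i. i \<in> {1..m} \<Longrightarrow> s i = s' i) \<Longrightarrow> F s = F s'"
  unfolding depends_upto_def by blast

lemma mholI:
  assumes "open \<Omega>" "continuous_on \<Omega> F"
    "\<And>s j. s \<in> \<Omega> \<Longrightarrow> (\<lambda>z. F (s(j := z))) field_differentiable (at (s j))"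
    "\<And>s s'. (\<And>i. i \<in> {1..m} \<Longrightarrow> s i = s' i) \<Longrightarrow> F s = F s'"
  shows "mhol m F \<Omega>"
  unfolding mhol_def depends_upto_def
proof (intro conjI ballI allI impI)
  show "F s = F s'" if "\<forall>i\<in>{1..m}. s i = s' i" for s s'
    by (rule assms(4)) (use that in blast)
qed (use assms(1-3) in auto)

lemma mhol_subset: "mhol m F U \<Longrightarrow> open V \<Longrightarrow> V \<subseteq> U \<Longrightarrow> mhol m F V"
  unfolding mhol_def using continuous_on_subset[of U F V] by auto

lemma mhol_const: "open \<Omega> \<Longrightarrow> mhol m (\<lambda>_. c) \<Omega>"
  unfolding mhol_def depends_upto_def by simp

lemma continuous_on_coord [continuous_intros]: "continuous_on S (\<lambda>s. s i :: 'b::topological_space)"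
  by (rule continuous_on_subset[OF continuous_on_product_coordinates]) simp

lemma continuous_on_fun_upd [continuous_intros]:
  fixes f :: "'a::topological_space \<Rightarrow> 'i \<Rightarrow> 'b::topological_space"
  assumes "continuous_on S f" "continuous_on S g"
  shows "continuous_on S (\<lambda>x. (f x)(k := g x))"
proof (rule continuous_on_coordinatewise_then_product)
  show "continuous_on S (\<lambda>x. ((f x)(k := g x)) i)" for i
    using assms(2) continuous_on_product_then_coordinatewise[OF assms(1), of i] by (cases "i = k") simp_all
qed

lemma mhol_coord: "open \<Omega> \<Longrightarrow> i \<in> {1..m} \<Longrightarrow> mhol m (\<lambda>s. s i) \<Omega>"
  unfolding mhol_def depends_upto_def
proof (intro conjI ballI allI)
  show "(\<lambda>z. (s(j := z)) i) field_differentiable at (s j)" for s :: "nat \<Rightarrow> complex" and j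
    by (cases "i = j") (simp_all add: field_differentiable_ident field_differentiable_const)
qed (auto intro!: continuous_intros)

lemma mhol_add: "mhol m F \<Omega> \<Longrightarrow> mhol m G \<Omega> \<Longrightarrow> mhol m (\<lambda>s. F s + G s) \<Omega>"
proof (rule mholI)
  assume F: "mhol m F \<Omega>" and G: "mhol m G \<Omega>"
  show "open \<Omega>" using F by (rule mholD)
  show "continuous_on \<Omega> (\<lambda>s. F s + G s)" by (intro continuous_intros mholD(2)[OF F] mholD(2)[OF G])
  show "(\<lambda>z. F (s(j := z)) + G (s(j := z))) field_differentiable at (s j)" if "s \<in> \<Omega>" for s j
    by (intro field_differentiable_add mholD(3)[OF F that] mholD(3)[OF G that])
  show "F s + G s = F s' + G s'" if "\<And>i. i \<in> {1..m} \<Longrightarrow> s i = s' i" for s s'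
    using depends_uptoD[OF mholD(4)[OF F] that] depends_uptoD[OF mholD(4)[OF G] that] by simp
qed

lemma mhol_mult: "mhol m F \<Omega> \<Longrightarrow> mhol m G \<Omega> \<Longrightarrow> mhol m (\<lambda>s. F s * G s) \<Omega>"
proof (rule mholI)
  assume F: "mhol m F \<Omega>" and G: "mhol m G \<Omega>"
  show "open \<Omega>" using F by (rule mholD)
  show "continuous_on \<Omega> (\<lambda>s. F s * G s)" by (intro continuous_intros mholD(2)[OF F] mholD(2)[OF G])
  show "(\<lambda>z. F (s(j := z)) * G (s(j := z))) field_differentiable at (s j)" if "s \<in> \<Omega>" for s j
    by (intro field_differentiable_mult mholD(3)[OF F that] mholD(3)[OF G that])
  show "F s * G s = F s' * G s'" if "\<And>i. i \<in> {1..m} \<Longrightarrow> s i = s' i" for s s'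
    using depends_uptoD[OF mholD(4)[OF F] that] depends_uptoD[OF mholD(4)[OF G] that] by simp
qed

lemma mhol_cmult: "mhol m F \<Omega> \<Longrightarrow> mhol m (\<lambda>s. c * F s) \<Omega>"
  by (rule mhol_mult[OF mhol_const[OF mholD(1)]])

lemma mhol_diff: "mhol m F \<Omega> \<Longrightarrow> mhol m G \<Omega> \<Longrightarrow> mhol m (\<lambda>s. F s - G s) \<Omega>"
  using mhol_add[of m F \<Omega> "\<lambda>s. - 1 * G s"] mhol_cmult[of m G \<Omega> "-1"] by simp

lemma mhol_sum:
  "open \<Omega> \<Longrightarrow> (\<And>i. i \<in> I \<Longrightarrow> mhol m (F i) \<Omega>) \<Longrightarrow> mhol m (\<lambda>s. \<Sum>i\<in>I. F i s) \<Omega>"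
proof (induction I rule: infinite_finite_induct)
  case (insert x I)
  have "mhol m (\<lambda>s. F x s + (\<Sum>i\<in>I. F i s)) \<Omega>"
    by (rule mhol_add) (use insert in auto)
  then show ?case using insert.hyps by simp
qed (simp_all add: mhol_const)

lemma mhol_prod:
  "open \<Omega> \<Longrightarrow> (\<And>i. i \<in> I \<Longrightarrow> mhol m (F i) \<Omega>) \<Longrightarrow> mhol m (\<lambda>s. \<Prod>i\<in>I. F i s) \<Omega>"
proof (induction I rule: infinite_finite_induct)
  case (insert x I)
  have "mhol m (\<lambda>s. F x s * (\<Prod>i\<in>I. F i s)) \<Omega>"
    by (rule mhol_mult) (use insert in auto)
  then show ?case using insert.hyps by simp
qed (simp_all add: mhol_const)

lemma mhol_compose:
  assumes F: "mhol m F \<Omega>" and g: "g holomorphic_on U" "open U" "\<And>s. s \<in> \<Omega> \<Longrightarrow> F s \<in> U"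
  shows "mhol m (\<lambda>s. g (F s)) \<Omega>"
proof -
  have "continuous_on \<Omega> (\<lambda>s. g (F s))"
    by (rule continuous_on_compose2[OF holomorphic_on_imp_continuous_on[OF g(1)] mholD(2)[OF F]])
       (use g(3) in auto)
  moreover have "(\<lambda>z. g (F (s(j := z)))) field_differentiable at (s j)" if "s \<in> \<Omega>" for s j
  proof -
    have "g field_differentiable at (F (s(j := s j)))"
      using holomorphic_on_imp_differentiable_at[OF g(1,2)] g(3)[OF that] by simp
    from field_differentiable_compose[OF mholD(3)[OF F that, of j] this]
    show ?thesis unfolding comp_def .
  qed
  ultimately show ?thesis
    by (intro mholI mholD(1)[OF F] arg_cong[where f = g] depends_uptoD[OF mholD(4)[OF F]]) simp_all
qed

text \<open>Varying coordinate \<open>k\<close> or coordinate \<open>Suc k\<close> has the same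
  effect: it translates the \<open>k\<close>-th argument of \<open>F\<close>. Both partial
  derivatives are therefore derivatives of \<open>F\<close> in slot \<open>k\<close>.\<close>

lemma mhol_shift:
  assumes F: "mhol k F UNIV"
  shows "mhol (Suc k) (\<lambda>s. F (s(k := s k + s (Suc k) + t))) UNIV"
proof -
  let ?G = "\<lambda>s. F (s(k := s k + s (Suc k) + t))"
  have dep: "depends_upto k F" using F by (rule mholD)
  have cont: "continuous_on UNIV (\<lambda>s::nat \<Rightarrow> complex. s(k := s k + s (Suc k) + t))"
    by (intro continuous_intros continuous_on_id)
  have "continuous_on UNIV ?G"
    by (rule continuous_on_compose2[OF mholD(2)[OF F] cont]) auto
  moreover have "(\<lambda>z. ?G (s(j := z))) field_differentiable at (s j)" for s j
  proof -
    define p where "p = s(k := s k + s (Suc k) + t)"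
    have sh: "(\<lambda>z. F (p(k := z + c))) field_differentiable at w" if "w + c = p k" for w c
    proof -
      have *: "(\<lambda>z. F (p(k := z))) field_differentiable at (w + c)"
        using mholD(3)[OF F, of p k] that by simp
      have "(\<lambda>z. z + c) field_differentiable at w"
        by (intro field_differentiable_add field_differentiable_ident field_differentiable_const)
      from field_differentiable_compose[OF this *] show ?thesis by (simp add: comp_def)
    qed
    consider "j = k" | "j = Suc k" | "j \<noteq> k" "j \<noteq> Suc k" by blast
    then show ?thesis
    proof cases
      case 1
      have "?G (s(j := z)) = F (p(k := z + (s (Suc k) + t)))" for z
        by (simp add: 1 p_def fun_upd_def add.assoc) (rule arg_cong[where f = F], auto)
      then show ?thesis using sh[of "s j" "s (Suc k) + t"] 1 by (simp add: p_def add.assoc)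
    next
      case 2
      \<comment> \<open>The two points also differ in coordinate \<open>Suc k\<close>, which
        \<open>F\<close> ignores.\<close>
      have "?G (s(j := z)) = F (p(k := z + (s k + t)))" for z
        by (rule depends_uptoD[OF dep]) (auto simp: 2 p_def)
      then show ?thesis using sh[of "s j" "s k + t"] 2 by (simp add: p_def algebra_simps)
    next
      case 3
      have "?G (s(j := z)) = F (p(j := z))" for z
        using 3 by (auto simp: p_def fun_upd_twist)
      then show ?thesis using mholD(3)[OF F, of p j] 3 by (simp add: p_def)
    qed
  qed
  moreover have "depends_upto (Suc k) ?G"
    unfolding depends_upto_def
  proof (intro allI impI)
    fix s s' :: "nat \<Rightarrow> complex" assume "\<forall>i\<in>{1..Suc k}. s i = s' i"
    then show "?G s = ?G s'" by (intro depends_uptoD[OF dep]) auto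
  qed
  ultimately show ?thesis by (simp add: mhol_def)
qed

section \<open>Locally dominated series of holomorphic functions\<close>

lemma holomorphic_infsum:
  fixes f :: "'a \<Rightarrow> complex \<Rightarrow> complex"
  assumes op: "open U" and hol: "\<And>a. a \<in> A \<Longrightarrow> f a holomorphic_on U"
    and bd: "\<And>z. z \<in> U \<Longrightarrow> \<exists>V B. open V \<and> z \<in> V \<and> B summable_on A \<and>
      (\<forall>a\<in>A. \<forall>u\<in>V \<inter> U. norm (f a u) \<le> B a)"
  shows "(\<lambda>z. \<Sum>\<^sub>\<infinity>a\<in>A. f a z) holomorphic_on U"
proof -
  have "(\<lambda>z. \<Sum>\<^sub>\<infinity>a\<in>A. f a z) field_differentiable at z" if z: "z \<in> U" for z
  proof -
    obtain V B where VB: "open V" "z \<in> V" "B summable_on A"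
      "\<And>a u. a \<in> A \<Longrightarrow> u \<in> V \<inter> U \<Longrightarrow> norm (f a u) \<le> B a" using bd[OF z] by metis
    have "open (V \<inter> U)" "z \<in> V \<inter> U" using VB op z by auto
    then obtain r where r: "r > 0" "cball z r \<subseteq> V \<inter> U" using open_contains_cball_eq by blast
    have ul: "uniform_limit (cball z r) (\<lambda>X y. \<Sum>x\<in>X. f x y) (\<lambda>y. \<Sum>\<^sub>\<infinity>x\<in>A. f x y) (finite_subsets_at_top A)"
      by (rule Weierstrass_m_test_general[OF VB(4) VB(3)]) (use r in auto)
    have ev: "\<forall>\<^sub>F X in finite_subsets_at_top A. continuous_on (cball z r) (\<lambda>y. \<Sum>x\<in>X. f x y) \<and>
        (\<lambda>y. \<Sum>x\<in>X. f x y) holomorphic_on ball z r"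
    proof (rule eventually_finite_subsets_at_top_weakI)
      fix X assume X: "finite X" "X \<subseteq> A"
      have "f x holomorphic_on cball z r" if "x \<in> X" for x
        using hol[of x] that X r holomorphic_on_subset by blast
      then have "(\<lambda>y. \<Sum>x\<in>X. f x y) holomorphic_on cball z r" by (intro holomorphic_intros)
      then show "continuous_on (cball z r) (\<lambda>y. \<Sum>x\<in>X. f x y) \<and>
        (\<lambda>y. \<Sum>x\<in>X. f x y) holomorphic_on ball z r"
        using holomorphic_on_imp_continuous_on holomorphic_on_subset ball_subset_cball by blast
    qed
    have "(\<lambda>y. \<Sum>\<^sub>\<infinity>x\<in>A. f x y) holomorphic_on ball z r"
      by (rule holomorphic_uniform_limit[OF ev ul finite_subsets_at_top_neq_bot])
    then show ?thesis
      using r(1) by (intro holomorphic_on_imp_differentiable_at[of _ "ball z r"]) auto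
  qed
  then show ?thesis using op holomorphic_on_def field_differentiable_at_within by blast
qed

text \<open>One local majorant serves twice: the M-test on a neighbourhood gives joint continuity,
  and its trace on each coordinate line gives differentiability in each variable.\<close>

lemma mhol_infsum:
  fixes f :: "'a \<Rightarrow> (nat \<Rightarrow> complex) \<Rightarrow> complex"
  assumes op: "open \<Omega>" and hol: "\<And>a. a \<in> A \<Longrightarrow> mhol m (f a) \<Omega>"
    and bd: "\<And>s. s \<in> \<Omega> \<Longrightarrow> \<exists>V B. open V \<and> s \<in> V \<and> B summable_on A \<and>
      (\<forall>a\<in>A. \<forall>u\<in>V \<inter> \<Omega>. norm (f a u) \<le> B a)"
  shows "mhol m (\<lambda>s. \<Sum>\<^sub>\<infinity>a\<in>A. f a s) \<Omega>"
proof -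
  have upd: "continuous_on UNIV (\<lambda>z. s(j := z))" for s :: "nat \<Rightarrow> complex" and j
    by (intro continuous_intros continuous_on_id)
  have upd_open: "open {z. s(j := z) \<in> V}" if "open V" for s :: "nat \<Rightarrow> complex" and j V
    using open_vimage[OF that upd[of s j]] by (simp add: vimage_def)
  have "isCont (\<lambda>s. \<Sum>\<^sub>\<infinity>a\<in>A. f a s) s" if s: "s \<in> \<Omega>" for s
  proof -
    obtain V B where VB: "open V" "s \<in> V" "B summable_on A"
      "\<And>a u. a \<in> A \<Longrightarrow> u \<in> V \<inter> \<Omega> \<Longrightarrow> norm (f a u) \<le> B a" using bd[OF s] by metis
    have ul: "uniform_limit (V \<inter> \<Omega>) (\<lambda>X y. \<Sum>x\<in>X. f x y) (\<lambda>y. \<Sum>\<^sub>\<infinity>x\<in>A. f x y) (finite_subsets_at_top A)"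
      by (rule Weierstrass_m_test_general[OF VB(4) VB(3)]) auto
    have ev: "\<forall>\<^sub>F X in finite_subsets_at_top A. continuous_on (V \<inter> \<Omega>) (\<lambda>y. \<Sum>x\<in>X. f x y)"
    proof (rule eventually_finite_subsets_at_top_weakI)
      fix X assume X: "finite X" "X \<subseteq> A"
      have "continuous_on (V \<inter> \<Omega>) (f x)" if "x \<in> X" for x
        using mholD(2)[OF hol[of x]] that X by (auto intro: continuous_on_subset)
      then show "continuous_on (V \<inter> \<Omega>) (\<lambda>y. \<Sum>x\<in>X. f x y)" by (intro continuous_intros)
    qed
    have "continuous_on (V \<inter> \<Omega>) (\<lambda>y. \<Sum>\<^sub>\<infinity>x\<in>A. f x y)"
      by (rule uniform_limit_theorem[OF ev ul finite_subsets_at_top_neq_bot])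
    from this[THEN continuous_on_interior] show ?thesis using VB s op by (simp add: interior_open open_Int)
  qed
  then have "continuous_on \<Omega> (\<lambda>s. \<Sum>\<^sub>\<infinity>a\<in>A. f a s)" by (simp add: continuous_at_imp_continuous_on)
  moreover have "(\<lambda>z. \<Sum>\<^sub>\<infinity>a\<in>A. f a (s(j := z))) field_differentiable at (s j)" if s: "s \<in> \<Omega>" for s j
  proof -
    let ?U = "{z. s(j := z) \<in> \<Omega>}"
    have "(\<lambda>z. \<Sum>\<^sub>\<infinity>a\<in>A. f a (s(j := z))) holomorphic_on ?U"
    proof (rule holomorphic_infsum)
      show "open ?U" by (rule upd_open[OF op])
      show "(\<lambda>z. f a (s(j := z))) holomorphic_on ?U" if a: "a \<in> A" for a
        unfolding holomorphic_on_def
      proof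
        fix z assume "z \<in> ?U"
        then show "(\<lambda>z. f a (s(j := z))) field_differentiable at z within ?U"
          using mholD(3)[OF hol[OF a], of "s(j := z)" j] by (auto intro: field_differentiable_at_within)
      qed
      fix z assume z: "z \<in> ?U"
      have "s(j := z) \<in> \<Omega>" using z by simp
      from bd[OF this] obtain V B where VB: "open V" "s(j := z) \<in> V" "B summable_on A"
        "\<forall>a\<in>A. \<forall>u\<in>V \<inter> \<Omega>. norm (f a u) \<le> B a" by blast
      show "\<exists>V B. open V \<and> z \<in> V \<and> B summable_on A \<and>
          (\<forall>a\<in>A. \<forall>u\<in>V \<inter> ?U. norm (f a (s(j := u))) \<le> B a)"
        by (rule exI[of _ "{z. s(j := z) \<in> V}"], rule exI[of _ B]) (use VB upd_open in auto)
    qed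
    moreover have "s j \<in> ?U" using s by simp
    ultimately show ?thesis using holomorphic_on_imp_differentiable_at upd_open[OF op] by blast
  qed
  moreover have "depends_upto m (\<lambda>s. \<Sum>\<^sub>\<infinity>a\<in>A. f a s)"
    unfolding depends_upto_def
  proof (intro allI impI infsum_cong)
    fix s s' :: "nat \<Rightarrow> complex" and a assume "\<forall>i\<in>{1..m}. s i = s' i" "a \<in> A"
    then show "f a s = f a s'" by (intro depends_uptoD[OF mholD(4)[OF hol]]) auto
  qed
  ultimately show ?thesis using op by (simp add: mhol_def)
qed

section \<open>Exhaustion by half-boxes and gluing\<close>

text \<open>The boxes exhaust the space and are nested, and each is a product of half-planes, so
  \<open>identity_box\<close> applies to it.\<close>

definition half_box :: "nat \<Rightarrow> nat \<Rightarrow> (nat \<Rightarrow> complex) set" where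
  "half_box m T = {s. \<forall>i\<in>{1..m}. Re (s i) > - real T}"

definition conv_region :: "nat \<Rightarrow> (nat \<Rightarrow> nat) \<Rightarrow> (nat \<Rightarrow> complex) set" where
  "conv_region m e = {s. \<forall>j\<in>{1..m}. Re (\<Sum>i\<in>{j..m}. s i) > (\<Sum>i\<in>{j..m}. 1 / real (e i))}"

lemma open_half_box: "open (half_box m T)"
proof -
  have "half_box m T = (\<Inter>i\<in>{1..m}. {s. Re (s i) > - real T})" by (auto simp: half_box_def)
  also have "open \<dots>"
    by (intro open_INT ballI open_Collect_less continuous_intros) auto
  finally show ?thesis .
qed

lemma half_box_mono: "T \<le> T' \<Longrightarrow> half_box m T \<subseteq> half_box m T'"
  by (fastforce simp: half_box_def)

lemma half_box_ex: "\<exists>T. s \<in> half_box m T"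
proof -
  obtain T where "real T > (\<Sum>i\<in>{1..m}. \<bar>Re (s i)\<bar>)" using reals_Archimedean2 by blast
  moreover have "\<bar>Re (s i)\<bar> \<le> (\<Sum>i\<in>{1..m}. \<bar>Re (s i)\<bar>)" if "i \<in> {1..m}" for i
    using that by (intro member_le_sum) auto
  ultimately have "s \<in> half_box m T" by (fastforce simp: half_box_def)
  then show ?thesis ..
qed

text \<open>Two local continuations live on nested products of half-planes and agree where all
  \<open>Re (s i) > 1\<close> within the smaller one, hence throughout it. The third conclusion
  allows an explicit formula valid on one half-box to be substituted for the global function
  later.\<close>

lemma mhol_glue:
  assumes "\<And>T. \<exists>E. mhol m E (half_box m T) \<and> (\<forall>s\<in>half_box m T \<inter> conv_region m e. E s = G s)"
  obtains E where "mhol m E UNIV" "\<And>s. s \<in> conv_region m e \<Longrightarrow> E s = G s"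
    "\<And>T E'. mhol m E' (half_box m T) \<Longrightarrow> (\<And>s. s \<in> half_box m T \<inter> conv_region m e \<Longrightarrow> E' s = G s) \<Longrightarrow>
       (\<And>s. s \<in> half_box m T \<Longrightarrow> E' s = E s)"
proof -
  have uniq: "E s = E' s"
    if E: "mhol m E (half_box m T)" "\<And>s. s \<in> half_box m T \<inter> conv_region m e \<Longrightarrow> E s = G s"
      and E': "mhol m E' (half_box m T')" "\<And>s. s \<in> half_box m T' \<inter> conv_region m e \<Longrightarrow> E' s = G s"
      and s: "s \<in> half_box m T" "s \<in> half_box m T'" for E E' T T' s
  proof -
    define T0 where "T0 = min T T'"
    have T0: "half_box m T0 \<subseteq> half_box m T" "half_box m T0 \<subseteq> half_box m T'"
      by (intro half_box_mono; simp add: T0_def)+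
    have d: "mhol m (\<lambda>s. E s - E' s) (half_box m T0)"
      by (intro mhol_diff mhol_subset[OF E(1)] mhol_subset[OF E'(1)] open_half_box T0)
    have "E s - E' s = 0"
    proof (rule identity_box[where F = "\<lambda>s. E s - E' s" and s = s and I = "{1..m}"
          and B = "\<lambda>_. {z. Re z > - real T0}" and V = "\<lambda>_. {z. Re z > 1}"])
      show "(\<lambda>z. E (s(j := z)) - E' (s(j := z))) holomorphic_on {z. Re z > - real T0}"
        if s: "\<And>i. i \<in> {1..m} \<Longrightarrow> s i \<in> {z. Re z > - real T0}" for s j
        unfolding holomorphic_on_def
      proof
        fix z assume "z \<in> {z. Re z > - real T0}"
        then have "s(j := z) \<in> half_box m T0" using s by (auto simp: half_box_def)
        from mholD(3)[OF d this, of j]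
        show "(\<lambda>z. E (s(j := z)) - E' (s(j := z))) field_differentiable at z within {z. Re z > - real T0}"
          by (simp add: field_differentiable_at_within)
      qed
      show "E s - E' s = 0" if s: "\<And>i. i \<in> {1..m} \<Longrightarrow> s i \<in> {z. Re z > 1}" for s
      proof -
        have "Re (s i) > 1" if "i \<in> {1..m}" for i using s[OF that] by simp
        then have "s \<in> conv_region m e" unfolding conv_region_def using region_box[of m s] by blast
        moreover have "s \<in> half_box m T0" using s by (fastforce simp: half_box_def)
        ultimately show ?thesis using E(2)[of s] E'(2)[of s] T0[THEN subsetD, of s] by auto
      qed
      show "{z. Re z > 1} \<noteq> {}" using exI[of "\<lambda>z. Re z > 1" 2] by auto
      show "connected {z. Re z > - real T0}" by (intro convex_connected convex_halfspace_Re_gt)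
    qed (use s in \<open>auto simp: half_box_def T0_def min_def open_halfspace_Re_gt\<close>)
    then show ?thesis by simp
  qed
  from assms have "\<forall>T. \<exists>E. mhol m E (half_box m T) \<and> (\<forall>s\<in>half_box m T \<inter> conv_region m e. E s = G s)"
    by blast
  from choice[OF this] obtain EE where EE: "\<And>T. mhol m (EE T) (half_box m T)"
    "\<And>T s. s \<in> half_box m T \<inter> conv_region m e \<Longrightarrow> EE T s = G s" by blast
  \<comment> \<open>The choice of \<open>T\<close> is immaterial by \<open>uniq\<close>; the least
    one only makes \<open>E\<close> a definite function.\<close>
  define E where "E s = EE (LEAST T. s \<in> half_box m T) s" for s
  have L: "s \<in> half_box m (LEAST T. s \<in> half_box m T)" for s
    by (rule LeastI_ex) (rule half_box_ex)
  have E_eq: "E s = EE T s" if "s \<in> half_box m T" for s T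
    unfolding E_def by (rule uniq[OF EE EE L that])
  show ?thesis
  proof (rule that[of E])
    have "isCont E s" for s
    proof -
      obtain T where T: "s \<in> half_box m T" using half_box_ex by blast
      have "continuous_on (half_box m T) E"
        using mholD(2)[OF EE(1)[of T]] E_eq by (simp cong: continuous_on_cong)
      then show ?thesis using T open_half_box continuous_on_eq_continuous_at by blast
    qed
    then have "continuous_on UNIV E" by (simp add: continuous_at_imp_continuous_on)
    moreover have "(\<lambda>z. E (s(j := z))) field_differentiable at (s j)" for s j
    proof -
      obtain T where T: "s \<in> half_box m T" using half_box_ex by blast
      have "continuous_on UNIV (\<lambda>z. s(j := z))"
        by (intro continuous_intros continuous_on_id)
      from open_vimage[OF open_half_box this, of m T]
      have o: "open {z. s(j := z) \<in> half_box m T}" by (simp add: vimage_def)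
      obtain D where "((\<lambda>z. EE T (s(j := z))) has_field_derivative D) (at (s j))"
        using mholD(3)[OF EE(1) T] by (auto simp: field_differentiable_def)
      then have "((\<lambda>z. E (s(j := z))) has_field_derivative D) (at (s j))"
        by (rule has_field_derivative_transform_within_open[OF _ o]) (use T E_eq in auto)
      then show ?thesis by (auto simp: field_differentiable_def)
    qed
    moreover have "depends_upto m E"
      unfolding depends_upto_def
    proof (intro allI impI)
      fix s s' :: "nat \<Rightarrow> complex" assume *: "\<forall>i\<in>{1..m}. s i = s' i"
      obtain T where T: "s \<in> half_box m T" using half_box_ex by blast
      then have T': "s' \<in> half_box m T" using * by (auto simp: half_box_def)
      show "E s = E s'"
        unfolding E_eq[OF T] E_eq[OF T'] using depends_uptoD[OF mholD(4)[OF EE(1)]] * by blast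
    qed
    ultimately show "mhol m E UNIV" by (simp add: mhol_def)
    show "E s = G s" if "s \<in> conv_region m e" for s using EE(2) L that by (auto simp: E_def)
    show "E' s = E s" if "mhol m E' (half_box m T)"
      "\<And>s. s \<in> half_box m T \<inter> conv_region m e \<Longrightarrow> E' s = G s" "s \<in> half_box m T" for T E' s
      unfolding E_eq[OF that(3)] using uniq[OF that(1) that(2) EE that(3) that(3)] by blast
  qed
qed

subsection \<open>Absolute convergence\<close>

text \<open>Mean value theorem for \<open>x powr (1 - p)\<close>. The right-hand side telescopes,
  which replaces the integral test in the next lemma.\<close>

lemma powr_telescope_bound:
  fixes x p :: real
  assumes "x > 0" "p > 1"
  shows "(x + 1) powr (- p) \<le> (x powr (1 - p) - (x + 1) powr (1 - p)) / (p - 1)"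
proof -
  have "\<exists>z>x. z < x + 1 \<and> (x + 1) powr (1 - p) - x powr (1 - p) = (x + 1 - x) * ((1 - p) * z powr (- p))"
  proof (rule MVT2)
    fix z assume "x \<le> z"
    then have "z > 0" using assms by linarith
    then show "((\<lambda>z. z powr (1 - p)) has_real_derivative (1 - p) * z powr (- p)) (at z)"
      using has_real_derivative_powr[of z "1 - p"] by simp
  qed simp
  then obtain z where z: "x < z" "z < x + 1"
    "(x + 1) powr (1 - p) - x powr (1 - p) = (1 - p) * z powr (- p)" by auto
  have "(x + 1) powr (- p) \<le> z powr (- p)"
    using z assms by (intro powr_mono2') auto
  then have "(p - 1) * (x + 1) powr (- p) \<le> (p - 1) * z powr (- p)"
    using assms(2) by (intro mult_left_mono) auto
  also have "\<dots> = x powr (1 - p) - (x + 1) powr (1 - p)" using z(3) by (simp add: algebra_simps)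
  finally show ?thesis using assms(2) by (simp add: field_simps)
qed

lemma sum_shift_powr_le:
  fixes B p :: real
  assumes "B \<ge> 1" "p > 1"
  shows "(\<Sum>k<n. (B + real k) powr (- p)) \<le> (p / (p - 1)) * B powr (1 - p)"
proof -
  have *: "(\<Sum>k<Suc n. (B + real k) powr (- p)) \<le>
      B powr (- p) + (B powr (1 - p) - (B + real n) powr (1 - p)) / (p - 1)" for n
  proof (induction n)
    case (Suc n)
    have "(B + real n + 1) powr (- p) \<le>
        ((B + real n) powr (1 - p) - (B + real n + 1) powr (1 - p)) / (p - 1)"
      using assms by (intro powr_telescope_bound) auto
    then show ?case using Suc by (simp add: diff_divide_distrib add_ac)
  qed simp
  have "(\<Sum>k<n. (B + real k) powr (- p)) \<le> (\<Sum>k<Suc n. (B + real k) powr (- p))" by simp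
  also have "\<dots> \<le> B powr (- p) + (B powr (1 - p) - (B + real n) powr (1 - p)) / (p - 1)" by (rule *)
  also have "\<dots> \<le> B powr (1 - p) + B powr (1 - p) / (p - 1)"
    using assms by (intro add_mono powr_mono divide_right_mono) auto
  also have "\<dots> = (p / (p - 1)) * B powr (1 - p)" using assms by (simp add: field_simps)
  finally show ?thesis .
qed

text \<open>With \<open>B = A powr (1/d)\<close> the term is comparable to
  \<open>(B + k) powr (- d \<sigma>)\<close>. The point is the explicit power
  \<open>1/d - \<sigma>\<close> of \<open>A\<close> in the bound: it is the exponent handed to the
  preceding variable when several sums are nested.\<close>

lemma sum_powr_bound:
  fixes A \<sigma> :: real and d :: nat
  assumes d: "d \<ge> 1" and \<sigma>: "\<sigma> > 1 / real d" and A: "A \<ge> 1"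
  shows "(\<lambda>k::nat. (A + real k ^ d) powr (- \<sigma>)) summable_on UNIV"
    "(\<Sum>\<^sub>\<infinity>k::nat. (A + real k ^ d) powr (- \<sigma>)) \<le>
       2 powr (d * \<sigma>) * (d * \<sigma> / (d * \<sigma> - 1)) * A powr (1 / d - \<sigma>)"
proof -
  define p where "p = d * \<sigma>"
  define B where "B = A powr (1 / d)"
  have p: "p > 1" using \<sigma> d by (simp add: p_def field_simps)
  have \<sigma>0: "\<sigma> > 0" using \<sigma> by (smt (verit) of_nat_0_le_iff divide_nonneg_nonneg)
  have B: "B \<ge> 1" using A by (simp add: B_def ge_one_powr_ge_zero)
  have Bd: "B ^ d = A" using A d by (simp add: B_def powr_power)
  have term_le: "(A + real k ^ d) powr (- \<sigma>) \<le> 2 powr p * (B + real k) powr (- p)" for k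
  proof -
    \<comment> \<open>The mean of \<open>B\<close> and \<open>k\<close> is at most their maximum,
      and the \<open>d\<close>-th power of the maximum is one of the two summands \<open>A\<close>,
      \<open>k ^ d\<close>.\<close>
    have "((B + real k) / 2) ^ d \<le> (max B (real k)) ^ d" using B by (intro power_mono) auto
    also have "\<dots> \<le> A + real k ^ d" using Bd A by (auto simp: max_def)
    finally have "(A + real k ^ d) powr (- \<sigma>) \<le> (((B + real k) / 2) ^ d) powr (- \<sigma>)"
      using B \<sigma>0 by (intro powr_mono2') auto
    also have "\<dots> = ((B + real k) / 2) powr (- p)"
      using B by (simp add: p_def powr_realpow[symmetric] powr_powr del: powr_realpow)
    also have "\<dots> = 2 powr p * (B + real k) powr (- p)"
      using B by (simp add: powr_divide powr_minus divide_simps)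
    finally show ?thesis .
  qed
  have part: "(\<Sum>k<n. (A + real k ^ d) powr (- \<sigma>)) \<le>
     2 powr (d * \<sigma>) * (d * \<sigma> / (d * \<sigma> - 1)) * A powr (1 / d - \<sigma>)" for n
  proof -
    have "(\<Sum>k<n. (A + real k ^ d) powr (- \<sigma>)) \<le> (\<Sum>k<n. 2 powr p * (B + real k) powr (- p))"
      by (intro sum_mono term_le)
    also have "\<dots> \<le> 2 powr p * ((p / (p - 1)) * B powr (1 - p))"
      unfolding sum_distrib_left[symmetric] by (intro mult_left_mono sum_shift_powr_le B p) auto
    also have "B powr (1 - p) = A powr (1 / d - \<sigma>)"
      using d A by (simp add: B_def powr_powr p_def field_simps)
    finally show ?thesis by (simp add: p_def)
  qed
  have sm: "summable (\<lambda>k. (A + real k ^ d) powr (- \<sigma>))"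
    using part by (intro summableI_nonneg_bounded) auto
  then have hs: "((\<lambda>k. (A + real k ^ d) powr (- \<sigma>)) has_sum (\<Sum>k. (A + real k ^ d) powr (- \<sigma>))) UNIV"
    by (intro sums_nonneg_imp_has_sum summable_sums) auto
  then show "(\<lambda>k::nat. (A + real k ^ d) powr (- \<sigma>)) summable_on UNIV"
    by (auto simp: summable_on_def)
  show "(\<Sum>\<^sub>\<infinity>k::nat. (A + real k ^ d) powr (- \<sigma>)) \<le>
       2 powr (d * \<sigma>) * (d * \<sigma> / (d * \<sigma> - 1)) * A powr (1 / d - \<sigma>)"
    unfolding infsumI[OF hs] by (rule suminf_le_const[OF sm part])
qed

text \<open>The summand 1 makes this quantity at least 1 also for \<open>j = 0\<close>, so that the induction over the
  number of variables can start at 0.\<close>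

definition lin_size :: "(nat \<Rightarrow> nat) \<Rightarrow> (nat \<Rightarrow> nat) \<Rightarrow> nat \<Rightarrow> real" where
  "lin_size e a j = 1 + (\<Sum>i\<in>{1..j}. real (a i) ^ e i)"

lemma lin_size_ge_1: "lin_size e a j \<ge> 1"
  by (simp add: lin_size_def sum_nonneg)

lemma lin_size_upd: "j \<le> m \<Longrightarrow> lin_size e (a(Suc m := k)) j = lin_size e a j"
  by (auto simp: lin_size_def intro!: sum.cong)

lemma lin_size_Suc: "lin_size e (a(Suc m := k)) (Suc m) = lin_size e a m + real k ^ e (Suc m)"
proof -
  have "(\<Sum>i\<in>{1..m}. real ((a(Suc m := k)) i) ^ e i) = (\<Sum>i\<in>{1..m}. real (a i) ^ e i)"
    by (rule sum.cong) auto
  then show ?thesis by (simp add: lin_size_def)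
qed

lemma bij_betw_PiE_Suc:
  "bij_betw (\<lambda>(a, k). a(Suc m := k)) (({1..m} \<rightarrow>\<^sub>E Y) \<times> Y) ({1..Suc m} \<rightarrow>\<^sub>E Y)"
proof (rule bij_betwI[where g = "\<lambda>a. (a(Suc m := undefined), a (Suc m))"])
  show "(\<lambda>(a, k). a(Suc m := k)) \<in> ({1..m} \<rightarrow>\<^sub>E Y) \<times> Y \<rightarrow> {1..Suc m} \<rightarrow>\<^sub>E Y"
    by (auto simp: PiE_iff extensional_def)
  show "(\<lambda>a. (a(Suc m := undefined), a (Suc m))) \<in> ({1..Suc m} \<rightarrow>\<^sub>E Y) \<rightarrow> ({1..m} \<rightarrow>\<^sub>E Y) \<times> Y"
    by (auto simp: PiE_iff extensional_def)
qed (auto simp: PiE_iff extensional_def fun_eq_iff)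

lemma prod_lin_size_upd:
  "(\<Prod>j\<in>{1..Suc m}. lin_size e (a(Suc m := k)) j powr (- \<sigma> j)) =
     (\<Prod>j\<in>{1..m}. lin_size e a j powr (- \<sigma> j)) * (lin_size e a m + real k ^ e (Suc m)) powr (- \<sigma> (Suc m))"
  by (simp add: lin_size_Suc lin_size_upd)

lemma prod_upd_last:
  fixes f :: "nat \<Rightarrow> 'b \<Rightarrow> 'a::comm_monoid_mult"
  assumes "m \<ge> 1"
  shows "(\<Prod>j\<in>{1..m}. f j ((s(m := t)) j)) = (\<Prod>j\<in>{1..m - 1}. f j (s j)) * f m t"
proof -
  obtain k where k: "m = Suc k" using assms by (cases m) auto
  have "(\<Prod>j\<in>{1..k}. f j ((s(m := t)) j)) = (\<Prod>j\<in>{1..k}. f j (s j))"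
    by (rule prod.cong) (auto simp: k)
  then show ?thesis by (simp add: k)
qed

text \<open>Summing out the last variable multiplies the \<open>m\<close>-th factor by the power
  \<open>1/d - \<sigma> (Suc m)\<close>. The new exponents \<open>\<tau>\<close> satisfy the
  hypothesis for \<open>m\<close> variables because each tail sum and its lower bound both drop by
  \<open>1/d\<close>.\<close>

lemma summable_lin_size:
  assumes "\<And>i. i \<in> {1..m} \<Longrightarrow> e i \<ge> 1"
    and "\<And>j. j \<in> {1..m} \<Longrightarrow> (\<Sum>i\<in>{j..m}. \<sigma> i) > (\<Sum>i\<in>{j..m}. 1 / real (e i))"
  shows "(\<lambda>a. \<Prod>j\<in>{1..m}. lin_size e a j powr (- \<sigma> j)) summable_on ({1..m} \<rightarrow>\<^sub>E UNIV)"
  using assms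
proof (induction m arbitrary: \<sigma>)
  case 0
  then show ?case by (intro summable_on_finite) simp
next
  case (Suc m)
  define d where "d = e (Suc m)"
  have d: "d \<ge> 1" using Suc.prems(1)[of "Suc m"] by (simp add: d_def)
  have \<sigma>m: "\<sigma> (Suc m) > 1 / real d" using Suc.prems(2)[of "Suc m"] by (simp add: d_def)
  define \<tau> where "\<tau> = \<sigma>(m := \<sigma> m + \<sigma> (Suc m) - 1 / d)"
  have IH: "(\<lambda>a. \<Prod>j\<in>{1..m}. lin_size e a j powr (- \<tau> j)) summable_on ({1..m} \<rightarrow>\<^sub>E UNIV)"
  proof (rule Suc.IH)
    fix j assume j: "j \<in> {1..m}"
    then have "{j..m} = insert m {j..<m}" by auto
    then have "(\<Sum>i\<in>{j..m}. \<tau> i) = (\<Sum>i\<in>{j..<m}. \<sigma> i) + \<tau> m" by (simp add: \<tau>_def)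
    also have "\<dots> = (\<Sum>i\<in>{j..Suc m}. \<sigma> i) - 1 / d"
      using j \<open>{j..m} = insert m {j..<m}\<close> by (simp add: \<tau>_def)
    also have "\<dots> > (\<Sum>i\<in>{j..Suc m}. 1 / real (e i)) - 1 / d" using Suc.prems(2)[of j] j by simp
    also have "(\<Sum>i\<in>{j..Suc m}. 1 / real (e i)) - 1 / d = (\<Sum>i\<in>{j..m}. 1 / real (e i))"
      using j by (simp add: d_def)
    finally show "(\<Sum>i\<in>{j..m}. 1 / real (e i)) < (\<Sum>i\<in>{j..m}. \<tau> i)" .
  qed (use Suc.prems in auto)
  define P where "P = (\<lambda>a. \<Prod>j\<in>{1..m}. lin_size e a j powr (- \<sigma> j))"
  define G where "G = (\<lambda>(a, k). P a * (lin_size e a m + real k ^ d) powr (- \<sigma> (Suc m)))"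
  define C where "C = 2 powr (d * \<sigma> (Suc m)) * (d * \<sigma> (Suc m) / (d * \<sigma> (Suc m) - 1))"
  have P0: "P a \<ge> 0" for a by (auto simp: P_def intro: prod_nonneg)
  have Gs: "G summable_on (({1..m} \<rightarrow>\<^sub>E UNIV) \<times> UNIV)"
  proof (rule summable_on_SigmaI)
    fix a :: "nat \<Rightarrow> nat"
    show "((\<lambda>k. G (a, k)) has_sum (P a * (\<Sum>\<^sub>\<infinity>k. (lin_size e a m + real k ^ d) powr (- \<sigma> (Suc m))))) UNIV"
      unfolding G_def prod.case
      by (intro has_sum_cmult_right has_sum_infsum sum_powr_bound(1) d \<sigma>m lin_size_ge_1)
  next
    show "(\<lambda>a. P a * (\<Sum>\<^sub>\<infinity>k. (lin_size e a m + real k ^ d) powr (- \<sigma> (Suc m)))) summable_on ({1..m} \<rightarrow>\<^sub>E UNIV)"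
    proof (rule summable_on_comparison_test[OF summable_on_cmult_right[OF IH, of C]])
      fix a
      have "P a * (\<Sum>\<^sub>\<infinity>k. (lin_size e a m + real k ^ d) powr (- \<sigma> (Suc m))) \<le>
          P a * (C * lin_size e a m powr (1 / d - \<sigma> (Suc m)))"
        unfolding C_def by (intro mult_left_mono sum_powr_bound(2) d \<sigma>m lin_size_ge_1 P0)
      also have "P a * lin_size e a m powr (1 / d - \<sigma> (Suc m)) = (\<Prod>j\<in>{1..m}. lin_size e a j powr (- \<tau> j))"
      proof (cases "m = 0")
        \<comment> \<open>Here \<open>lin_size e a 0 = 1\<close>, so the leftover power is
          \<open>1\<close> and there is no exponent to absorb it.\<close>
        case True
        then show ?thesis by (simp add: P_def lin_size_def)
      next
        case False
        then obtain k where k: "m = Suc k" by (cases m) auto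
        have "(\<Prod>j\<in>{1..m}. lin_size e a j powr (- \<tau> j)) =
            (\<Prod>j\<in>{1..m - 1}. lin_size e a j powr (- \<sigma> j)) * lin_size e a m powr (- (\<sigma> m + \<sigma> (Suc m) - 1 / d))"
          unfolding \<tau>_def using prod_upd_last[of m "\<lambda>j t. lin_size e a j powr (- t)"] False by simp
        also have "- (\<sigma> m + \<sigma> (Suc m) - 1 / d) = - \<sigma> m + (1 / d - \<sigma> (Suc m))" by simp
        finally show ?thesis unfolding powr_add by (simp add: k P_def)
      qed
      then have "P a * (C * lin_size e a m powr (1 / d - \<sigma> (Suc m))) =
         C * (\<Prod>j\<in>{1..m}. lin_size e a j powr (- \<tau> j))"
        by (simp only: mult.left_commute)
      finally show "P a * (\<Sum>\<^sub>\<infinity>k. (lin_size e a m + real k ^ d) powr (- \<sigma> (Suc m))) \<le>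
          C * (\<Prod>j\<in>{1..m}. lin_size e a j powr (- \<tau> j))" .
      show "0 \<le> P a * (\<Sum>\<^sub>\<infinity>k. (lin_size e a m + real k ^ d) powr (- \<sigma> (Suc m)))"
        by (intro mult_nonneg_nonneg P0 infsum_nonneg) simp
    qed
  qed (auto simp: G_def P0)
  have Geq: "G = (\<lambda>x. (\<lambda>a. \<Prod>j\<in>{1..Suc m}. lin_size e a j powr (- \<sigma> j)) ((\<lambda>(a, k). a(Suc m := k)) x))"
  proof (rule ext)
    fix x :: "(nat \<Rightarrow> nat) \<times> nat"
    obtain a k where x: "x = (a, k)" by (cases x)
    show "G x = (\<lambda>a. \<Prod>j\<in>{1..Suc m}. lin_size e a j powr (- \<sigma> j)) ((\<lambda>(a, k). a(Suc m := k)) x)"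
      by (simp only: x G_def P_def d_def prod_lin_size_upd prod.case)
  qed
  show ?case
    by (rule iffD1[OF summable_on_reindex_bij_betw[OF bij_betw_PiE_Suc] Gs[unfolded Geq]])
qed

section \<open>Complex powers of the linear forms against real sizes\<close>

text \<open>\<open>\<bar>z powr w\<bar> = exp (Re (w * Ln z))\<close>, where
  \<open>Im (Ln z)\<close> is at most \<open>pi\<close> in modulus and \<open>ln (norm z)\<close>
  differs from \<open>ln L\<close> by a bounded amount. The constant depends only on
  \<open>c\<close>, \<open>H\<close> and \<open>Y\<close>, so the bound is uniform in the point and
  locally uniform in the exponent.\<close>

lemma norm_powr_le:
  fixes z w :: complex
  assumes "c > 0" "H > 0" "L > 0" "c * L \<le> norm z" "norm z \<le> H * L" "norm w \<le> Y"
  shows "norm (z powr w) \<le> exp (Y * (pi + \<bar>ln c\<bar> + \<bar>ln H\<bar>)) * L powr Re w"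
proof -
  define q where "q = norm z / L"
  have q: "c \<le> q" "q \<le> H" using assms by (auto simp: q_def field_simps)
  have q0: "q > 0" using q assms by linarith
  have z: "norm z = L * q" "z \<noteq> 0" using assms q0 by (auto simp: q_def)
  have lq: "\<bar>ln q\<bar> \<le> \<bar>ln c\<bar> + \<bar>ln H\<bar>"
  proof -
    have "ln c \<le> ln q" "ln q \<le> ln H" using q q0 assms by auto
    then show ?thesis by linarith
  qed
  have "Re (w * Ln z) = Re w * ln L + Re w * ln q - Im w * Im (Ln z)"
    using z q0 assms by (simp add: ln_mult algebra_simps)
  also have "\<dots> \<le> Re w * ln L + Y * (\<bar>ln c\<bar> + \<bar>ln H\<bar>) + Y * pi"
  proof -
    have Y: "Y \<ge> 0" using assms(6) norm_ge_zero order_trans by blast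
    have "Re w * ln q \<le> \<bar>Re w\<bar> * \<bar>ln q\<bar>" by (metis abs_ge_self abs_mult)
    also have "\<dots> \<le> Y * (\<bar>ln c\<bar> + \<bar>ln H\<bar>)"
      using lq abs_Re_le_cmod[of w] assms(6) Y by (intro mult_mono) auto
    finally have 1: "Re w * ln q \<le> Y * (\<bar>ln c\<bar> + \<bar>ln H\<bar>)" .
    have "- (Im w * Im (Ln z)) \<le> \<bar>Im w\<bar> * \<bar>Im (Ln z)\<bar>" by (metis abs_ge_minus_self abs_mult)
    also have "\<dots> \<le> Y * pi"
      using abs_Im_le_cmod[of w] assms(6) Y mpi_less_Im_Ln[OF z(2)] Im_Ln_le_pi[OF z(2)]
      by (intro mult_mono) auto
    finally show ?thesis using 1 by linarith
  qed
  finally have "Re (w * Ln z) \<le> Y * (pi + \<bar>ln c\<bar> + \<bar>ln H\<bar>) + Re w * ln L" by (simp add: algebra_simps)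
  then have "exp (Re (w * Ln z)) \<le> exp (Y * (pi + \<bar>ln c\<bar> + \<bar>ln H\<bar>)) * exp (Re w * ln L)"
    by (simp flip: exp_add)
  then show ?thesis using z assms by (simp add: powr_def)
qed

definition lin_form :: "(nat \<Rightarrow> complex) \<Rightarrow> (nat \<Rightarrow> nat) \<Rightarrow> (nat \<Rightarrow> nat) \<Rightarrow> nat \<Rightarrow> complex" where
  "lin_form \<eta> e a j = (\<Sum>i\<in>{1..j}. \<eta> i * of_nat (a i) ^ e i)"

lemma lin_form_upd: "j \<le> m \<Longrightarrow> lin_form \<eta> e (a(Suc m := k)) j = lin_form \<eta> e a j"
  by (auto simp: lin_form_def intro!: sum.cong)

lemma lin_form_Suc:
  "lin_form \<eta> e (a(Suc m := k)) (Suc m) = lin_form \<eta> e a m + \<eta> (Suc m) * of_nat k ^ e (Suc m)"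
proof -
  have "(\<Sum>i\<in>{1..m}. \<eta> i * of_nat ((a(Suc m := k)) i) ^ e i) = (\<Sum>i\<in>{1..m}. \<eta> i * of_nat (a i) ^ e i)"
    by (rule sum.cong) auto
  then show ?thesis by (simp add: lin_form_def)
qed

lemma coeff_bounds:
  fixes \<eta> :: "nat \<Rightarrow> complex"
  assumes "\<And>i. i \<in> {1..m} \<Longrightarrow> Re (\<eta> i) > 0"
  obtains c H where "c > 0" "H > 0" "\<And>i. i \<in> {1..m} \<Longrightarrow> c \<le> Re (\<eta> i)" "\<And>i. i \<in> {1..m} \<Longrightarrow> norm (\<eta> i) \<le> H"
proof
  define c where "c = Min (insert 1 ((\<lambda>i. Re (\<eta> i)) ` {1..m}))"
  define H where "H = Max (insert 1 ((\<lambda>i. norm (\<eta> i)) ` {1..m}))"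
  show "c > 0" using assms by (auto simp: c_def)
  have "H \<ge> 1" by (simp add: H_def)
  then show "H > 0" by simp
  show "c \<le> Re (\<eta> i)" if "i \<in> {1..m}" for i unfolding c_def by (rule Min_le) (use that in auto)
  show "norm (\<eta> i) \<le> H" if "i \<in> {1..m}" for i unfolding H_def by (rule Max_ge) (use that in auto)
qed

lemma lin_form_bounds:
  assumes "c > 0" "\<And>i. i \<in> {1..m} \<Longrightarrow> c \<le> Re (\<eta> i)" "\<And>i. i \<in> {1..m} \<Longrightarrow> norm (\<eta> i) \<le> H"
    and a: "\<And>i. i \<in> {1..m} \<Longrightarrow> a i \<ge> 1" and j: "j \<in> {1..m}"
  shows "c / 2 * lin_size e a j \<le> Re (lin_form \<eta> e a j)" "norm (lin_form \<eta> e a j) \<le> H * lin_size e a j"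
proof -
  define Q where "Q = (\<Sum>i\<in>{1..j}. real (a i) ^ e i)"
  have H: "H \<ge> 0" using assms(3)[OF j] norm_ge_zero order_trans by blast
  have "1 \<le> real (a j) ^ e j" using a[OF j] by (intro one_le_power) auto
  also have "\<dots> \<le> Q" unfolding Q_def using j by (intro member_le_sum) auto
  finally have Q: "Q \<ge> 1" .
  \<comment> \<open>As \<open>Q \<ge> 1\<close>, the extra summand in \<open>lin_size\<close> costs
    a factor 2: \<open>1 + Q \<le> 2 * Q\<close>.\<close>
  have "c / 2 * lin_size e a j \<le> c * Q"
    using Q assms(1) unfolding lin_size_def Q_def[symmetric] by simp
  also have "\<dots> = (\<Sum>i\<in>{1..j}. c * real (a i) ^ e i)" by (simp add: Q_def sum_distrib_left)
  also have "\<dots> \<le> (\<Sum>i\<in>{1..j}. Re (\<eta> i) * real (a i) ^ e i)"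
    using assms(2) j by (intro sum_mono mult_right_mono) auto
  also have "\<dots> = Re (lin_form \<eta> e a j)"
    by (simp add: lin_form_def flip: of_nat_power)
  finally show "c / 2 * lin_size e a j \<le> Re (lin_form \<eta> e a j)" .
  have "norm (lin_form \<eta> e a j) \<le> (\<Sum>i\<in>{1..j}. norm (\<eta> i) * real (a i) ^ e i)"
    unfolding lin_form_def by (rule order_trans[OF norm_sum]) (simp add: norm_mult norm_power)
  also have "\<dots> \<le> (\<Sum>i\<in>{1..j}. H * real (a i) ^ e i)"
    using assms(3) j by (intro sum_mono mult_right_mono) auto
  also have "\<dots> = H * Q" by (simp add: Q_def sum_distrib_left)
  also have "\<dots> \<le> H * lin_size e a j" using H by (intro mult_left_mono) (auto simp: lin_size_def Q_def)
  finally show "norm (lin_form \<eta> e a j) \<le> H * lin_size e a j" .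
qed

lemma lin_form_nz:
  assumes "\<And>i. i \<in> {1..m} \<Longrightarrow> Re (\<eta> i) > 0" "\<And>i. i \<in> {1..m} \<Longrightarrow> a i \<ge> 1" "j \<in> {1..m}"
  shows "Re (lin_form \<eta> e a j) > 0"
proof -
  obtain c H where c: "c > 0" "H > 0" "\<And>i. i \<in> {1..m} \<Longrightarrow> c \<le> Re (\<eta> i)" "\<And>i. i \<in> {1..m} \<Longrightarrow> norm (\<eta> i) \<le> H"
    using coeff_bounds[of m \<eta>, OF assms(1)] by blast
  have "0 < c / 2 * lin_size e a j" using c(1) lin_size_ge_1[of e a j] by simp
  also have "\<dots> \<le> Re (lin_form \<eta> e a j)" using lin_form_bounds(1)[OF c(1,3,4) assms(2,3)] .
  finally show ?thesis .
qed

lemma prod_powr_bound: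
  assumes c: "c > 0" "H > 0" "\<And>i. i \<in> {1..m} \<Longrightarrow> c \<le> Re (\<eta> i)" "\<And>i. i \<in> {1..m} \<Longrightarrow> norm (\<eta> i) \<le> H"
    and a: "\<And>i. i \<in> {1..m} \<Longrightarrow> a i \<ge> 1" and Y: "\<And>j. j \<in> {1..m} \<Longrightarrow> norm (s j) \<le> Y"
  shows "norm (\<Prod>j\<in>{1..m}. lin_form \<eta> e a j powr (- s j)) \<le>
    exp (Y * (pi + \<bar>ln (c / 2)\<bar> + \<bar>ln H\<bar>)) ^ m * (\<Prod>j\<in>{1..m}. lin_size e a j powr (- Re (s j)))"
proof -
  have "norm (\<Prod>j\<in>{1..m}. lin_form \<eta> e a j powr (- s j)) \<le>
     (\<Prod>j\<in>{1..m}. exp (Y * (pi + \<bar>ln (c / 2)\<bar> + \<bar>ln H\<bar>)) * lin_size e a j powr (- Re (s j)))"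
    unfolding prod_norm[symmetric]
  proof (rule prod_mono, rule conjI)
    fix j assume j: "j \<in> {1..m}"
    have L: "lin_size e a j > 0" using lin_size_ge_1[of e a j] by linarith
    note b = lin_form_bounds[OF c(1,3,4) a j, where e = e]
    have "c / 2 * lin_size e a j \<le> norm (lin_form \<eta> e a j)"
      by (rule order_trans[OF b(1) complex_Re_le_cmod])
    then show "norm (lin_form \<eta> e a j powr (- s j)) \<le>
        exp (Y * (pi + \<bar>ln (c / 2)\<bar> + \<bar>ln H\<bar>)) * lin_size e a j powr (- Re (s j))"
      using norm_powr_le[of "c / 2" H "lin_size e a j" "lin_form \<eta> e a j" "- s j" Y] b(2) c(1,2) L Y[OF j]
      by simp
  qed simp
  then show ?thesis by (simp add: prod.distrib)
qed

lemma multizeta_series_alt: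
  "multizeta_series m e \<eta> s = (\<Sum>\<^sub>\<infinity>a\<in>{1..m} \<rightarrow>\<^sub>E {1..}. \<Prod>j\<in>{1..m}. lin_form \<eta> e a j powr (- s j))"
  by (simp add: multizeta_series_def lin_form_def)

lemma multizeta_abs_summable:
  assumes e: "\<And>i. i \<in> {1..m} \<Longrightarrow> e i \<ge> 1" and \<eta>: "\<And>i. i \<in> {1..m} \<Longrightarrow> Re (\<eta> i) > 0"
    and s: "s \<in> conv_region m e"
  shows "(\<lambda>a. norm (\<Prod>j\<in>{1..m}. lin_form \<eta> e a j powr (- s j))) summable_on ({1..m} \<rightarrow>\<^sub>E {1..})"
proof -
  obtain c H where c: "c > 0" "H > 0" "\<And>i. i \<in> {1..m} \<Longrightarrow> c \<le> Re (\<eta> i)" "\<And>i. i \<in> {1..m} \<Longrightarrow> norm (\<eta> i) \<le> H"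
    using coeff_bounds[of m \<eta>, OF \<eta>] by blast
  define Y where "Y = (\<Sum>j\<in>{1..m}. norm (s j))"
  have Y: "norm (s j) \<le> Y" if "j \<in> {1..m}" for j
    unfolding Y_def using that by (intro member_le_sum) auto
  have "(\<lambda>a. \<Prod>j\<in>{1..m}. lin_size e a j powr (- Re (s j))) summable_on ({1..m} \<rightarrow>\<^sub>E UNIV)"
    using s by (intro summable_lin_size e) (auto simp: conv_region_def)
  then have "(\<lambda>a. \<Prod>j\<in>{1..m}. lin_size e a j powr (- Re (s j))) summable_on ({1..m} \<rightarrow>\<^sub>E {1..})"
    by (rule summable_on_subset) (intro PiE_mono, simp)
  then have "(\<lambda>a. exp (Y * (pi + \<bar>ln (c / 2)\<bar> + \<bar>ln H\<bar>)) ^ m *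
      (\<Prod>j\<in>{1..m}. lin_size e a j powr (- Re (s j)))) summable_on ({1..m} \<rightarrow>\<^sub>E {1..})"
    by (rule summable_on_cmult_right)
  then show ?thesis
  proof (rule summable_on_comparison_test)
    fix a assume a: "a \<in> {1..m} \<rightarrow>\<^sub>E {1::nat..}"
    have "a i \<ge> 1" if "i \<in> {1..m}" for i using PiE_mem[OF a that] by simp
    from prod_powr_bound[OF c this Y]
    show "norm (\<Prod>j\<in>{1..m}. lin_form \<eta> e a j powr (- s j)) \<le>
      exp (Y * (pi + \<bar>ln (c / 2)\<bar> + \<bar>ln H\<bar>)) ^ m * (\<Prod>j\<in>{1..m}. lin_size e a j powr (- Re (s j)))" .
  qed simp
qed

subsection \<open>Euler-Maclaurin summation\<close>

text \<open>These are \<open>B_k / k!\<close> and \<open>B_k(x) / k!\<close>; the normalization makes each function the derivative of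
  the next one.\<close>

definition bernoulli_coeff :: "nat \<Rightarrow> real" where
  "bernoulli_coeff k = fps_nth (fps_X / (fps_exp 1 - 1)) k"

definition bernoulli_fun :: "nat \<Rightarrow> real \<Rightarrow> real" where
  "bernoulli_fun k x = (\<Sum>i\<le>k. bernoulli_coeff (k - i) * x ^ i / fact i)"

lemma bernoulli_fps: "(fps_X / (fps_exp 1 - 1)) * (fps_exp 1 - 1) = (fps_X :: real fps)"
proof -
  have E1: "subdegree (fps_exp 1 - 1 :: real fps) = 1"
    by (rule subdegreeI) auto
  then have "(fps_exp 1 - 1 :: real fps) \<noteq> 0" by auto
  then have "(fps_exp 1 - 1) dvd (fps_X :: real fps)"
    using E1 by (subst fps_dvd_iff) auto
  then show ?thesis by (rule dvd_div_mult_self)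
qed

text \<open>Coefficients of the product \<open>F * (exp X - 1) = X\<close>; the index
  \<open>i = 0\<close> drops out because \<open>exp X - 1\<close> has no constant term.\<close>

lemma bernoulli_coeff_rec: "(\<Sum>i\<in>{1..k}. bernoulli_coeff (k - i) / fact i) = (if k = 1 then 1 else 0)"
proof -
  let ?F = "fps_X / (fps_exp 1 - 1) :: real fps"
  have "(if k = 1 then 1 else 0 :: real) = fps_nth ((fps_exp 1 - 1) * ?F) k"
    by (subst mult.commute, subst bernoulli_fps) (simp add: fps_X_def)
  also have "\<dots> = (\<Sum>i=0..k. fps_nth (fps_exp 1 - 1) i * bernoulli_coeff (k - i))"
    by (simp only: fps_mult_nth bernoulli_coeff_def)
  also have "\<dots> = (\<Sum>i\<in>{1..k}. fps_nth (fps_exp 1 - 1) i * bernoulli_coeff (k - i))"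
    by (intro sum.mono_neutral_right) auto
  also have "\<dots> = (\<Sum>i\<in>{1..k}. bernoulli_coeff (k - i) / fact i)"
    by (intro sum.cong) (auto simp: divide_simps)
  finally show ?thesis by simp
qed

lemma bernoulli_coeff_0: "bernoulli_coeff 0 = 1" using bernoulli_coeff_rec[of 1] by simp

lemma bernoulli_coeff_1: "bernoulli_coeff 1 = - 1 / 2"
proof -
  have "{1..2} = {1, 2 :: nat}" by auto
  then show ?thesis using bernoulli_coeff_rec[of 2] by (simp add: bernoulli_coeff_0 fact_2)
qed

text \<open>For \<open>F = X / (exp X - 1)\<close> one has \<open>F(-X) = X + F(X)\<close>, so the
  odd part of \<open>F\<close> is \<open>- X / 2\<close>. The substitution of \<open>-X\<close> is
  \<open>N\<close>; multiplication by \<open>exp X\<close> returns to the denominator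
  \<open>E\<close>.\<close>

lemma bernoulli_coeff_odd:
  assumes "odd k" "k \<noteq> 1"
  shows "bernoulli_coeff k = 0"
proof -
  define F where "F = (fps_X / (fps_exp 1 - 1) :: real fps)"
  define E where "E = (fps_exp 1 - 1 :: real fps)"
  define N where "N f = f oo (fps_const (-1) * fps_X)" for f :: "real fps"
  have X0: "fps_nth (fps_const (-1) * fps_X :: real fps) 0 = 0" by simp
  have FE: "F * E = fps_X" unfolding F_def E_def by (rule bernoulli_fps)
  have "N F * N E = N (F * E)" unfolding N_def by (rule fps_compose_mult_distrib[OF X0, symmetric])
  also have "\<dots> = N fps_X" by (simp only: FE)
  also have "N fps_X = - fps_X" by (simp add: N_def fps_X_fps_compose_startby0 flip: fps_const_neg)
  also have "N E = fps_exp (-1) - 1" by (simp add: N_def E_def fps_compose_sub_distrib fps_exp_compose_linear del: fps_const_neg)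
  finally have "N F * (fps_exp (-1) - 1) * fps_exp 1 = - fps_X * fps_exp 1" by simp
  moreover have "(fps_exp (-1) - 1) * fps_exp 1 = (1 - fps_exp 1 :: real fps)"
    by (simp add: algebra_simps flip: fps_exp_add_mult)
  ultimately have "N F * (1 - fps_exp 1) = - fps_X * fps_exp 1" by (simp add: mult.assoc)
  then have "N F * E = fps_X * (E + 1)" by (simp add: E_def algebra_simps)
  also have "\<dots> = (fps_X + F) * E" unfolding FE[symmetric] by (simp add: algebra_simps)
  finally have "N F * E = (fps_X + F) * E" .
  moreover have "E \<noteq> 0" using FE by auto
  ultimately have "N F = fps_X + F" by simp
  then have "fps_nth (N F) k = fps_nth (fps_X + F) k" by simp
  then have "(- 1) ^ k * fps_nth F k = (if k = 1 then 1 else 0) + fps_nth F k"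
    unfolding N_def fps_nth_compose_linear by (simp add: fps_X_def)
  then show ?thesis using assms by (simp add: bernoulli_coeff_def F_def)
qed

lemma bernoulli_fun_deriv: "(bernoulli_fun (Suc k) has_real_derivative bernoulli_fun k x) (at x within S)"
proof -
  have "((\<lambda>x. \<Sum>i\<le>Suc k. bernoulli_coeff (Suc k - i) * x ^ i / fact i) has_real_derivative
      (\<Sum>i\<le>Suc k. bernoulli_coeff (Suc k - i) * (of_nat i * x ^ (i - 1)) / fact i)) (at x within S)"
    by (rule DERIV_sum) (auto intro!: derivative_eq_intros)
  also have "(\<Sum>i\<le>Suc k. bernoulli_coeff (Suc k - i) * (of_nat i * x ^ (i - 1)) / fact i) = bernoulli_fun k x"
  proof -
    have "bernoulli_coeff (Suc k - Suc i) * (of_nat (Suc i) * x ^ (Suc i - 1)) / fact (Suc i) = bernoulli_coeff (k - i) * x ^ i / fact i" for i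
      by (simp only: fact_Suc diff_Suc_Suc diff_Suc_1) (simp del: of_nat_Suc)
    then show ?thesis unfolding sum.atMost_Suc_shift bernoulli_fun_def by simp
  qed
  also have "(\<lambda>x. \<Sum>i\<le>Suc k. bernoulli_coeff (Suc k - i) * x ^ i / fact i) = bernoulli_fun (Suc k)"
    by (simp add: bernoulli_fun_def fun_eq_iff)
  finally show ?thesis .
qed

lemma bernoulli_fun_at_0: "bernoulli_fun k 0 = bernoulli_coeff k"
proof -
  have "bernoulli_fun k 0 = (\<Sum>i\<in>{0}. bernoulli_coeff (k - i) * 0 ^ i / fact i)"
    unfolding bernoulli_fun_def by (rule sum.mono_neutral_right) auto
  then show ?thesis by simp
qed

text \<open>The end values agree except at \<open>k = 1\<close>. Hence the boundary terms of order
  at least 2 telescope over unit intervals, while \<open>k = 1\<close> gives the trapezoidal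
  mean.\<close>

lemma bernoulli_fun_at_1: "bernoulli_fun k 1 = bernoulli_coeff k + (if k = 1 then 1 else 0)"
proof -
  have "{..k} = insert 0 {1..k}" by auto
  then show ?thesis using bernoulli_coeff_rec[of k] by (simp add: bernoulli_fun_def)
qed

lemma continuous_on_bernoulli_fun: "continuous_on S (bernoulli_fun k)"
  unfolding bernoulli_fun_def by (intro continuous_intros) simp_all

text \<open>\<open>M\<close> integrations by parts, using that each \<open>bernoulli_fun\<close> is
  the derivative of the next and \<open>bernoulli_fun 0 = 1\<close>.\<close>

lemma euler_maclaurin_unit:
  fixes g :: "nat \<Rightarrow> real \<Rightarrow> complex"
  assumes der: "\<And>k x. x \<in> {0..1} \<Longrightarrow> (g k has_vector_derivative g (Suc k) x) (at x within {0..1})"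
    and "M \<ge> 1"
  shows "integral {0..1} (\<lambda>x. of_real (bernoulli_fun 0 x) * g 0 x) = (g 0 0 + g 0 1) / 2 -
    (\<Sum>k\<in>{1..<M}. of_real (bernoulli_coeff (Suc k)) * (g k 1 - g k 0)) +
    (- 1) ^ M * integral {0..1} (\<lambda>x. of_real (bernoulli_fun M x) * g M x)"
proof -
  have cont: "continuous_on {0..1} (g k)" for k
    by (rule continuous_on_vector_derivative[OF der])
  have int: "(\<lambda>x. of_real (bernoulli_fun i x) * g k x) integrable_on {0..1}" for i k
    by (intro integrable_continuous_real continuous_intros cont continuous_on_bernoulli_fun)
  have step: "integral {0..1} (\<lambda>x. of_real (bernoulli_fun k x) * g k x) =
     (of_real (bernoulli_fun (Suc k) 1) * g k 1 - of_real (bernoulli_fun (Suc k) 0) * g k 0) -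
     integral {0..1} (\<lambda>x. of_real (bernoulli_fun (Suc k) x) * g (Suc k) x)" for k
  proof -
    have "((\<lambda>x. of_real (bernoulli_fun (Suc k) x) * g (Suc k) x + of_real (bernoulli_fun k x) * g k x) has_integral
       (of_real (bernoulli_fun (Suc k) 1) * g k 1 - of_real (bernoulli_fun (Suc k) 0) * g k 0)) {0..1}"
    proof (rule fundamental_theorem_of_calculus)
      fix x :: real assume x: "x \<in> {0..1}"
      have "(bernoulli_fun (Suc k) has_vector_derivative bernoulli_fun k x) (at x within {0..1})"
        using bernoulli_fun_deriv has_real_derivative_iff_has_vector_derivative by blast
      then have "((\<lambda>x. complex_of_real (bernoulli_fun (Suc k) x)) has_vector_derivative of_real (bernoulli_fun k x)) (at x within {0..1})"
        by (rule bounded_linear.has_vector_derivative[OF bounded_linear_of_real])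
      from has_vector_derivative_mult[OF this der[OF x]]
      show "((\<lambda>x. of_real (bernoulli_fun (Suc k) x) * g k x) has_vector_derivative
         of_real (bernoulli_fun (Suc k) x) * g (Suc k) x + of_real (bernoulli_fun k x) * g k x) (at x within {0..1})" .
    qed simp
    from integral_unique[OF this] show ?thesis
      by (simp add: integral_add int eq_diff_eq add.commute)
  qed
  have all: "integral {0..1} (\<lambda>x. of_real (bernoulli_fun 0 x) * g 0 x) =
     (\<Sum>k<M. (- 1) ^ k * (of_real (bernoulli_fun (Suc k) 1) * g k 1 - of_real (bernoulli_fun (Suc k) 0) * g k 0)) +
     (- 1) ^ M * integral {0..1} (\<lambda>x. of_real (bernoulli_fun M x) * g M x)" for M
  proof (induction M)
    case (Suc M)
    show ?case by (subst Suc.IH, subst step[of M]) (simp add: algebra_simps)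
  qed simp
  have "{..<M} = insert 0 {1..<M}" using \<open>M \<ge> 1\<close> by auto
  then have "(\<Sum>k<M. (- 1) ^ k * (of_real (bernoulli_fun (Suc k) 1) * g k 1 - of_real (bernoulli_fun (Suc k) 0) * g k 0)) =
     (of_real (bernoulli_fun 1 1) * g 0 1 - of_real (bernoulli_fun 1 0) * g 0 0) +
     (\<Sum>k\<in>{1..<M}. (- 1) ^ k * (of_real (bernoulli_fun (Suc k) 1) * g k 1 - of_real (bernoulli_fun (Suc k) 0) * g k 0))"
    by simp
  also have "of_real (bernoulli_fun 1 1) * g 0 1 - of_real (bernoulli_fun 1 0) * g 0 0 = (g 0 0 + g 0 1) / 2"
    unfolding bernoulli_fun_at_0 bernoulli_fun_at_1 bernoulli_coeff_1 by (simp add: field_simps)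
  also have "(\<Sum>k\<in>{1..<M}. (- 1) ^ k * (of_real (bernoulli_fun (Suc k) 1) * g k 1 - of_real (bernoulli_fun (Suc k) 0) * g k 0)) =
     (\<Sum>k\<in>{1..<M}. - (of_real (bernoulli_coeff (Suc k)) * (g k 1 - g k 0)))"
  proof (rule sum.cong)
    \<comment> \<open>The alternating sign disappears: for even \<open>k\<close> the coefficient of
      odd index \<open>Suc k \<noteq> 1\<close> is \<open>0\<close>, and for odd \<open>k\<close>
      the sign is \<open>-1\<close>.\<close>
    fix k assume "k \<in> {1..<M}"
    then have "k \<ge> 1" by simp
    then show "(- 1) ^ k * (of_real (bernoulli_fun (Suc k) 1) * g k 1 - of_real (bernoulli_fun (Suc k) 0) * g k 0) =
       - (of_real (bernoulli_coeff (Suc k)) * (g k 1 - g k 0))"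
      unfolding bernoulli_fun_at_0 bernoulli_fun_at_1 using bernoulli_coeff_odd[of "Suc k"]
      by (cases "even k") (auto simp: algebra_simps)
  qed simp
  finally show ?thesis using all[of M] by (simp add: sum_negf)
qed

text \<open>The \<open>r\<close>-th derivative of \<open>(A + \<gamma> z^d)^(-w)\<close> is a sum over \<open>l\<close> of multiples of
  \<open>z^(d l - r) (A + \<gamma> z^d)^(-w-l)\<close>. The coefficients are the \<open>l\<close>-th differences at 0 of
  \<open>i \<mapsto> (d i) (d i - 1) \<dots> (d i - r + 1)\<close>; they vanish for \<open>r > d l\<close>, so the truncated exponent
  \<open>d * l - r\<close> is harmless.\<close>

definition diff_coeff :: "nat \<Rightarrow> nat \<Rightarrow> nat \<Rightarrow> complex" where
  "diff_coeff d r l = (\<Sum>i\<le>l. (- 1) ^ (l - i) * of_nat (l choose i) * of_nat (fact r * (d * i choose r)))"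

lemma diff_coeff_0: "diff_coeff d 0 l = (if l = 0 then 1 else 0)"
proof -
  have "diff_coeff d 0 l = (\<Sum>i\<le>l. of_nat (l choose i) * 1 ^ i * (- 1) ^ (l - i))"
    by (auto simp: diff_coeff_def intro!: sum.cong)
  also have "\<dots> = (1 + (- 1)) ^ l" by (rule binomial_ring[symmetric])
  finally show ?thesis by (auto simp: power_0_left)
qed

lemma fact_choose_Suc:
  "(of_nat (fact (Suc r) * (x choose Suc r)) :: complex) = (of_nat x - of_nat r) * of_nat (fact r * (x choose r))"
proof (cases "r \<le> x")
  case True
  have "Suc r * (x choose Suc r) = (x - r) * (x choose r)"
    using binomial_absorption[of r x] binomial_absorb_comp[of x r] by simp
  then have "fact r * (Suc r * (x choose Suc r)) = fact r * ((x - r) * (x choose r))" by (simp only:)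
  then have "fact (Suc r) * (x choose Suc r) = (x - r) * (fact r * (x choose r))"
    by (simp only: fact_Suc of_nat_id mult.assoc mult.left_commute)
  then show ?thesis using True by (simp add: of_nat_diff)
qed (simp add: binomial_eq_0)

text \<open>This recursion is the one forced by differentiating
  \<open>z^(d l - r) (A + \<gamma> z^d)^(-w-l)\<close>. For the difference formula it follows from
  \<open>d i - r = (d l - r) - d (l - i)\<close> and
  \<open>(l - i) binom(l, i) = l binom(l - 1, i)\<close>.\<close>

lemma diff_coeff_Suc:
  "diff_coeff d (Suc r) l = (of_nat (d * l) - of_nat r) * diff_coeff d r l + of_nat (d * l) * diff_coeff d r (l - 1)"
proof (cases l)
  case 0
  then show ?thesis unfolding diff_coeff_def by (cases r) simp_all
next
  case (Suc k)
  define f where "f i = (of_nat (fact r * (d * i choose r)) :: complex)" for i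
  have "diff_coeff d (Suc r) l = (\<Sum>i\<le>l. (- 1) ^ (l - i) * of_nat (l choose i) * ((of_nat (d * i) - of_nat r) * f i))"
    unfolding diff_coeff_def fact_choose_Suc f_def ..
  also have "\<dots> = (\<Sum>i\<le>l. (of_nat (d * l) - of_nat r) * ((- 1) ^ (l - i) * of_nat (l choose i) * f i)
      - of_nat d * ((- 1) ^ (l - i) * (of_nat ((l - i) * (l choose i)) * f i)))"
    by (intro sum.cong) (auto simp: of_nat_diff algebra_simps)
  also have "\<dots> = (of_nat (d * l) - of_nat r) * diff_coeff d r l -
      (\<Sum>i\<le>l. of_nat d * ((- 1) ^ (l - i) * (of_nat ((l - i) * (l choose i)) * f i)))"
    by (simp add: sum_subtractf sum_distrib_left diff_coeff_def f_def)
  also have "(\<Sum>i\<le>l. of_nat d * ((- 1) ^ (l - i) * (of_nat ((l - i) * (l choose i)) * f i))) =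
     (\<Sum>i\<le>k. of_nat d * ((- 1) ^ (l - i) * (of_nat ((l - i) * (l choose i)) * f i)))"
    unfolding Suc by simp
  also have "\<dots> = (\<Sum>i\<le>k. - (of_nat (d * l) * ((- 1) ^ (k - i) * of_nat (k choose i) * f i)))"
  proof (rule sum.cong)
    fix i assume "i \<in> {..k}"
    then have "l - i = Suc (k - i)" using Suc by auto
    moreover have "(l - i) * (l choose i) = l * (k choose i)"
      using binomial_absorb_comp[of l i] Suc by simp
    ultimately show "of_nat d * ((- 1) ^ (l - i) * (of_nat ((l - i) * (l choose i)) * f i)) =
       - (of_nat (d * l) * ((- 1) ^ (k - i) * of_nat (k choose i) * f i))"
      by (simp only: power_Suc of_nat_mult) (simp add: algebra_simps)
  qed simp
  also have "\<dots> = - (of_nat (d * l) * diff_coeff d r k)"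
    by (simp add: sum_negf sum_distrib_left diff_coeff_def f_def)
  finally show ?thesis using Suc by simp
qed

lemma diff_coeff_eq_0_gt: "r > d * l \<Longrightarrow> diff_coeff d r l = 0"
  unfolding diff_coeff_def
proof (intro sum.neutral ballI)
  fix i assume r: "r > d * l" and "i \<in> {..l}"
  then have "d * i \<le> d * l" by simp
  then have "d * i < r" using r by linarith
  then show "(- 1) ^ (l - i) * of_nat (l choose i) * of_nat (fact r * (d * i choose r)) = (0 :: complex)"
    by (simp add: binomial_eq_0)
qed

text \<open>The \<open>l\<close>-th difference of a polynomial of degree \<open>r < l\<close>
  vanishes. This is why the sum in \<open>em_fun\<close> may stop at \<open>l = r\<close>.\<close>

lemma diff_coeff_eq_0_lt: "r < l \<Longrightarrow> diff_coeff d r l = 0"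
proof (induction r arbitrary: l)
  case 0
  then show ?case by (simp add: diff_coeff_0)
next
  case (Suc r)
  then show ?case unfolding diff_coeff_Suc using Suc.IH[of l] Suc.IH[of "l - 1"] by simp
qed

lemma diff_coeff_diag:
  assumes "d \<ge> 1"
  shows "diff_coeff d (d * l) l = fact (d * l)"
proof -
  have "diff_coeff d (d * l) l = (\<Sum>i\<in>{l}. (- 1) ^ (l - i) * of_nat (l choose i) * of_nat (fact (d * l) * (d * i choose (d * l))))"
    unfolding diff_coeff_def
  proof (rule sum.mono_neutral_right)
    show "\<forall>i\<in>{..l} - {l}. (- 1) ^ (l - i) * of_nat (l choose i) * of_nat (fact (d * l) * (d * i choose (d * l))) = (0::complex)"
    proof
      fix i assume "i \<in> {..l} - {l}"
      then have "d * i < d * l" using assms by auto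
      then show "(- 1) ^ (l - i) * of_nat (l choose i) * of_nat (fact (d * l) * (d * i choose (d * l))) = (0::complex)"
        by (simp add: binomial_eq_0)
    qed
  qed auto
  then show ?thesis by simp
qed

definition em_fun :: "nat \<Rightarrow> complex \<Rightarrow> complex \<Rightarrow> complex \<Rightarrow> nat \<Rightarrow> complex \<Rightarrow> complex" where
  "em_fun d \<gamma> w A r z = (\<Sum>l\<le>r. \<gamma> ^ l * (- w gchoose l) * diff_coeff d r l * z ^ (d * l - r) *
     (A + \<gamma> * z ^ d) powr (- w - of_nat l))"

lemma em_fun_0: "em_fun d \<gamma> w A 0 z = (A + \<gamma> * z ^ d) powr (- w)"
  by (simp add: em_fun_def diff_coeff_0)

lemma em_fun_deriv:
  assumes d: "d \<ge> 1" and S: "A + \<gamma> * z ^ d \<notin> \<real>\<^sub>\<le>\<^sub>0"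
  shows "(em_fun d \<gamma> w A r has_field_derivative em_fun d \<gamma> w A (Suc r) z) (at z)"
proof -
  define S where "S = A + \<gamma> * z ^ d"
  define G where "G l = (- w gchoose l)" for l
  define a where "a l = \<gamma> ^ l * G l * diff_coeff d r l" for l
  \<comment> \<open>\<open>U l\<close> comes from differentiating the power of \<open>z\<close>, and
    \<open>W (Suc l)\<close> from differentiating the complex power, which raises \<open>l\<close>
    by one. Together they match the two summands of \<open>diff_coeff_Suc\<close>.\<close>
  define U where "U l = \<gamma> ^ l * G l * ((of_nat (d * l) - of_nat r) * diff_coeff d r l) * z ^ (d * l - Suc r) * S powr (- w - of_nat l)" for l
  define W where "W l = \<gamma> ^ l * G l * (of_nat (d * l) * diff_coeff d r (l - 1)) * z ^ (d * l - Suc r) * S powr (- w - of_nat l)" for l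
  have "(em_fun d \<gamma> w A r has_field_derivative
      (\<Sum>l\<le>r. a l * (of_nat (d * l - r) * z ^ (d * l - r - 1)) * S powr (- w - of_nat l) +
        a l * z ^ (d * l - r) * ((- w - of_nat l) * S powr (- w - of_nat l - 1) * (\<gamma> * (of_nat d * z ^ (d - 1)))))) (at z)"
    unfolding em_fun_def a_def G_def S_def using S
    by (auto intro!: derivative_eq_intros sum.cong simp: algebra_simps)
  also have "(\<Sum>l\<le>r. a l * (of_nat (d * l - r) * z ^ (d * l - r - 1)) * S powr (- w - of_nat l) +
        a l * z ^ (d * l - r) * ((- w - of_nat l) * S powr (- w - of_nat l - 1) * (\<gamma> * (of_nat d * z ^ (d - 1))))) =
      (\<Sum>l\<le>r. U l + W (Suc l))"
  proof (rule sum.cong)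
    fix l
    show "a l * (of_nat (d * l - r) * z ^ (d * l - r - 1)) * S powr (- w - of_nat l) +
        a l * z ^ (d * l - r) * ((- w - of_nat l) * S powr (- w - of_nat l - 1) * (\<gamma> * (of_nat d * z ^ (d - 1)))) =
        U l + W (Suc l)"
    proof (cases "r > d * l")
      \<comment> \<open>In this range the exponents are truncated to \<open>0\<close> and the
        identities for powers of \<open>z\<close> fail, but the coefficient is
        \<open>0\<close>.\<close>
      case True
      then show ?thesis by (simp add: a_def U_def W_def diff_coeff_eq_0_gt)
    next
      case False
      then have le: "r \<le> d * l" by simp
      have "a l * (of_nat (d * l - r) * z ^ (d * l - r - 1)) * S powr (- w - of_nat l) = U l"
        unfolding U_def a_def of_nat_diff[OF le] by (simp add: algebra_simps)
      moreover have "a l * z ^ (d * l - r) * ((- w - of_nat l) * S powr (- w - of_nat l - 1) * (\<gamma> * (of_nat d * z ^ (d - 1)))) = W (Suc l)"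
      proof -
        have G: "(- w - of_nat l) * G l = of_nat (Suc l) * G (Suc l)"
          unfolding G_def using gbinomial_absorb_comp[of "- w" l] gbinomial_absorption[of l "- w"]
          by (simp add: algebra_simps)
        have "d * Suc l - Suc r = (d * l - r) + (d - 1)" using le d by (simp add: algebra_simps)
        then have z: "z ^ (d * Suc l - Suc r) = z ^ (d * l - r) * z ^ (d - 1)" by (simp only: power_add)
        have p: "- w - of_nat (Suc l) = - w - of_nat l - 1" by simp
        have "a l * z ^ (d * l - r) * ((- w - of_nat l) * S powr (- w - of_nat l - 1) * (\<gamma> * (of_nat d * z ^ (d - 1)))) =
          \<gamma> ^ Suc l * ((- w - of_nat l) * G l) * (of_nat d * diff_coeff d r l) * (z ^ (d * l - r) * z ^ (d - 1)) * S powr (- w - of_nat l - 1)"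
          by (simp add: a_def)
        also have "\<dots> = W (Suc l)" unfolding G W_def z p by (simp add: algebra_simps)
        finally show ?thesis .
      qed
      ultimately show ?thesis by simp
    qed
  qed simp
  also have "\<dots> = (\<Sum>l\<le>Suc r. U l) + (\<Sum>l\<le>Suc r. W l)"
  proof -
    have "U (Suc r) = 0" by (simp add: U_def diff_coeff_eq_0_lt)
    moreover have "W 0 = 0" by (simp add: W_def)
    ultimately show ?thesis unfolding sum.distrib sum.atMost_Suc_shift[of W] by simp
  qed
  also have "\<dots> = em_fun d \<gamma> w A (Suc r) z"
    unfolding em_fun_def sum.distrib[symmetric] diff_coeff_Suc
    by (intro sum.cong) (auto simp: U_def W_def G_def S_def algebra_simps)
  finally show ?thesis .
qed

text \<open>Only \<open>l\<close> with \<open>d * l = r\<close> survives: for larger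
  \<open>l\<close> the power of \<open>0\<close> vanishes, for smaller \<open>l\<close> the
  coefficient. This is the origin of the divisibility condition in the theorem.\<close>

lemma em_fun_at_0:
  assumes "d \<ge> 1"
  shows "em_fun d \<gamma> w A r 0 =
    (if d dvd r then \<gamma> ^ (r div d) * (- w gchoose (r div d)) * fact r * A powr (- w - of_nat (r div d)) else 0)"
proof -
  have *: "\<gamma> ^ l * (- w gchoose l) * diff_coeff d r l * 0 ^ (d * l - r) * (A + \<gamma> * 0 ^ d) powr (- w - of_nat l) = 0"
    if "d * l \<noteq> r" for l
    using that by (cases "d * l < r") (simp_all add: diff_coeff_eq_0_gt)
  show ?thesis
  proof (cases "d dvd r")
    case False
    then have "d * l \<noteq> r" for l by auto
    then show ?thesis unfolding em_fun_def using * False by (auto intro!: sum.neutral)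
  next
    case True
    then obtain q where q: "r = d * q" by auto
    have "em_fun d \<gamma> w A r 0 = (\<Sum>l\<in>{q}. \<gamma> ^ l * (- w gchoose l) * diff_coeff d r l * 0 ^ (d * l - r) *
      (A + \<gamma> * 0 ^ d) powr (- w - of_nat l))"
      unfolding em_fun_def
    proof (rule sum.mono_neutral_right)
      show "{q} \<subseteq> {..r}" using assms q by simp
      show "\<forall>l\<in>{..r} - {q}. \<gamma> ^ l * (- w gchoose l) * diff_coeff d r l * 0 ^ (d * l - r) *
          (A + \<gamma> * 0 ^ d) powr (- w - of_nat l) = 0"
        using * assms q by auto
    qed simp
    moreover have "(0 :: complex) ^ d = 0" using assms by simp
    ultimately show ?thesis using assms q by (simp add: diff_coeff_diag)
  qed
qed

text \<open>At \<open>w = -P\<close> the summand is a polynomial in \<open>z\<close> of degree at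
  most \<open>d * P\<close>. In the closed form either the binomial (\<open>l > P\<close>) or the
  coefficient (\<open>d * l < r\<close>) is \<open>0\<close>.\<close>

lemma em_fun_eq_0:
  assumes "r > d * P"
  shows "em_fun d \<gamma> (- of_nat P) A r z = 0"
  unfolding em_fun_def
proof (intro sum.neutral ballI)
  fix l
  have "(of_nat P gchoose l :: complex) * diff_coeff d r l = 0"
  proof (cases "l > P")
    case True
    then show ?thesis by (simp add: binomial_eq_0 flip: binomial_gbinomial)
  next
    case False
    then have "d * l \<le> d * P" by (intro mult_le_mono2) simp
    then have "r > d * l" using assms by linarith
    then show ?thesis by (simp add: diff_coeff_eq_0_gt)
  qed
  then show "\<gamma> ^ l * (- (- of_nat P) gchoose l) * diff_coeff d r l * z ^ (d * l - r) * (A + \<gamma> * z ^ d) powr (- (- of_nat P) - of_nat l) = 0"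
    by auto
qed

lemma holomorphic_gbinomial: "(\<lambda>w. (- w :: complex) gchoose l) holomorphic_on S"
  unfolding gbinomial_prod_rev by (intro holomorphic_intros) simp_all

lemma gbinomial_bounded: "\<exists>g\<ge>0. \<forall>w. norm w \<le> Y \<longrightarrow> norm ((- w :: complex) gchoose l) \<le> g"
proof -
  have "continuous_on (cball 0 Y) (\<lambda>w. (- w :: complex) gchoose l)"
    by (intro holomorphic_on_imp_continuous_on holomorphic_gbinomial)
  then have "bounded ((\<lambda>w. (- w :: complex) gchoose l) ` cball 0 Y)"
    by (intro compact_imp_bounded compact_continuous_image compact_cball)
  then obtain g where "\<forall>x\<in>(\<lambda>w. (- w :: complex) gchoose l) ` cball 0 Y. norm x \<le> g" "g > 0"
    unfolding bounded_pos by blast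
  then show ?thesis by (intro exI[of _ g]) (auto simp: less_imp_le)
qed

lemma affine_bounds:
  assumes "c > 0" "c * \<Lambda> \<le> Re A" "norm A \<le> H * \<Lambda>" "c \<le> Re \<gamma>" "norm \<gamma> \<le> H" "x \<ge> 0"
  shows "c * (\<Lambda> + x ^ d) \<le> Re (A + \<gamma> * of_real x ^ d)"
    "c * (\<Lambda> + x ^ d) \<le> norm (A + \<gamma> * of_real x ^ d)"
    "norm (A + \<gamma> * of_real x ^ d) \<le> H * (\<Lambda> + x ^ d)"
proof -
  have "c * x ^ d \<le> Re \<gamma> * x ^ d" using assms by (intro mult_right_mono) auto
  then show 1: "c * (\<Lambda> + x ^ d) \<le> Re (A + \<gamma> * of_real x ^ d)"
    using assms by (simp add: algebra_simps flip: of_real_power)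
  show "c * (\<Lambda> + x ^ d) \<le> norm (A + \<gamma> * of_real x ^ d)"
    by (rule order_trans[OF 1 complex_Re_le_cmod])
  have "norm (\<gamma> * of_real x ^ d) \<le> H * x ^ d"
    using assms by (simp add: norm_mult norm_power mult_right_mono)
  then show "norm (A + \<gamma> * of_real x ^ d) \<le> H * (\<Lambda> + x ^ d)"
    using norm_triangle_ineq[of A "\<gamma> * of_real x ^ d"] assms(3) by (simp add: algebra_simps)
qed

text \<open>Each derivative gains the power \<open>1/d\<close> of \<open>\<Lambda> + x^d\<close>.
  The constant \<open>K\<close> must not depend on \<open>A\<close>, since the estimate is later
  summed over all values of the outer linear form, nor on \<open>w\<close> within a disc, since
  local majorants are wanted.\<close>

lemma em_fun_bound:
  assumes d: "d \<ge> 1" and c: "c > 0" "H > 0" "c \<le> Re \<gamma>" "norm \<gamma> \<le> H"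
  shows "\<exists>K\<ge>0. \<forall>w A \<Lambda> x. norm w \<le> Y \<longrightarrow> \<Lambda> \<ge> 1 \<longrightarrow> x \<ge> 0 \<longrightarrow> c * \<Lambda> \<le> Re A \<longrightarrow> norm A \<le> H * \<Lambda> \<longrightarrow>
     norm (em_fun d \<gamma> w A r (of_real x)) \<le> K * (\<Lambda> + x ^ d) powr (- Re w - r / d)"
proof -
  have "\<forall>l. \<exists>g\<ge>0. \<forall>w. norm w \<le> Y \<longrightarrow> norm ((- w :: complex) gchoose l) \<le> g"
    using gbinomial_bounded by blast
  from choice[OF this] obtain g where g: "\<And>l. g l \<ge> 0"
    "\<And>l w. norm w \<le> Y \<Longrightarrow> norm ((- w :: complex) gchoose l) \<le> g l" by blast
  define P where "P = exp ((Y + r) * (pi + \<bar>ln c\<bar> + \<bar>ln H\<bar>))"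
  define K where "K = (\<Sum>l\<le>r. H ^ l * g l * norm (diff_coeff d r l) * P)"
  have P: "P > 0" by (simp add: P_def)
  have "K \<ge> 0" unfolding K_def using c g P by (intro sum_nonneg mult_nonneg_nonneg) auto
  moreover have "norm (em_fun d \<gamma> w A r (of_real x)) \<le> K * (\<Lambda> + x ^ d) powr (- Re w - r / d)"
    if w: "norm w \<le> Y" and L: "\<Lambda> \<ge> 1" and x: "x \<ge> 0" and A: "c * \<Lambda> \<le> Re A" "norm A \<le> H * \<Lambda>" for w A \<Lambda> x
  proof -
    define S where "S = A + \<gamma> * of_real x ^ d"
    define L where "L = \<Lambda> + x ^ d"
    have "x ^ d \<ge> 0" using x by simp
    then have L1: "L \<ge> 1" "x ^ d \<le> L" using L unfolding L_def by linarith+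
    have "norm (em_fun d \<gamma> w A r (of_real x)) \<le>
       (\<Sum>l\<le>r. norm (\<gamma> ^ l * (- w gchoose l) * diff_coeff d r l * of_real x ^ (d * l - r) * S powr (- w - of_nat l)))"
      unfolding em_fun_def S_def by (rule norm_sum)
    also have "\<dots> \<le> (\<Sum>l\<le>r. (H ^ l * g l * norm (diff_coeff d r l) * P) * L powr (- Re w - r / d))"
    proof (rule sum_mono)
      fix l assume l: "l \<in> {..r}"
      show "norm (\<gamma> ^ l * (- w gchoose l) * diff_coeff d r l * of_real x ^ (d * l - r) * S powr (- w - of_nat l)) \<le>
        (H ^ l * g l * norm (diff_coeff d r l) * P) * L powr (- Re w - r / d)"
      proof (cases "r > d * l")
        case True
        then show ?thesis by (simp add: diff_coeff_eq_0_gt)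
      next
        case False
        then have le: "r \<le> d * l" by simp
        have "norm (S powr (- w - of_nat l)) \<le> P * L powr Re (- w - of_nat l)"
          unfolding P_def S_def L_def
        proof (rule norm_powr_le)
          show "norm (- w - of_nat l) \<le> Y + r"
            using norm_triangle_ineq4[of "- w" "of_nat l"] w l by simp
        qed (use c L1 affine_bounds[OF c(1) A c(3,4) x] in \<open>auto simp: L_def\<close>)
        then have 1: "norm (S powr (- w - of_nat l)) \<le> P * L powr (- Re w - real l)" by simp
        \<comment> \<open>\<open>x \<le> L powr (1/d)\<close> turns the monomial factor into the
          power \<open>l - r/d\<close> of \<open>L\<close>, and the \<open>l\<close> cancels against
          the exponent \<open>-w-l\<close>.\<close>
        have "x = (x ^ d) powr (1 / d)"
          using d x by (cases "x = 0") (auto simp: powr_powr simp flip: powr_realpow)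
        also have "\<dots> \<le> L powr (1 / d)" using L1 x by (intro powr_mono2) auto
        finally have "x ^ (d * l - r) \<le> (L powr (1 / d)) ^ (d * l - r)" using x by (intro power_mono) auto
        also have "\<dots> = L powr (real (d * l - r) / d)" using L1 by (simp add: powr_power)
        also have "real (d * l - r) / d = real l - r / d"
          using le d by (simp add: of_nat_diff field_simps)
        finally have 2: "x ^ (d * l - r) \<le> L powr (real l - r / d)" .
        have "norm (\<gamma> ^ l * (- w gchoose l) * diff_coeff d r l * of_real x ^ (d * l - r) * S powr (- w - of_nat l)) =
          norm \<gamma> ^ l * norm (- w gchoose l) * norm (diff_coeff d r l) * (x ^ (d * l - r) * norm (S powr (- w - of_nat l)))"
          using x by (simp add: norm_mult norm_power)
        also have "\<dots> \<le> H ^ l * g l * norm (diff_coeff d r l) * (L powr (real l - r / d) * (P * L powr (- Re w - real l)))"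
          using c g(1) g(2)[OF w] 1 2 x P
          by (intro mult_mono power_mono mult_nonneg_nonneg) auto
        also have "\<dots> = H ^ l * g l * norm (diff_coeff d r l) * P * (L powr (real l - r / d) * L powr (- Re w - real l))"
          by simp
        also have "L powr (real l - r / d) * L powr (- Re w - real l) = L powr (- Re w - r / d)"
          unfolding powr_add[symmetric] by (rule arg_cong) simp
        finally show ?thesis .
      qed
    qed
    also have "\<dots> = K * L powr (- Re w - r / d)" by (simp add: K_def sum_distrib_right)
    finally show ?thesis by (simp add: L_def)
  qed
  ultimately show ?thesis by blast
qed

section \<open>Remainder integrals\<close>

text \<open>The Euler-Maclaurin remainder on \<open>[m, m + 1]\<close>. As
  \<open>bernoulli_fun 0\<close> is constantly \<open>1\<close>, order \<open>M = 0\<close> is the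
  integral of the summand itself.\<close>

definition em_rem :: "nat \<Rightarrow> complex \<Rightarrow> nat \<Rightarrow> complex \<Rightarrow> complex \<Rightarrow> nat \<Rightarrow> complex" where
  "em_rem d \<gamma> M w A m =
     integral {0..1} (\<lambda>x. of_real (bernoulli_fun M x) * em_fun d \<gamma> w A M (of_real (real m + x)))"

lemma Re_affine_pos:
  assumes "Re A > 0" "Re \<gamma> > 0" "x \<ge> 0"
  shows "Re (A + \<gamma> * of_real x ^ d) > 0"
  using assms by (simp add: add_pos_nonneg flip: of_real_power)

lemma affine_notin_nonpos:
  assumes "Re A > 0" "Re \<gamma> > 0" "x \<ge> 0"
  shows "A + \<gamma> * of_real x ^ d \<notin> \<real>\<^sub>\<le>\<^sub>0"
  using Re_affine_pos[OF assms, of d] by (auto simp: complex_nonpos_Reals_iff)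

lemma em_fun_vector_deriv:
  assumes d: "d \<ge> 1" and A: "Re A > 0" "Re \<gamma> > 0" and x: "x \<ge> 0"
  shows "((\<lambda>x. em_fun d \<gamma> w A r (of_real (real m + x))) has_vector_derivative
    em_fun d \<gamma> w A (Suc r) (of_real (real m + x))) (at x within T)"
proof -
  have "(em_fun d \<gamma> w A r has_field_derivative em_fun d \<gamma> w A (Suc r) (of_real x + of_nat m)) (at (of_real x + of_nat m))"
    using em_fun_deriv[OF d affine_notin_nonpos[OF A, of "real m + x" d]] x by (simp add: add.commute)
  then have "((\<lambda>z. em_fun d \<gamma> w A r (z + of_nat m)) has_field_derivative em_fun d \<gamma> w A (Suc r) (of_real x + of_nat m)) (at (of_real x))"
    by (simp only: DERIV_shift)
  from has_vector_derivative_real_field[OF this] show ?thesis by (simp add: add.commute)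
qed

lemma continuous_on_em_fun:
  assumes d: "d \<ge> 1" and A: "Re A > 0" "Re \<gamma> > 0"
  shows "continuous_on {0..1} (\<lambda>x. em_fun d \<gamma> w A r (of_real (real m + x)))"
  by (rule continuous_on_vector_derivative[OF em_fun_vector_deriv[OF d A]]) auto

lemma em_rem_bound:
  assumes d: "d \<ge> 1" and c: "c > 0" "H > 0" "c \<le> Re \<gamma>" "norm \<gamma> \<le> H"
  shows "\<exists>K\<ge>0. \<forall>w A \<Lambda> m. norm w \<le> Y \<longrightarrow> \<Lambda> \<ge> 1 \<longrightarrow> c * \<Lambda> \<le> Re A \<longrightarrow> norm A \<le> H * \<Lambda> \<longrightarrow> Re w + M / d \<ge> 0 \<longrightarrow>
     norm (em_rem d \<gamma> M w A m) \<le> K * (\<Lambda> + real m ^ d) powr (- Re w - M / d)"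
proof -
  from em_fun_bound[OF d c, of Y M] obtain K where K: "K \<ge> 0"
    "\<And>w A \<Lambda> x. norm w \<le> Y \<Longrightarrow> \<Lambda> \<ge> 1 \<Longrightarrow> x \<ge> 0 \<Longrightarrow> c * \<Lambda> \<le> Re A \<Longrightarrow> norm A \<le> H * \<Lambda> \<Longrightarrow>
      norm (em_fun d \<gamma> w A M (of_real x)) \<le> K * (\<Lambda> + x ^ d) powr (- Re w - M / d)" by blast
  have "bounded (bernoulli_fun M ` {0..1})"
    by (intro compact_imp_bounded compact_continuous_image continuous_on_bernoulli_fun compact_Icc)
  then obtain B where B: "B > 0" "\<And>x. x \<in> {0..1} \<Longrightarrow> \<bar>bernoulli_fun M x\<bar> \<le> B"
    unfolding bounded_pos by auto
  have "norm (em_rem d \<gamma> M w A m) \<le> (B * K) * (\<Lambda> + real m ^ d) powr (- Re w - M / d)"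
    if w: "norm w \<le> Y" and L: "\<Lambda> \<ge> 1" and A: "c * \<Lambda> \<le> Re A" "norm A \<le> H * \<Lambda>" and e: "Re w + M / d \<ge> 0" for w A \<Lambda> m
  proof -
    have "0 < c * \<Lambda>" using c L by simp
    then have A0: "Re A > 0" using A by linarith
    have g0: "Re \<gamma> > 0" using c by linarith
    have "norm (em_rem d \<gamma> M w A m) \<le> (B * K * (\<Lambda> + real m ^ d) powr (- Re w - M / d)) * (1 - 0)"
      unfolding em_rem_def
    proof (rule integral_bound)
      show "continuous_on {0..1} (\<lambda>x. of_real (bernoulli_fun M x) * em_fun d \<gamma> w A M (of_real (real m + x)))"
        by (intro continuous_intros continuous_on_bernoulli_fun continuous_on_em_fun d A0 g0)
      fix x :: real assume x: "x \<in> {0..1}"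
      have "norm (em_fun d \<gamma> w A M (of_real (real m + x))) \<le> K * (\<Lambda> + (real m + x) ^ d) powr (- Re w - M / d)"
        using K(2)[OF w L _ A, of "real m + x"] x by simp
      \<comment> \<open>The hypothesis \<open>Re w + M / d \<ge> 0\<close> makes the power
        decreasing in its base, so the left end of the interval dominates.\<close>
      also have "\<dots> \<le> K * (\<Lambda> + real m ^ d) powr (- Re w - M / d)"
      proof (intro mult_left_mono K(1) powr_mono2')
        show "0 < \<Lambda> + real m ^ d" using L by (simp add: add_pos_nonneg)
        show "\<Lambda> + real m ^ d \<le> \<Lambda> + (real m + x) ^ d" using x by (intro add_left_mono power_mono) auto
      qed (use e in simp)
      finally show "norm (of_real (bernoulli_fun M x) * em_fun d \<gamma> w A M (of_real (real m + x))) \<le>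
          B * K * (\<Lambda> + real m ^ d) powr (- Re w - M / d)"
        using B(2)[OF x] B(1) unfolding norm_mult mult.assoc by (intro mult_mono) auto
    qed simp
    then show ?thesis by simp
  qed
  moreover have "B * K \<ge> 0" using B K by simp
  ultimately show ?thesis by blast
qed

lemma holomorphic_param_integral:
  assumes f: "continuous_on {0..1} f" and L: "continuous_on {0..1} L"
  shows "(\<lambda>w. integral {0..1::real} (\<lambda>x. f x * exp (w * L x) :: complex)) holomorphic_on UNIV"
proof -
  have "(\<lambda>w. integral (cbox 0 (1::real)) (\<lambda>x. f x * exp (w * L x))) holomorphic_on UNIV"
  proof (rule leibniz_rule_holomorphic)
    show "((\<lambda>w. f t * exp (w * L t)) has_field_derivative f t * (exp (w * L t) * L t)) (at w within UNIV)" for w t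
      by (auto intro!: derivative_eq_intros)
    show "(\<lambda>x. f x * exp (w * L x)) integrable_on cbox 0 1" for w
      by (intro integrable_continuous continuous_intros) (use f L in auto)
    have f': "continuous_on (UNIV \<times> cbox 0 1) (\<lambda>p::complex \<times> real. f (snd p))"
      by (rule continuous_on_compose2[OF f]) (auto intro!: continuous_intros)
    have L': "continuous_on (UNIV \<times> cbox 0 1) (\<lambda>p::complex \<times> real. L (snd p))"
      by (rule continuous_on_compose2[OF L]) (auto intro!: continuous_intros)
    show "continuous_on (UNIV \<times> cbox 0 1) (\<lambda>(w, t). f t * (exp (w * L t) * L t))"
      unfolding case_prod_unfold by (intro continuous_intros f' L')
  qed simp
  then show ?thesis by simp
qed

text \<open>In the closed form of the derivative the parameter separates: binomials polynomial in
  \<open>w\<close> stand before the integral, and inside only the kernel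
  \<open>exp (- w * Ln (S x))\<close> depends on \<open>w\<close>.\<close>

lemma em_rem_holomorphic:
  assumes d: "d \<ge> 1" and A: "Re A > 0" "Re \<gamma> > 0"
  shows "(\<lambda>w. em_rem d \<gamma> M w A m) holomorphic_on UNIV"
proof -
  define S where "S x = A + \<gamma> * of_real (real m + x) ^ d" for x
  have S: "S x \<notin> \<real>\<^sub>\<le>\<^sub>0" if "x \<in> {0..1}" for x
    unfolding S_def using that by (intro affine_notin_nonpos A) auto
  have cS: "continuous_on {0..1} S" unfolding S_def by (intro continuous_intros)
  have cL: "continuous_on {0..1} (\<lambda>x. Ln (S x))" by (intro continuous_on_Ln' cS S)
  define f where "f l x = of_real (bernoulli_fun M x) * of_real (real m + x) ^ (d * l - M) * exp (- of_nat l * Ln (S x))" for l x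
  have cf: "continuous_on {0..1} (f l)" for l
    unfolding f_def by (intro continuous_intros continuous_on_bernoulli_fun cL)
  have "em_rem d \<gamma> M w A m = (\<Sum>l\<le>M. (\<gamma> ^ l * (- w gchoose l) * diff_coeff d M l) *
     integral {0..1} (\<lambda>x. f l x * exp (w * - Ln (S x))))" for w
  proof -
    have "em_rem d \<gamma> M w A m = integral {0..1} (\<lambda>x. \<Sum>l\<le>M. (\<gamma> ^ l * (- w gchoose l) * diff_coeff d M l) *
       (f l x * exp (w * - Ln (S x))))"
      unfolding em_rem_def
    proof (rule integral_cong)
      fix x :: real assume x: "x \<in> {0..1}"
      have "S x \<noteq> 0" using S[OF x] by auto
      then have pw: "S x powr (- w - of_nat l) = exp (- of_nat l * Ln (S x)) * exp (w * - Ln (S x))" for l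
        by (simp add: powr_def algebra_simps flip: exp_add)
      show "of_real (bernoulli_fun M x) * em_fun d \<gamma> w A M (of_real (real m + x)) =
        (\<Sum>l\<le>M. (\<gamma> ^ l * (- w gchoose l) * diff_coeff d M l) * (f l x * exp (w * - Ln (S x))))"
        unfolding em_fun_def S_def[symmetric] sum_distrib_left pw f_def
        by (intro sum.cong) (simp_all only: mult_ac)
    qed
    also have "\<dots> = (\<Sum>l\<le>M. (\<gamma> ^ l * (- w gchoose l) * diff_coeff d M l) *
     integral {0..1} (\<lambda>x. f l x * exp (w * - Ln (S x))))"
      by (subst integral_sum)
         (auto intro!: integrable_continuous_real continuous_intros cf cL)
    finally show ?thesis .
  qed
  then have "(\<lambda>w. em_rem d \<gamma> M w A m) = (\<lambda>w. \<Sum>l\<le>M. (\<gamma> ^ l * (- w gchoose l) * diff_coeff d M l) *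
     integral {0..1} (\<lambda>x. f l x * exp (w * - Ln (S x))))" by auto
  moreover have "\<dots> holomorphic_on UNIV"
    by (intro holomorphic_intros holomorphic_gbinomial holomorphic_param_integral cf continuous_intros cL)
  ultimately show ?thesis by simp
qed

lemma em_partial_sum:
  assumes d: "d \<ge> 1" and A: "Re A > 0" "Re \<gamma> > 0" and M: "M \<ge> 1"
  shows "(\<Sum>m<X. em_rem d \<gamma> 0 w A m) = (\<Sum>m<X. em_fun d \<gamma> w A 0 (of_nat (Suc m))) +
    (em_fun d \<gamma> w A 0 0 - em_fun d \<gamma> w A 0 (of_nat X)) / 2 -
    (\<Sum>k\<in>{1..<M}. of_real (bernoulli_coeff (Suc k)) * (em_fun d \<gamma> w A k (of_nat X) - em_fun d \<gamma> w A k 0)) +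
    (- 1) ^ M * (\<Sum>m<X. em_rem d \<gamma> M w A m)"
proof -
  define \<Phi> where "\<Phi> k m = em_fun d \<gamma> w A k (of_nat m)" for k m
  have unit: "em_rem d \<gamma> 0 w A m = (\<Phi> 0 m + \<Phi> 0 (Suc m)) / 2 -
    (\<Sum>k\<in>{1..<M}. of_real (bernoulli_coeff (Suc k)) * (\<Phi> k (Suc m) - \<Phi> k m)) + (- 1) ^ M * em_rem d \<gamma> M w A m" for m
    unfolding em_rem_def
    by (subst euler_maclaurin_unit[where g = "\<lambda>k x. em_fun d \<gamma> w A k (of_real (real m + x))", OF em_fun_vector_deriv[OF d A] M])
       (auto simp: \<Phi>_def add.commute)
  have "(\<Sum>m<X. em_rem d \<gamma> 0 w A m) = (\<Sum>m<X. (\<Phi> 0 m + \<Phi> 0 (Suc m)) / 2) -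
    (\<Sum>m<X. \<Sum>k\<in>{1..<M}. of_real (bernoulli_coeff (Suc k)) * (\<Phi> k (Suc m) - \<Phi> k m)) + (- 1) ^ M * (\<Sum>m<X. em_rem d \<gamma> M w A m)"
    unfolding unit by (simp add: sum.distrib sum_subtractf sum_distrib_left)
  also have "(\<Sum>m<X. (\<Phi> 0 m + \<Phi> 0 (Suc m)) / 2) = (\<Sum>m<X. \<Phi> 0 (Suc m)) + (\<Phi> 0 0 - \<Phi> 0 X) / 2"
  proof (induction X)
    case (Suc X)
    show ?case unfolding sum.lessThan_Suc Suc.IH by (simp add: field_simps)
  qed simp
  also have "(\<Sum>m<X. \<Sum>k\<in>{1..<M}. of_real (bernoulli_coeff (Suc k)) * (\<Phi> k (Suc m) - \<Phi> k m)) =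
    (\<Sum>k\<in>{1..<M}. of_real (bernoulli_coeff (Suc k)) * (\<Phi> k X - \<Phi> k 0))"
    by (subst sum.swap) (simp add: sum_lessThan_telescope flip: sum_distrib_left)
  finally show ?thesis by (simp add: \<Phi>_def)
qed

lemma summable_of_powr_bound:
  fixes f :: "nat \<Rightarrow> complex"
  assumes d: "d \<ge> 1" and \<sigma>: "\<sigma> > 1 / real d" and L: "\<Lambda> \<ge> 1"
    and f: "\<And>m. norm (f m) \<le> K * (\<Lambda> + real m ^ d) powr (- \<sigma>)"
  shows "(\<lambda>m. norm (f m)) summable_on UNIV" "f summable_on UNIV"
proof -
  show "(\<lambda>m. norm (f m)) summable_on UNIV"
    by (rule summable_on_comparison_test[OF summable_on_cmult_right[OF sum_powr_bound(1)[OF d \<sigma> L], of K]])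
       (use f in auto)
  then show "f summable_on UNIV" by (rule abs_summable_summable)
qed

lemma complex_bounds:
  assumes "Re A > 0" "Re \<gamma> > 0"
  obtains c H where "c > 0" "H > 0" "c \<le> Re \<gamma>" "norm \<gamma> \<le> H" "c * 1 \<le> Re A" "norm A \<le> H * 1"
proof (rule that[of "min (Re A) (Re \<gamma>)" "max (norm A) (norm \<gamma>)"])
  show "0 < max (norm A) (norm \<gamma>)" using assms by (auto simp: less_max_iff_disj)
qed (use assms in auto)

lemma em_rem_summable:
  assumes d: "d \<ge> 1" and A: "Re A > 0" "Re \<gamma> > 0" and w: "Re w + M / d > 1 / d"
  shows "em_rem d \<gamma> M w A summable_on UNIV"
proof -
  obtain c H where c: "c > 0" "H > 0" "c \<le> Re \<gamma>" "norm \<gamma> \<le> H" "c * 1 \<le> Re A" "norm A \<le> H * 1"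
    by (rule complex_bounds[OF A])
  from em_rem_bound[OF d c(1-4), of "norm w" M] obtain K where
    "\<And>m. Re w + M / d \<ge> 0 \<Longrightarrow> norm (em_rem d \<gamma> M w A m) \<le> K * (1 + real m ^ d) powr (- Re w - M / d)"
    using c(5,6) by (metis order_refl)
  moreover have "Re w + M / d \<ge> 0" using w by (smt (verit) divide_nonneg_nonneg of_nat_0_le_iff)
  ultimately have "\<And>m. norm (em_rem d \<gamma> M w A m) \<le> K * (1 + real m ^ d) powr (- (Re w + M / d))" by simp
  from summable_of_powr_bound(2)[OF d w _ this] show ?thesis by simp
qed

lemma em_fun_summable:
  assumes d: "d \<ge> 1" and A: "Re A > 0" "Re \<gamma> > 0" and w: "Re w > 1 / d"
  shows "(\<lambda>m. em_fun d \<gamma> w A r (of_nat m)) summable_on UNIV"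
proof -
  obtain c H where c: "c > 0" "H > 0" "c \<le> Re \<gamma>" "norm \<gamma> \<le> H" "c * 1 \<le> Re A" "norm A \<le> H * 1"
    by (rule complex_bounds[OF A])
  from em_fun_bound[OF d c(1-4), of "norm w" r] obtain K where
    K: "\<And>x. x \<ge> 0 \<Longrightarrow> norm (em_fun d \<gamma> w A r (of_real x)) \<le> K * (1 + x ^ d) powr (- Re w - r / d)"
    using c(5,6) by (metis order_refl)
  have "norm (em_fun d \<gamma> w A r (of_nat m)) \<le> K * (1 + real m ^ d) powr (- (Re w + r / d))" for m
    using K[of "real m"] by simp
  moreover have "Re w + r / d > 1 / d" using w by (smt (verit) divide_nonneg_nonneg of_nat_0_le_iff)
  ultimately show ?thesis using summable_of_powr_bound(2)[OF d] by (metis order_refl)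
qed

lemma summable_on_imp_tendsto_0:
  fixes f :: "nat \<Rightarrow> complex"
  assumes "f summable_on UNIV"
  shows "f \<longlonglongrightarrow> 0"
  using assms has_sum_imp_sums[OF has_sum_infsum] by (blast intro: summable_LIMSEQ_zero sums_summable)

text \<open>For \<open>Re w > 1/d\<close> this is the integral of
  \<open>(A + \<gamma> x^d)^(-w)\<close> over \<open>[0, \<infinity>)\<close>, cut into unit
  intervals.\<close>

definition em_int :: "nat \<Rightarrow> complex \<Rightarrow> complex \<Rightarrow> complex \<Rightarrow> complex" where
  "em_int d \<gamma> w A = (\<Sum>\<^sub>\<infinity>m. em_rem d \<gamma> 0 w A m)"

lemma em_int_sums:
  assumes d: "d \<ge> 1" and A: "Re A > 0" "Re \<gamma> > 0" and w: "Re w > 1 / d"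
  shows "em_rem d \<gamma> 0 w A sums em_int d \<gamma> w A"
  unfolding em_int_def
  by (intro has_sum_imp_sums has_sum_infsum em_rem_summable d A) (use w in simp)

text \<open>Boundary terms at the far end tend to \<open>0\<close>. The sum starts at
  \<open>k = 1\<close>, so the value at \<open>0\<close>, which carries weight \<open>1/2\<close> in
  the trapezoidal rule, enters with \<open>-1/2\<close>: this is the \<open>-1/2\<close> of the
  theorem.\<close>

lemma euler_maclaurin:
  assumes d: "d \<ge> 1" and A: "Re A > 0" "Re \<gamma> > 0" and M: "M \<ge> 1" and w: "Re w > 1 / d"
  shows "((\<lambda>k. (A + \<gamma> * of_nat k ^ d) powr (- w)) has_sum
     (em_int d \<gamma> w A - A powr (- w) / 2 - (\<Sum>k\<in>{1..<M}. of_real (bernoulli_coeff (Suc k)) * em_fun d \<gamma> w A k 0) -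
     (- 1) ^ M * (\<Sum>\<^sub>\<infinity>m. em_rem d \<gamma> M w A m))) {1..}"
proof -
  have wM: "Re w + M / d > 1 / d" using w by (smt (verit) divide_nonneg_nonneg of_nat_0_le_iff)
  have J: "em_rem d \<gamma> M w A sums (\<Sum>\<^sub>\<infinity>m. em_rem d \<gamma> M w A m)"
    by (intro has_sum_imp_sums has_sum_infsum em_rem_summable d A wM)
  have t0: "(\<lambda>X. em_fun d \<gamma> w A k (of_nat X)) \<longlonglongrightarrow> 0" for k
    by (rule summable_on_imp_tendsto_0[OF em_fun_summable[OF d A w]])
  define R where "R = em_int d \<gamma> w A - em_fun d \<gamma> w A 0 0 / 2 - (\<Sum>k\<in>{1..<M}. of_real (bernoulli_coeff (Suc k)) * em_fun d \<gamma> w A k 0) -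
     (- 1) ^ M * (\<Sum>\<^sub>\<infinity>m. em_rem d \<gamma> M w A m)"
  have "(\<lambda>X. (\<Sum>m<X. em_rem d \<gamma> 0 w A m) -
     (em_fun d \<gamma> w A 0 0 - em_fun d \<gamma> w A 0 (of_nat X)) / 2 +
     (\<Sum>k\<in>{1..<M}. of_real (bernoulli_coeff (Suc k)) * (em_fun d \<gamma> w A k (of_nat X) - em_fun d \<gamma> w A k 0)) -
     (- 1) ^ M * (\<Sum>m<X. em_rem d \<gamma> M w A m)) \<longlonglongrightarrow>
     em_int d \<gamma> w A - (em_fun d \<gamma> w A 0 0 - 0) / 2 +
     (\<Sum>k\<in>{1..<M}. of_real (bernoulli_coeff (Suc k)) * (0 - em_fun d \<gamma> w A k 0)) -
     (- 1) ^ M * (\<Sum>\<^sub>\<infinity>m. em_rem d \<gamma> M w A m)"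
    by (intro tendsto_intros t0 J[unfolded sums_def] em_int_sums[OF d A w, unfolded sums_def]) simp
  moreover have "em_int d \<gamma> w A - (em_fun d \<gamma> w A 0 0 - 0) / 2 +
     (\<Sum>k\<in>{1..<M}. of_real (bernoulli_coeff (Suc k)) * (0 - em_fun d \<gamma> w A k 0)) -
     (- 1) ^ M * (\<Sum>\<^sub>\<infinity>m. em_rem d \<gamma> M w A m) = R"
    by (simp add: R_def sum_negf)
  ultimately have "(\<lambda>m. em_fun d \<gamma> w A 0 (of_nat (Suc m))) sums R"
    unfolding sums_def em_partial_sum[OF d A M] by (simp add: algebra_simps)
  \<comment> \<open>The limit above is that of the ordered partial sums; unordered summability is
    established separately, and then both sums coincide.\<close>
  moreover have sm: "(\<lambda>m. em_fun d \<gamma> w A 0 (of_nat m)) summable_on {1..}"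
    by (rule summable_on_subset[OF em_fun_summable[OF d A w]]) simp
  moreover have bij: "bij_betw Suc UNIV {1..}"
    by (rule bij_betwI[where g = "\<lambda>n. n - 1"]) auto
  ultimately have "((\<lambda>m. em_fun d \<gamma> w A 0 (of_nat (Suc m))) has_sum R) UNIV"
    using has_sum_infsum[of "\<lambda>m. em_fun d \<gamma> w A 0 (of_nat (Suc m))" UNIV] summable_on_reindex_bij_betw[OF bij, of "\<lambda>m. em_fun d \<gamma> w A 0 (of_nat m)"]
    by (metis (no_types, lifting) has_sum_imp_sums sums_unique2)
  then have "((\<lambda>m. em_fun d \<gamma> w A 0 (of_nat m)) has_sum R) {1..}"
    using has_sum_reindex_bij_betw[OF bij, of "\<lambda>m. em_fun d \<gamma> w A 0 (of_nat m)"] by simp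
  moreover have "em_fun d \<gamma> w A 0 0 = A powr (- w)" using d by (simp add: em_fun_0 power_0_left)
  ultimately show ?thesis by (simp add: em_fun_0 R_def)
qed

section \<open>Integration by parts and the derivative in \<open>A\<close>\<close>

lemma em_rem_0: "em_rem d \<gamma> 0 w A m = integral {0..1} (\<lambda>x. (A + \<gamma> * of_real (real m + x) ^ d) powr (- w))"
  by (simp add: em_rem_def em_fun_0 bernoulli_fun_def bernoulli_coeff_0)

text \<open>For \<open>S = A + \<gamma> z^d\<close> one has \<open>z S' = d (S - A)\<close>, so the
  derivative of \<open>z S^(-w)\<close> involves only the exponents \<open>-w\<close> and
  \<open>-w-1\<close>. This one identity relates the integrals at \<open>w\<close> and
  \<open>w + 1\<close>.\<close>

lemma moment_deriv:
  fixes z :: complex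
  assumes d: "d \<ge> 1" and S: "A + \<gamma> * z ^ d \<notin> \<real>\<^sub>\<le>\<^sub>0"
  shows "((\<lambda>z. z * (A + \<gamma> * z ^ d) powr (- w)) has_field_derivative
    (1 - w * of_nat d) * (A + \<gamma> * z ^ d) powr (- w) + w * of_nat d * A * (A + \<gamma> * z ^ d) powr (- w - 1)) (at z)"
proof -
  define S where "S = A + \<gamma> * z ^ d"
  have S0: "S \<noteq> 0" using S by (auto simp: S_def)
  have "((\<lambda>z. z * (A + \<gamma> * z ^ d) powr (- w)) has_field_derivative
     S powr (- w) + z * ((- w) * S powr (- w - 1) * (\<gamma> * (of_nat d * z ^ (d - 1))))) (at z)"
    unfolding S_def using S by (auto intro!: derivative_eq_intros simp: algebra_simps)
  also have "S powr (- w) + z * ((- w) * S powr (- w - 1) * (\<gamma> * (of_nat d * z ^ (d - 1)))) =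
     S powr (- w) - w * of_nat d * (\<gamma> * (z * z ^ (d - 1))) * S powr (- w - 1)"
    by (simp add: algebra_simps)
  also have "\<gamma> * (z * z ^ (d - 1)) = S - A"
    using d by (simp add: S_def power_eq_if)
  also have "S powr (- w) - w * of_nat d * (S - A) * S powr (- w - 1) =
     S powr (- w) - w * of_nat d * (S * S powr (- w - 1)) + w * of_nat d * A * S powr (- w - 1)"
    by (simp add: algebra_simps)
  also have "S * S powr (- w - 1) = S powr (- w)"
    using S0 by (simp add: powr_diff)
  finally show ?thesis by (simp only: S_def left_diff_distrib mult_1_left)
qed

lemma em_rem_by_parts:
  assumes d: "d \<ge> 1" and A: "Re A > 0" "Re \<gamma> > 0"
  shows "of_nat (Suc m) * em_fun d \<gamma> w A 0 (of_nat (Suc m)) - of_nat m * em_fun d \<gamma> w A 0 (of_nat m) =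
    (1 - w * of_nat d) * em_rem d \<gamma> 0 w A m + w * of_nat d * A * em_rem d \<gamma> 0 (w + 1) A m"
proof -
  let ?S = "\<lambda>x. A + \<gamma> * of_real (real m + x) ^ d"
  have int: "(\<lambda>x. ?S x powr w) integrable_on {0..1}" for w
    using integrable_continuous_real[OF continuous_on_em_fun[OF d A, of "- w" 0 m]] by (simp only: em_fun_0 minus_minus)
  have "((\<lambda>x. (1 - w * of_nat d) * ?S x powr (- w) + w * of_nat d * A * ?S x powr (- w - 1)) has_integral
     (of_real (real m + 1) * ?S 1 powr (- w) - of_real (real m + 0) * ?S 0 powr (- w))) {0..1}"
  proof (rule fundamental_theorem_of_calculus)
    fix x :: real assume x: "x \<in> {0..1}"
    let ?g = "\<lambda>z. z * (A + \<gamma> * z ^ d) powr (- w)"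
    let ?g' = "\<lambda>z. (1 - w * of_nat d) * (A + \<gamma> * z ^ d) powr (- w) + w * of_nat d * A * (A + \<gamma> * z ^ d) powr (- w - 1)"
    have "(?g has_field_derivative ?g' (of_real x + of_nat m)) (at (of_real x + of_nat m))"
      using moment_deriv[OF d affine_notin_nonpos[OF A, of "real m + x" d]] x by (simp add: add.commute)
    then have "((\<lambda>z. ?g (z + of_nat m)) has_field_derivative ?g' (of_real x + of_nat m)) (at (of_real x))"
      by (simp only: DERIV_shift)
    from has_vector_derivative_real_field[OF this]
    show "((\<lambda>x. of_real (real m + x) * ?S x powr (- w)) has_vector_derivative
       (1 - w * of_nat d) * ?S x powr (- w) + w * of_nat d * A * ?S x powr (- w - 1)) (at x within {0..1})"
      by (simp add: add.commute)
  qed simp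
  from integral_unique[OF this]
  have "(1 - w * of_nat d) * integral {0..1} (\<lambda>x. ?S x powr (- w)) + w * of_nat d * A * integral {0..1} (\<lambda>x. ?S x powr (- w - 1)) =
     of_real (real m + 1) * ?S 1 powr (- w) - of_real (real m + 0) * ?S 0 powr (- w)"
    by (subst (asm) integral_add) (simp_all only: integral_mult_right integrable_on_mult_right int)
  moreover have e: "- (w + 1) = - w - 1" by simp
  moreover have "of_nat (Suc m) = complex_of_real (real m + 1)" "of_nat m = complex_of_real (real m + 0)" by simp_all
  ultimately show ?thesis unfolding em_rem_0 em_fun_0 by (simp only:)
qed

lemma em_rem_by_parts_sum:
  assumes d: "d \<ge> 1" and A: "Re A > 0" "Re \<gamma> > 0"
  shows "of_nat X * em_fun d \<gamma> w A 0 (of_nat X) =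
    (1 - w * of_nat d) * (\<Sum>m<X. em_rem d \<gamma> 0 w A m) + w * of_nat d * A * (\<Sum>m<X. em_rem d \<gamma> 0 (w + 1) A m)"
proof (induction X)
  case (Suc X)
  show ?case using em_rem_by_parts[OF d A, of X w] Suc by (simp add: algebra_simps)
qed simp

text \<open>Differentiation under the integral sign raises \<open>w\<close> by one, so that
  \<open>em_rem_by_parts\<close> can evaluate the derivative in \<open>A\<close>.\<close>

lemma em_rem_deriv_param:
  assumes d: "d \<ge> 1" and A: "Re A > 0" "Re \<gamma> > 0"
  shows "((\<lambda>A. em_rem d \<gamma> 0 w A m) has_field_derivative - w * em_rem d \<gamma> 0 (w + 1) A m) (at A)"
proof -
  let ?U = "{z. Re z > 0}"
  have nz: "z + \<gamma> * of_real (real m + x) ^ d \<notin> \<real>\<^sub>\<le>\<^sub>0" if "z \<in> ?U" "x \<in> {0..1}" for z x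
    using affine_notin_nonpos[of z \<gamma> "real m + x" d] that A by simp
  have "((\<lambda>A. integral (cbox 0 1) (\<lambda>x. (A + \<gamma> * of_real (real m + x) ^ d) powr (- w))) has_field_derivative
     integral (cbox 0 1) (\<lambda>x. - w * (A + \<gamma> * of_real (real m + x) ^ d) powr (- w - 1))) (at A within ?U)"
  proof (rule leibniz_rule_field_derivative)
    fix z and x :: real assume z: "z \<in> ?U" and x: "x \<in> cbox 0 1"
    have "z + \<gamma> * of_real (real m + x) ^ d \<notin> \<real>\<^sub>\<le>\<^sub>0" using nz z x by simp
    then show "((\<lambda>z. (z + \<gamma> * of_real (real m + x) ^ d) powr (- w)) has_field_derivative
       - w * (z + \<gamma> * of_real (real m + x) ^ d) powr (- w - 1)) (at z within ?U)"
      by (auto intro!: derivative_eq_intros)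
  next
    fix z assume "z \<in> ?U"
    then show "(\<lambda>x. (z + \<gamma> * of_real (real m + x) ^ d) powr (- w)) integrable_on cbox 0 1"
      using integrable_continuous_real[OF continuous_on_em_fun[OF d _ A(2), of z w 0 m]] by (simp add: em_fun_0)
  next
    have "continuous_on (?U \<times> cbox 0 1) (\<lambda>p::complex \<times> real. - w * (fst p + \<gamma> * of_real (real m + snd p) ^ d) powr (- w - 1))"
    proof (intro continuous_intros continuous_on_powr_complex)
      have re: "Re (fst p + \<gamma> * of_real (real m + snd p) ^ d) > 0" if "p \<in> ?U \<times> cbox 0 1" for p :: "complex \<times> real"
        using Re_affine_pos[of "fst p" \<gamma> "real m + snd p" d] that A by (simp add: mem_Times_iff)
      then show "?U \<times> cbox 0 1 \<subseteq> {p. 0 \<le> Re (fst p + \<gamma> * of_real (real m + snd p) ^ d) \<or>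
          Im (fst p + \<gamma> * of_real (real m + snd p) ^ d) \<noteq> 0}"
        by (blast intro: less_imp_le)
      \<comment> \<open>A vacuous case: the base has positive real part and is never
        \<open>0\<close>.\<close>
      show "0 < Re (- w - 1)" if "p \<in> ?U \<times> cbox 0 1" "fst p + \<gamma> * of_real (real m + snd p) ^ d = 0"
        for p :: "complex \<times> real"
        using re[OF that(1)] that(2) by (metis less_irrefl zero_complex.sel(1))
    qed
    then show "continuous_on (?U \<times> cbox 0 1) (\<lambda>(z, x). - w * (z + \<gamma> * of_real (real m + x) ^ d) powr (- w - 1))"
      by (simp add: case_prod_unfold)
  qed (use A in \<open>simp_all add: convex_halfspace_Re_gt\<close>)
  moreover have "- w - 1 = - (w + 1)" by simp
  ultimately have "((\<lambda>A. em_rem d \<gamma> 0 w A m) has_field_derivative - w * em_rem d \<gamma> 0 (w + 1) A m) (at A within ?U)"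
    unfolding em_rem_0 by (simp only: cbox_interval integral_mult_right)
  then show ?thesis using at_within_open[of A ?U] A by (simp add: open_halfspace_Re_gt)
qed

lemma boundary_tendsto_0:
  fixes \<sigma> :: real
  assumes d: "d \<ge> 1" and \<sigma>: "\<sigma> > 1 / real d"
  shows "(\<lambda>X. real X * (1 + real X ^ d) powr (- \<sigma>)) \<longlonglongrightarrow> 0"
proof (rule Lim_null_comparison)
  have \<sigma>0: "\<sigma> > 0" using \<sigma> by (smt (verit) of_nat_0_le_iff divide_nonneg_nonneg)
  have e: "1 - d * \<sigma> < 0" using \<sigma> d by (simp add: field_simps)
  show "(\<lambda>X. real X powr (1 - d * \<sigma>)) \<longlonglongrightarrow> 0"
    by (rule tendsto_neg_powr[OF e filterlim_real_sequentially])
  show "\<forall>\<^sub>F X in sequentially. norm (real X * (1 + real X ^ d) powr (- \<sigma>)) \<le> real X powr (1 - d * \<sigma>)"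
  proof (rule eventually_sequentiallyI[of 1])
    fix X :: nat assume X: "X \<ge> 1"
    have "(1 + real X ^ d) powr (- \<sigma>) \<le> (real X ^ d) powr (- \<sigma>)" using X \<sigma>0 by (intro powr_mono2') auto
    also have "\<dots> = real X powr (- (d * \<sigma>))" using X by (simp add: powr_powr flip: powr_realpow)
    finally have "real X * (1 + real X ^ d) powr (- \<sigma>) \<le> real X powr 1 * real X powr (- (d * \<sigma>))"
      using X by (simp add: mult_left_mono)
    also have "\<dots> = real X powr (1 - d * \<sigma>)" unfolding powr_add[symmetric] by simp
    finally show "norm (real X * (1 + real X ^ d) powr (- \<sigma>)) \<le> real X powr (1 - d * \<sigma>)" by simp
  qed
qed

subsection \<open>The main term\<close>

text \<open>With \<open>I(A, X)\<close> the integral over \<open>[0, X]\<close>, integration by parts shows that the \<open>A\<close>-derivative of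
  \<open>A^(w - 1/d) I(A, X)\<close> is the boundary term \<open>- A^(w - 1/d - 1) X (A + \<gamma> X^d)^(-w) / d\<close>, which tends
  to 0; no contour rotation is needed.\<close>

lemma em_int_scaling:
  assumes d: "d \<ge> 1" and A: "Re A > 0" "Re \<gamma> > 0" and w: "Re w > 1 / d"
  shows "em_int d \<gamma> w A = em_int d \<gamma> w 1 * A powr (1 / of_nat d - w)"
proof -
  \<comment> \<open>One pair of constants for \<open>\<gamma>\<close> and for all points of the
    segment from \<open>1\<close> to \<open>A\<close>, along which the mean value inequality is
    applied.\<close>
  define c where "c = min (min 1 (Re A)) (Re \<gamma>)"
  define H where "H = max (max 1 (norm A)) (norm \<gamma>)"
  have "H \<ge> 1" by (simp add: H_def)
  moreover have "c > 0" using A by (simp add: c_def)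
  moreover have "c \<le> Re \<gamma>" by (simp add: c_def)
  moreover have "norm \<gamma> \<le> H" by (simp add: H_def)
  ultimately have c: "c > 0" "H > 0" "c \<le> Re \<gamma>" "norm \<gamma> \<le> H" by linarith+
  have seg: "c * 1 \<le> Re z" "norm z \<le> H * 1" "Re z > 0" if z: "z \<in> closed_segment 1 A" for z
  proof -
    obtain u where u: "0 \<le> u" "u \<le> 1" "z = (1 - u) *\<^sub>R 1 + u *\<^sub>R A" using z unfolding in_segment by blast
    have "c = (1 - u) * c + u * c" by (simp add: algebra_simps)
    also have "\<dots> \<le> (1 - u) * 1 + u * Re A" using u by (intro add_mono mult_left_mono) (auto simp: c_def)
    also have "\<dots> = Re z" using u by simp
    finally show "c * 1 \<le> Re z" by simp
    then show "Re z > 0" using c by simp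
    have "norm z \<le> (1 - u) * 1 + u * norm A"
      using norm_triangle_ineq[of "(1 - u) *\<^sub>R 1" "u *\<^sub>R A"] u by simp
    also have "\<dots> \<le> (1 - u) * H + u * H" using u by (intro add_mono mult_left_mono) (auto simp: H_def)
    finally show "norm z \<le> H * 1" by (simp add: algebra_simps)
  qed
  from em_fun_bound[OF d c, of "norm w" 0] obtain K where K: "K \<ge> 0"
    "\<And>u z \<Lambda> x. norm u \<le> norm w \<Longrightarrow> \<Lambda> \<ge> 1 \<Longrightarrow> x \<ge> 0 \<Longrightarrow> c * \<Lambda> \<le> Re z \<Longrightarrow> norm z \<le> H * \<Lambda> \<Longrightarrow>
       norm (em_fun d \<gamma> u z 0 (of_real x)) \<le> K * (\<Lambda> + x ^ d) powr (- Re u - real 0 / d)"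
    by blast
  define P where "P = exp (norm (w - 1 / of_nat d - 1) * (pi + \<bar>ln c\<bar> + \<bar>ln H\<bar>))"
  \<comment> \<open>The normalized partial integral: its derivative in \<open>z\<close> reduces to a
    boundary term that tends to \<open>0\<close> uniformly on the segment, so its limit is the same
    at \<open>A\<close> and at \<open>1\<close>.\<close>
  define D where "D X z = z powr (w - 1 / of_nat d) * (\<Sum>m<X. em_rem d \<gamma> 0 w z m)" for X z
  have bound: "norm (D X A - D X 1) \<le> (P * K * (real X * (1 + real X ^ d) powr (- Re w))) * norm (A - 1)" for X
  proof (rule field_differentiable_bound[where S = "closed_segment 1 A" and
      f' = "\<lambda>z. - (1 / of_nat d) * z powr (w - 1 / of_nat d - 1) * (of_nat X * em_fun d \<gamma> w z 0 (of_nat X))"])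
    fix z assume z: "z \<in> closed_segment 1 A"
    note sz = seg[OF z]
    have z0: "z \<notin> \<real>\<^sub>\<le>\<^sub>0" "z \<noteq> 0" using sz by (auto simp: complex_nonpos_Reals_iff)
    have d1: "((\<lambda>z. z powr (w - 1 / of_nat d)) has_field_derivative (w - 1 / of_nat d) * z powr (w - 1 / of_nat d - 1)) (at z)"
      using z0 by (auto intro!: derivative_eq_intros)
    have d2: "((\<lambda>z. \<Sum>m<X. em_rem d \<gamma> 0 w z m) has_field_derivative
        (\<Sum>m<X. - w * em_rem d \<gamma> 0 (w + 1) z m)) (at z)"
      by (rule DERIV_sum) (rule em_rem_deriv_param[OF d sz(3) A(2)])
    have "(D X has_field_derivative
       ((w - 1 / of_nat d) * z powr (w - 1 / of_nat d - 1) * (\<Sum>m<X. em_rem d \<gamma> 0 w z m) +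
         (\<Sum>m<X. - w * em_rem d \<gamma> 0 (w + 1) z m) * z powr (w - 1 / of_nat d))) (at z)"
      unfolding D_def by (rule DERIV_mult[OF d1 d2])
    also have "(\<Sum>m<X. - w * em_rem d \<gamma> 0 (w + 1) z m) * z powr (w - 1 / of_nat d) =
       - w * (\<Sum>m<X. em_rem d \<gamma> 0 (w + 1) z m) * (z * z powr (w - 1 / of_nat d - 1))"
      using z0 by (simp add: sum_distrib_left powr_diff)
    also have "(w - 1 / of_nat d) * z powr (w - 1 / of_nat d - 1) * (\<Sum>m<X. em_rem d \<gamma> 0 w z m) + \<dots> =
       - (1 / of_nat d) * z powr (w - 1 / of_nat d - 1) * ((1 - w * of_nat d) * (\<Sum>m<X. em_rem d \<gamma> 0 w z m) + w * of_nat d * z * (\<Sum>m<X. em_rem d \<gamma> 0 (w + 1) z m))"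
      using d by (simp add: field_simps)
    also have "\<dots> = - (1 / of_nat d) * z powr (w - 1 / of_nat d - 1) * (of_nat X * em_fun d \<gamma> w z 0 (of_nat X))"
      using em_rem_by_parts_sum[OF d sz(3) A(2)] by simp
    finally show "(D X has_field_derivative - (1 / of_nat d) * z powr (w - 1 / of_nat d - 1) * (of_nat X * em_fun d \<gamma> w z 0 (of_nat X)))
       (at z within closed_segment 1 A)" by (rule has_field_derivative_at_within)
    have "norm (z powr (w - 1 / of_nat d - 1)) \<le> P * 1 powr Re (w - 1 / of_nat d - 1)"
      unfolding P_def by (rule norm_powr_le) (use c sz complex_Re_le_cmod[of z] in auto)
    then have 1: "norm (z powr (w - 1 / of_nat d - 1)) \<le> P" by simp
    have 2: "norm (em_fun d \<gamma> w z 0 (of_nat X)) \<le> K * (1 + real X ^ d) powr (- Re w)"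
      using K(2)[of w 1 "real X" z] sz by simp
    have 3: "norm (- (1 / of_nat d) :: complex) \<le> 1" using d by (simp add: norm_divide)
    have "norm (- (1 / of_nat d) * z powr (w - 1 / of_nat d - 1) * (of_nat X * em_fun d \<gamma> w z 0 (of_nat X))) \<le>
       1 * P * (real X * (K * (1 + real X ^ d) powr (- Re w)))"
      unfolding norm_mult using 1 2 3 by (intro mult_mono mult_nonneg_nonneg) (auto simp: P_def K(1))
    then show "norm (- (1 / of_nat d) * z powr (w - 1 / of_nat d - 1) * (of_nat X * em_fun d \<gamma> w z 0 (of_nat X))) \<le>
       P * K * (real X * (1 + real X ^ d) powr (- Re w))" by (simp add: mult_ac)
  qed auto
  have "(\<lambda>X. (P * K * (real X * (1 + real X ^ d) powr (- Re w))) * norm (A - 1)) \<longlonglongrightarrow> P * K * 0 * norm (A - 1)"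
    by (intro tendsto_intros boundary_tendsto_0 d w)
  then have bt: "(\<lambda>X. (P * K * (real X * (1 + real X ^ d) powr (- Re w))) * norm (A - 1)) \<longlonglongrightarrow> 0" by simp
  have lim1: "(\<lambda>X. D X A - D X 1) \<longlonglongrightarrow> 0"
    by (rule Lim_null_comparison[OF always_eventually[OF allI[OF bound]] bt])
  have lim2: "(\<lambda>X. D X A - D X 1) \<longlonglongrightarrow>
     A powr (w - 1 / of_nat d) * em_int d \<gamma> w A - 1 powr (w - 1 / of_nat d) * em_int d \<gamma> w 1"
    unfolding D_def
    by (intro tendsto_intros em_int_sums[OF d _ A(2) w, unfolded sums_def]) (use A in auto)
  have e1: "em_int d \<gamma> w 1 = A powr (w - 1 / of_nat d) * em_int d \<gamma> w A"
    using LIMSEQ_unique[OF lim2 lim1] by simp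
  have "A \<noteq> 0" using A by auto
  then have e2: "A powr (w - 1 / of_nat d) * A powr (1 / of_nat d - w) = 1"
    unfolding powr_add[symmetric] by simp
  have "em_int d \<gamma> w 1 * A powr (1 / of_nat d - w) =
      (A powr (w - 1 / of_nat d) * A powr (1 / of_nat d - w)) * em_int d \<gamma> w A"
    unfolding e1 by (simp only: mult_ac)
  then show ?thesis unfolding e2 by simp
qed

text \<open>Integration by parts at \<open>A = 1\<close> with vanishing boundary term: the
  functional equation of the Beta function, which drives the continuation to the left.\<close>

lemma em_int_rec:
  assumes d: "d \<ge> 1" and \<gamma>: "Re \<gamma> > 0" and w: "Re w > 1 / d"
  shows "(w - 1 / of_nat d) * em_int d \<gamma> w 1 = w * em_int d \<gamma> (w + 1) 1"
proof -
  have o: "Re 1 > 0" by simp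
  obtain c H where c: "c > 0" "H > 0" "c \<le> Re \<gamma>" "norm \<gamma> \<le> H" "c * 1 \<le> Re 1" "norm (1::complex) \<le> H * 1"
    by (rule complex_bounds[OF o \<gamma>])
  from em_fun_bound[OF d c(1-4), of "norm w" 0] obtain K where K: "K \<ge> 0"
    "\<And>u z \<Lambda> x. norm u \<le> norm w \<Longrightarrow> \<Lambda> \<ge> 1 \<Longrightarrow> x \<ge> 0 \<Longrightarrow> c * \<Lambda> \<le> Re z \<Longrightarrow> norm z \<le> H * \<Lambda> \<Longrightarrow>
       norm (em_fun d \<gamma> u z 0 (of_real x)) \<le> K * (\<Lambda> + x ^ d) powr (- Re u - real 0 / d)"
    by blast
  have bd: "norm (of_nat X * em_fun d \<gamma> w 1 0 (of_nat X)) \<le> K * (real X * (1 + real X ^ d) powr (- Re w))" for X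
  proof -
    have "norm (em_fun d \<gamma> w 1 0 (of_nat X)) \<le> K * (1 + real X ^ d) powr (- Re w)"
      using K(2)[of w 1 "real X" 1] c(5,6) by simp
    then have "real X * norm (em_fun d \<gamma> w 1 0 (of_nat X)) \<le> real X * (K * (1 + real X ^ d) powr (- Re w))"
      by (intro mult_left_mono) auto
    then show ?thesis by (simp add: norm_mult mult_ac)
  qed
  have "(\<lambda>X. K * (real X * (1 + real X ^ d) powr (- Re w))) \<longlonglongrightarrow> K * 0"
    by (intro tendsto_intros boundary_tendsto_0 d w)
  then have bt: "(\<lambda>X. K * (real X * (1 + real X ^ d) powr (- Re w))) \<longlonglongrightarrow> 0" by simp
  have lim1: "(\<lambda>X. of_nat X * em_fun d \<gamma> w 1 0 (of_nat X)) \<longlonglongrightarrow> 0"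
    by (rule Lim_null_comparison[OF always_eventually[OF allI[OF bd]] bt])
  have lim2: "(\<lambda>X. of_nat X * em_fun d \<gamma> w 1 0 (of_nat X)) \<longlonglongrightarrow>
     (1 - w * of_nat d) * em_int d \<gamma> w 1 + w * of_nat d * 1 * em_int d \<gamma> (w + 1) 1"
    unfolding em_rem_by_parts_sum[OF d o \<gamma>]
    by (intro tendsto_intros em_int_sums[OF d o \<gamma>, unfolded sums_def] w) (use w in simp)
  have "(1 - w * of_nat d) * em_int d \<gamma> w 1 + w * of_nat d * 1 * em_int d \<gamma> (w + 1) 1 = 0"
    by (rule LIMSEQ_unique[OF lim2 lim1])
  then show ?thesis using d by (simp add: field_simps)
qed

section \<open>Continuation of the main term in \<open>w\<close>\<close>

text \<open>Order \<open>M\<close> moves the half-plane of convergence to the left by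
  \<open>M/d\<close>. The case \<open>M = 0\<close> serves \<open>em_int\<close>, larger
  \<open>M\<close> the case of one variable.\<close>

lemma em_rem_sum_holomorphic:
  assumes d: "d \<ge> 1" and \<gamma>: "Re \<gamma> > 0"
  shows "(\<lambda>w. \<Sum>\<^sub>\<infinity>m. em_rem d \<gamma> M w 1 m) holomorphic_on {w. Re w > 1 / d - M / d}"
proof (rule holomorphic_infsum)
  have o: "Re 1 > 0" by simp
  show "open {w. Re w > 1 / d - M / d}" by (rule open_halfspace_Re_gt)
  show "(\<lambda>w. em_rem d \<gamma> M w 1 m) holomorphic_on {w. Re w > 1 / d - M / d}" for m
    using em_rem_holomorphic[OF d o \<gamma>] by (rule holomorphic_on_subset) simp
  fix w0 assume w0: "w0 \<in> {w. Re w > 1 / d - M / d}"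
  then have "1 / d < Re w0 + M / d" by simp
  \<comment> \<open>A value strictly in between leaves room for a neighbourhood of \<open>w0\<close>
    with one common summable majorant.\<close>
  then obtain \<sigma> where \<sigma>: "1 / d < \<sigma>" "\<sigma> < Re w0 + M / d" using dense by blast
  obtain c H where c: "c > 0" "H > 0" "c \<le> Re \<gamma>" "norm \<gamma> \<le> H" "c * 1 \<le> Re 1" "norm (1::complex) \<le> H * 1"
    by (rule complex_bounds[OF o \<gamma>])
  from em_rem_bound[OF d c(1-4), of "norm w0 + 1" M] obtain K where K: "K \<ge> 0"
    "\<And>w A \<Lambda> m. norm w \<le> norm w0 + 1 \<Longrightarrow> \<Lambda> \<ge> 1 \<Longrightarrow> c * \<Lambda> \<le> Re A \<Longrightarrow> norm A \<le> H * \<Lambda> \<Longrightarrow> Re w + M / d \<ge> 0 \<Longrightarrow>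
      norm (em_rem d \<gamma> M w A m) \<le> K * (\<Lambda> + real m ^ d) powr (- Re w - M / d)"
    by blast
  have \<sigma>0: "\<sigma> > 0" using \<sigma>(1) by (smt (verit) of_nat_0_le_iff divide_nonneg_nonneg)
  show "\<exists>V B. open V \<and> w0 \<in> V \<and> B summable_on UNIV \<and>
      (\<forall>m\<in>UNIV. \<forall>u\<in>V \<inter> {w. Re w > 1 / d - M / d}. norm (em_rem d \<gamma> M u 1 m) \<le> B m)"
  proof (intro exI conjI ballI)
    show "open ({w. Re w > \<sigma> - M / d} \<inter> ball w0 1)" by (intro open_Int open_halfspace_Re_gt open_ball)
    show "w0 \<in> {w. Re w > \<sigma> - M / d} \<inter> ball w0 1" using \<sigma> by simp
    show "(\<lambda>m. K * (1 + real m ^ d) powr (- \<sigma>)) summable_on UNIV"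
      by (intro summable_on_cmult_right sum_powr_bound(1) d \<sigma>) simp
    fix m :: nat and u assume u: "u \<in> ({w. Re w > \<sigma> - M / d} \<inter> ball w0 1) \<inter> {w. Re w > 1 / d - M / d}"
    have "norm u \<le> norm w0 + 1" using u norm_triangle_sub[of u w0] by (simp add: dist_norm norm_minus_commute)
    then have "norm (em_rem d \<gamma> M u 1 m) \<le> K * (1 + real m ^ d) powr (- Re u - M / d)"
      using K(2)[of u 1 1 m] c(5,6) u \<sigma>0 by simp
    also have "\<dots> \<le> K * (1 + real m ^ d) powr (- \<sigma>)"
      using u by (intro mult_left_mono powr_mono K(1)) auto
    finally show "norm (em_rem d \<gamma> M u 1 m) \<le> K * (1 + real m ^ d) powr (- \<sigma>)" .
  qed
qed

lemma em_int_holomorphic: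
  assumes d: "d \<ge> 1" and \<gamma>: "Re \<gamma> > 0"
  shows "(\<lambda>w. em_int d \<gamma> w 1) holomorphic_on {w. Re w > 1 / d}"
  using em_rem_sum_holomorphic[OF d \<gamma>, of 0] by (simp add: em_int_def)

text \<open>This continues \<open>rGamma (w - 1/d) * em_int d \<gamma> w 1\<close> to \<open>Re w > 1/d - T\<close> (a Beta function in disguise).
  The Pochhammer factor makes it vanish at \<open>0, -1, \<dots>, -(T - 1)\<close>.\<close>

definition em_main :: "nat \<Rightarrow> complex \<Rightarrow> nat \<Rightarrow> complex \<Rightarrow> complex" where
  "em_main d \<gamma> T w = pochhammer w T * rGamma (w + of_nat T - 1 / of_nat d) * em_int d \<gamma> (w + of_nat T) 1"

text \<open>Each unit of \<open>T\<close> uses \<open>em_int_rec\<close> once: it trades the factor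
  \<open>w\<close> for \<open>w - 1/d\<close>, which \<open>rGamma\<close> absorbs by
  \<open>z * rGamma (z + 1) = rGamma z\<close>. So all \<open>T\<close> continue the same
  function.\<close>

lemma em_main_eq:
  assumes d: "d \<ge> 1" and \<gamma>: "Re \<gamma> > 0" and w: "Re w > 1 / d"
  shows "em_main d \<gamma> T w = rGamma (w - 1 / of_nat d) * em_int d \<gamma> w 1"
  using w
proof (induction T arbitrary: w)
  case (Suc T)
  have "em_main d \<gamma> (Suc T) w = w * em_main d \<gamma> T (w + 1)"
    by (simp add: em_main_def pochhammer_rec add_ac)
  also have "\<dots> = w * (rGamma (w + 1 - 1 / of_nat d) * em_int d \<gamma> (w + 1) 1)"
    using Suc.prems by (subst Suc.IH) auto
  also have "\<dots> = rGamma (w + 1 - 1 / of_nat d) * (w * em_int d \<gamma> (w + 1) 1)" by simp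
  also have "\<dots> = ((w - 1 / of_nat d) * rGamma ((w - 1 / of_nat d) + 1)) * em_int d \<gamma> w 1"
    unfolding em_int_rec[OF d \<gamma> Suc.prems, symmetric] by (simp add: algebra_simps)
  also have "\<dots> = rGamma (w - 1 / of_nat d) * em_int d \<gamma> w 1" by (simp only: rGamma_plus1)
  finally show ?case .
qed (simp add: em_main_def)

text \<open>The extra step in \<open>Suc T\<close> is what reaches the half-plane of
  \<open>em_int\<close>: \<open>Re w > -T\<close> gives
  \<open>Re (w + T + 1) > 1 \<ge> 1/d\<close>.\<close>

lemma em_main_holomorphic:
  assumes d: "d \<ge> 1" and \<gamma>: "Re \<gamma> > 0"
  shows "(\<lambda>w. em_main d \<gamma> (Suc T) w) holomorphic_on {w. Re w > - real T}"
proof -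
  have "(\<lambda>w. em_int d \<gamma> (w + of_nat (Suc T)) 1) holomorphic_on {w. Re w > - real T}"
  proof (rule holomorphic_on_compose_gen[of _ _ "\<lambda>w. em_int d \<gamma> w 1", unfolded o_def, OF _ em_int_holomorphic[OF d \<gamma>]])
    show "(\<lambda>w. w + of_nat (Suc T)) ` {w. - real T < Re w} \<subseteq> {w. 1 / real d < Re w}"
    proof safe
      fix w assume "- real T < Re w"
      moreover have "1 / real d \<le> 1" using d by simp
      ultimately show "1 / real d < Re (w + of_nat (Suc T))" by simp
    qed
  qed (intro holomorphic_intros)
  then show ?thesis unfolding em_main_def by (intro holomorphic_intros)
qed

lemma em_main_eq_0: "P < T \<Longrightarrow> em_main d \<gamma> T (- of_nat P) = 0"
  by (auto simp: em_main_def pochhammer_eq_0_iff)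

text \<open>\<open>(1 + x)^(1-w)\<close> is an antiderivative up to the factor \<open>1 - w\<close>.
  The explicit value exhibits the pole of the Riemann zeta function in the one-variable
  case.\<close>

lemma em_int_riemann:
  assumes w: "Re w > 1"
  shows "em_int 1 1 w 1 = 1 / (w - 1)"
proof -
  have o: "Re 1 > 0" by simp
  have e1: "em_fun 1 1 (w - 1) 1 (Suc 0) z = (1 - w) * em_fun 1 1 w 1 0 z" for z
    by (simp add: em_fun_def diff_coeff_def)
  have part: "(1 - w) * em_rem 1 1 0 w 1 m = em_fun 1 1 (w - 1) 1 0 (of_nat (Suc m)) - em_fun 1 1 (w - 1) 1 0 (of_nat m)" for m
  proof -
    have "((\<lambda>x. em_fun 1 1 (w - 1) 1 (Suc 0) (of_real (real m + x))) has_integral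
      em_fun 1 1 (w - 1) 1 0 (of_real (real m + 1)) - em_fun 1 1 (w - 1) 1 0 (of_real (real m + 0))) {0..1}"
      by (rule fundamental_theorem_of_calculus) (auto intro!: em_fun_vector_deriv simp del: of_real_add)
    from integral_unique[OF this] show ?thesis
      unfolding e1 by (simp add: em_rem_0 em_fun_0 add.commute)
  qed
  have "(\<Sum>m<X. (1 - w) * em_rem 1 1 0 w 1 m) = em_fun 1 1 (w - 1) 1 0 (of_nat X) - em_fun 1 1 (w - 1) 1 0 (of_nat 0)" for X
    unfolding part by (rule sum_lessThan_telescope)
  then have s: "(1 - w) * (\<Sum>m<X. em_rem 1 1 0 w 1 m) = em_fun 1 1 (w - 1) 1 0 (of_nat X) - 1" for X
    by (simp add: sum_distrib_left em_fun_0)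
  have "(\<lambda>X. em_fun 1 1 (w - 1) 1 0 (of_nat X)) \<longlonglongrightarrow> 0"
  proof (rule tendsto_norm_zero_cancel)
    have "(\<lambda>X. real (Suc X) powr (1 - Re w)) \<longlonglongrightarrow> 0"
      by (rule tendsto_neg_powr[OF _ filterlim_compose[OF filterlim_real_sequentially filterlim_Suc]]) (use w in simp)
    moreover have "norm (em_fun 1 1 (w - 1) 1 0 (of_nat X)) = real (Suc X) powr (1 - Re w)" for X
    proof -
      have "em_fun 1 1 (w - 1) 1 0 (of_nat X) = of_real (real (Suc X)) powr (1 - w)" by (simp add: em_fun_0)
      then show ?thesis by (simp only:, subst norm_powr_real_powr) auto
    qed
    ultimately show "(\<lambda>X. norm (em_fun 1 1 (w - 1) 1 0 (of_nat X))) \<longlonglongrightarrow> 0" by simp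
  qed
  then have lim1: "(\<lambda>X. (1 - w) * (\<Sum>m<X. em_rem 1 1 0 w 1 m)) \<longlonglongrightarrow> 0 - 1"
    unfolding s by (intro tendsto_intros)
  have lim2: "(\<lambda>X. (1 - w) * (\<Sum>m<X. em_rem 1 1 0 w 1 m)) \<longlonglongrightarrow> (1 - w) * em_int 1 1 w 1"
    by (intro tendsto_intros em_int_sums[unfolded sums_def]) (use w in auto)
  have "(1 - w) * em_int 1 1 w 1 = - 1" using LIMSEQ_unique[OF lim2 lim1] by simp
  moreover have "w \<noteq> 1" using w by auto
  ultimately show ?thesis by (simp add: field_simps)
qed

subsection \<open>The polar hyperplanes\<close>

text \<open>An entire function whose product with the zeta function is entire. Unfolding the recursion, it is
  the product of \<open>1 / \<Gamma>(s_j + \<dots> + s_m - 1/e_j - \<Sum>_{k>j} \<epsilon>_k / e_k)\<close> over all \<open>j\<close> and all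
  \<open>\<epsilon>_k \<in> {0, 1}\<close>.\<close>

fun polar_factor :: "(nat \<Rightarrow> nat) \<Rightarrow> nat \<Rightarrow> (nat \<Rightarrow> complex) \<Rightarrow> complex" where
  "polar_factor e 0 s = 1"
| "polar_factor e (Suc m) s = rGamma (s (Suc m) - 1 / of_nat (e (Suc m))) *
     (if m = 0 then 1 else polar_factor e m (s(m := s m + s (Suc m) + 0)) *
        polar_factor e m (s(m := s m + s (Suc m) + - 1 / of_nat (e (Suc m)))))"

lemma mhol_polar_factor: "mhol m (polar_factor e m) UNIV"
proof (induction m)
  case 0
  have "polar_factor e 0 = (\<lambda>_. 1)" by auto
  then show ?case by (simp add: mhol_const)
next
  case (Suc m)
  have r: "mhol (Suc m) (\<lambda>s. rGamma (s (Suc m) - 1 / of_nat (e (Suc m)))) UNIV"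
    by (rule mhol_compose[where U = UNIV and g = "\<lambda>z. rGamma (z - 1 / of_nat (e (Suc m)))"])
       (auto intro!: mhol_coord holomorphic_intros)
  have "polar_factor e (Suc m) = (\<lambda>s. rGamma (s (Suc m) - 1 / of_nat (e (Suc m))) *
     (if m = 0 then 1 else polar_factor e m (s(m := s m + s (Suc m) + 0)) *
        polar_factor e m (s(m := s m + s (Suc m) + - 1 / of_nat (e (Suc m))))))" by auto
  moreover have "mhol (Suc m) \<dots> UNIV"
  proof (cases "m = 0")
    case True
    then show ?thesis using r by simp
  next
    case False
    have "mhol (Suc m) (\<lambda>s. rGamma (s (Suc m) - 1 / of_nat (e (Suc m))) *
      (polar_factor e m (s(m := s m + s (Suc m) + 0)) * polar_factor e m (s(m := s m + s (Suc m) + - 1 / of_nat (e (Suc m)))))) UNIV"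
      by (intro mhol_mult r mhol_shift Suc.IH)
    then show ?thesis using False by simp
  qed
  ultimately show ?case by simp
qed

lemma sum_shift_last:
  assumes "j \<in> {1..m}"
  shows "(\<Sum>k\<in>{j..m}. (s(m := s m + s (Suc m) + t)) k) = (\<Sum>k\<in>{j..Suc m}. s k) + (t :: complex)"
proof -
  have "{j..m} = insert m {j..<m}" using assms by auto
  then show ?thesis using assms by simp
qed

text \<open>\<open>1 / \<Gamma>\<close> vanishes exactly at the nonpositive integers
  \<open>- i\<close>. Descending through the recursion, \<open>\<epsilon>\<close> records for each
  variable which of the two translates was taken.\<close>

lemma polar_factor_eq_0:
  assumes "polar_factor e m s = 0"
  shows "\<exists>j\<in>{1..m}. \<exists>\<epsilon>\<in>{j+1..m} \<rightarrow> {0, 1::nat}. \<exists>i::nat.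
    (\<Sum>k\<in>{j..m}. s k) = of_real (1 / real (e j) + (\<Sum>k\<in>{j+1..m}. real (\<epsilon> k) / real (e k)) - real i)"
  using assms
proof (induction m arbitrary: s)
  case (Suc m)
  \<comment> \<open>The translate is written with \<open>b \<in> {0, 1}\<close> so that both
    branches are treated at once; \<open>b\<close> becomes the new value
    \<open>\<epsilon> (Suc m)\<close>.\<close>
  have shift: ?case if z: "polar_factor e m (s(m := s m + s (Suc m) + - of_nat b / of_nat (e (Suc m)))) = 0"
    and b: "b \<in> {0, 1}" for b :: nat
  proof -
    from Suc.IH[OF z] obtain j \<epsilon> i where j: "j \<in> {1..m}" and \<epsilon>: "\<epsilon> \<in> {j+1..m} \<rightarrow> {0, 1::nat}"
      and i: "(\<Sum>k\<in>{j..m}. (s(m := s m + s (Suc m) + - of_nat b / of_nat (e (Suc m)))) k) =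
        of_real (1 / real (e j) + (\<Sum>k\<in>{j+1..m}. real (\<epsilon> k) / real (e k)) - real i)" by blast
    define \<delta> where "\<delta> = \<epsilon>(Suc m := b)"
    have "(\<Sum>k\<in>{j+1..m}. real (\<delta> k) / real (e k)) = (\<Sum>k\<in>{j+1..m}. real (\<epsilon> k) / real (e k))"
      by (rule sum.cong) (auto simp: \<delta>_def)
    then have d: "(\<Sum>k\<in>{j+1..Suc m}. real (\<delta> k) / real (e k)) =
        (\<Sum>k\<in>{j+1..m}. real (\<epsilon> k) / real (e k)) + real b / real (e (Suc m))"
      using j by (simp add: \<delta>_def)
    have "(\<Sum>k\<in>{j..Suc m}. s k) = of_real (1 / real (e j) + (\<Sum>k\<in>{j+1..Suc m}. real (\<delta> k) / real (e k)) - real i)"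
      unfolding d using i unfolding sum_shift_last[OF j] by (simp add: algebra_simps)
    moreover have "\<delta> \<in> {j+1..Suc m} \<rightarrow> {0, 1}" using \<epsilon> b by (auto simp: \<delta>_def Pi_iff)
    moreover have "j \<in> {1..Suc m}" using j by simp
    ultimately show ?thesis by blast
  qed
  have "rGamma (s (Suc m) - 1 / of_nat (e (Suc m))) = 0 \<or>
     polar_factor e m (s(m := s m + s (Suc m) + - of_nat 0 / of_nat (e (Suc m)))) = 0 \<or>
     polar_factor e m (s(m := s m + s (Suc m) + - of_nat 1 / of_nat (e (Suc m)))) = 0"
    using Suc.prems by (auto split: if_splits)
  then consider "rGamma (s (Suc m) - 1 / of_nat (e (Suc m))) = 0"
    | "polar_factor e m (s(m := s m + s (Suc m) + - of_nat 0 / of_nat (e (Suc m)))) = 0"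
    | "polar_factor e m (s(m := s m + s (Suc m) + - of_nat 1 / of_nat (e (Suc m)))) = 0" by blast
  then show ?case
  proof cases
    case 1
    then obtain i where i: "s (Suc m) - 1 / of_nat (e (Suc m)) = - of_nat i"
      by (auto simp: rGamma_eq_zero_iff elim!: nonpos_Ints_cases')
    then have "(\<Sum>k\<in>{Suc m..Suc m}. s k) = of_real (1 / real (e (Suc m)) + (\<Sum>k\<in>{Suc m+1..Suc m}. real (0::nat) / real (e k)) - real i)"
      by (simp add: algebra_simps)
    then show ?thesis by (intro bexI[of _ "Suc m"] bexI[of _ "\<lambda>_. 0"] exI[of _ i]) auto
  next
    case 2
    then show ?thesis by (rule shift) simp
  next
    case 3
    then show ?thesis by (rule shift) simp
  qed
qed simp

text \<open>On a polar hyperplane the tail sum is at most the one with all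
  \<open>\<epsilon> k = 1\<close> and \<open>i = 0\<close>, which is exactly the bound that the
  region exceeds strictly.\<close>

lemma polar_factor_nz_region:
  assumes "s \<in> conv_region m e"
  shows "polar_factor e m s \<noteq> 0"
proof
  assume "polar_factor e m s = 0"
  from polar_factor_eq_0[OF this] obtain j \<epsilon> i where j: "j \<in> {1..m}" and \<epsilon>: "\<epsilon> \<in> {j+1..m} \<rightarrow> {0, 1::nat}"
    and i: "(\<Sum>k\<in>{j..m}. s k) = of_real (1 / real (e j) + (\<Sum>k\<in>{j+1..m}. real (\<epsilon> k) / real (e k)) - real i)" by blast
  have "Re (\<Sum>k\<in>{j..m}. s k) = 1 / real (e j) + (\<Sum>k\<in>{j+1..m}. real (\<epsilon> k) / real (e k)) - real i"
    unfolding i by (rule Re_complex_of_real)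
  also have "\<dots> \<le> 1 / real (e j) + (\<Sum>k\<in>{j+1..m}. 1 / real (e k))"
  proof -
    have "(\<Sum>k\<in>{j+1..m}. real (\<epsilon> k) / real (e k)) \<le> (\<Sum>k\<in>{j+1..m}. 1 / real (e k))"
    proof (intro sum_mono divide_right_mono)
      fix k assume "k \<in> {j+1..m}"
      then have "\<epsilon> k \<in> {0, 1}" using \<epsilon> by (rule Pi_mem[rotated])
      then show "real (\<epsilon> k) \<le> 1" by auto
    qed simp
    then show ?thesis by simp
  qed
  also have "\<dots> = (\<Sum>k\<in>{j..m}. 1 / real (e k))"
  proof -
    have "{j..m} = insert j {j+1..m}" using j by auto
    then show ?thesis by simp
  qed
  also have "\<dots> < Re (\<Sum>k\<in>{j..m}. s k)" using assms j by (simp add: conv_region_def)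
  finally show False by simp
qed

lemma polar_factor_depends: "(\<And>i. i \<in> {1..m} \<Longrightarrow> s i = s' i) \<Longrightarrow> polar_factor e m s = polar_factor e m s'"
  by (rule depends_uptoD[OF mholD(4)[OF mhol_polar_factor]])

text \<open>From \<open>rGamma z = pochhammer z l * rGamma (z + l)\<close>, applied to every factor:
  the last variable enters each of them with coefficient one. Thus the translates by
  \<open>l\<close> in the expansion introduce no new poles.\<close>

lemma polar_factor_shift:
  assumes "m \<ge> 1"
  shows "\<exists>q. mhol m q UNIV \<and> (\<forall>s. polar_factor e m s = q s * polar_factor e m (s(m := s m + of_nat l)))"
  using assms
proof (induction m rule: nat_induct_at_least)
  case base
  have "mhol 1 (\<lambda>s. pochhammer (s 1 - 1 / of_nat (e 1)) l) UNIV"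
    by (rule mhol_compose[where U = UNIV and g = "\<lambda>z. pochhammer (z - 1 / of_nat (e 1)) l"])
       (auto intro!: mhol_coord holomorphic_intros)
  moreover have "polar_factor e 1 s = pochhammer (s 1 - 1 / of_nat (e 1)) l * polar_factor e 1 (s(1 := s 1 + of_nat l))" for s
    using pochhammer_rGamma[of "s 1 - 1 / of_nat (e 1)" l] by (simp add: algebra_simps)
  ultimately show ?case by blast
next
  case (Suc m)
  then obtain q where q: "mhol m q UNIV" "\<And>s. polar_factor e m s = q s * polar_factor e m (s(m := s m + of_nat l))" by blast
  define t where "t = - 1 / complex_of_nat (e (Suc m))"
  define Q where "Q = (\<lambda>s. pochhammer (s (Suc m) - 1 / of_nat (e (Suc m))) l *
     (q (s(m := s m + s (Suc m) + 0)) * q (s(m := s m + s (Suc m) + t))))"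
  have p: "mhol (Suc m) (\<lambda>s. pochhammer (s (Suc m) - 1 / of_nat (e (Suc m))) l) UNIV"
    by (rule mhol_compose[where U = UNIV and g = "\<lambda>z. pochhammer (z - 1 / of_nat (e (Suc m))) l"])
       (auto intro!: mhol_coord holomorphic_intros)
  have "mhol (Suc m) Q UNIV" unfolding Q_def by (intro mhol_mult p mhol_shift q(1))
  moreover have "polar_factor e (Suc m) s = Q s * polar_factor e (Suc m) (s(Suc m := s (Suc m) + of_nat l))" for s
  proof -
    have sh: "polar_factor e m (s(m := s m + s (Suc m) + u)) = q (s(m := s m + s (Suc m) + u)) *
        polar_factor e m ((s(Suc m := s (Suc m) + of_nat l))(m := s m + (s (Suc m) + of_nat l) + u))" for u
    proof -
      have "polar_factor e m ((s(m := s m + s (Suc m) + u))(m := (s(m := s m + s (Suc m) + u)) m + of_nat l)) =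
         polar_factor e m ((s(Suc m := s (Suc m) + of_nat l))(m := s m + (s (Suc m) + of_nat l) + u))"
        by (rule polar_factor_depends) auto
      then show ?thesis using q(2)[of "s(m := s m + s (Suc m) + u)"] by simp
    qed
    have r: "rGamma (s (Suc m) - 1 / of_nat (e (Suc m))) =
        pochhammer (s (Suc m) - 1 / of_nat (e (Suc m))) l * rGamma (s (Suc m) + of_nat l - 1 / of_nat (e (Suc m)))"
      using pochhammer_rGamma[of "s (Suc m) - 1 / of_nat (e (Suc m))" l] by (simp add: algebra_simps)
    have m: "m \<noteq> 0" using Suc.hyps by simp
    have "polar_factor e (Suc m) s = rGamma (s (Suc m) - 1 / of_nat (e (Suc m))) *
       (polar_factor e m (s(m := s m + s (Suc m) + 0)) * polar_factor e m (s(m := s m + s (Suc m) + t)))"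
      using m by (simp add: t_def)
    also have "\<dots> = Q s * (rGamma (s (Suc m) + of_nat l - 1 / of_nat (e (Suc m))) *
       (polar_factor e m ((s(Suc m := s (Suc m) + of_nat l))(m := s m + (s (Suc m) + of_nat l) + 0)) *
        polar_factor e m ((s(Suc m := s (Suc m) + of_nat l))(m := s m + (s (Suc m) + of_nat l) + t))))"
      unfolding r sh[of 0] sh[of t] Q_def by (simp only: mult_ac)
    also have "\<dots> = Q s * polar_factor e (Suc m) (s(Suc m := s (Suc m) + of_nat l))"
      using m by (simp add: t_def)
    finally show ?thesis .
  qed
  ultimately show ?case by blast
qed

text \<open>The last coordinate occurs in every tail sum, so making it large enough satisfies all
  inequalities at once.\<close>

lemma conv_region_upd:
  assumes "m \<ge> 1"
  obtains t where "s(m := t) \<in> conv_region m e"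
proof -
  define C where "C = (\<Sum>j\<in>{1..m}. \<bar>Re (\<Sum>i\<in>{j..<m}. s i)\<bar> + (\<Sum>i\<in>{j..m}. 1 / real (e i)))"
  have "s(m := of_real (C + 1)) \<in> conv_region m e"
    unfolding conv_region_def
  proof (intro CollectI ballI)
    fix j assume j: "j \<in> {1..m}"
    have "\<bar>Re (\<Sum>i\<in>{j..<m}. s i)\<bar> + (\<Sum>i\<in>{j..m}. 1 / real (e i)) \<le> C"
      unfolding C_def using j by (intro member_le_sum) (auto intro!: add_nonneg_nonneg sum_nonneg)
    then have "(\<Sum>i\<in>{j..m}. 1 / real (e i)) < Re (\<Sum>i\<in>{j..<m}. s i) + (C + 1)" by linarith
    also have "\<dots> = Re (\<Sum>i\<in>{j..m}. (s(m := of_real (C + 1))) i)"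
    proof -
      have "{j..m} = insert m {j..<m}" using j by auto
      then show ?thesis by simp
    qed
    finally show "(\<Sum>i\<in>{j..m}. 1 / real (e i)) < Re (\<Sum>i\<in>{j..m}. (s(m := of_real (C + 1))) i)" .
  qed
  then show thesis by (rule that)
qed

text \<open>On the line through a point of \<open>V\<close> in the last coordinate the factor is
  entire and nonzero where the line meets the region of convergence, so it cannot vanish on an open
  piece of the line.\<close>

lemma polar_factor_nz_dense:
  assumes m: "m \<ge> 1" and V: "openin (complex_space m) V" "V \<noteq> {}"
  shows "\<exists>s\<in>V. polar_factor e m s \<noteq> 0"
proof -
  obtain p where p: "p \<in> V" using V by blast
  obtain B where B: "\<And>i. i \<in> {1..m} \<Longrightarrow> open (B i)" "p \<in> Pi\<^sub>E {1..m} B" "Pi\<^sub>E {1..m} B \<subseteq> V"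
    using complex_space_box[OF V(1) p] by metis
  obtain t where "p(m := t) \<in> conv_region m e" using conv_region_upd[OF m] .
  then have t: "polar_factor e m (p(m := t)) \<noteq> 0" by (rule polar_factor_nz_region)
  have hol: "(\<lambda>z. polar_factor e m (p(m := z))) holomorphic_on UNIV"
    unfolding holomorphic_on_def
  proof
    fix z
    have "(\<lambda>z'. polar_factor e m ((p(m := z))(m := z'))) field_differentiable at ((p(m := z)) m)"
      by (rule mholD(3)[OF mhol_polar_factor]) simp
    then show "(\<lambda>z. polar_factor e m (p(m := z))) field_differentiable at z within UNIV" by simp
  qed
  have mm: "m \<in> {1..m}" using m by simp
  have "p m \<in> B m" using B(2) mm by (rule PiE_mem)
  have "\<exists>z\<in>B m. polar_factor e m (p(m := z)) \<noteq> 0"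
  proof (rule ccontr)
    assume "\<not> (\<exists>z\<in>B m. polar_factor e m (p(m := z)) \<noteq> 0)"
    then have "polar_factor e m (p(m := t)) = 0"
      using analytic_continuation_open[OF B(1)[OF mm] open_UNIV _ connected_UNIV subset_UNIV hol holomorphic_on_const[of 0], of t]
        \<open>p m \<in> B m\<close> by auto
    then show False using t by simp
  qed
  then obtain z where z: "z \<in> B m" "polar_factor e m (p(m := z)) \<noteq> 0" by blast
  have "p(m := z) \<in> Pi\<^sub>E {1..m} B" using B(2) z mm by (auto simp: PiE_iff extensional_def)
  then show ?thesis using B(3) z by blast
qed

section \<open>Passage to extensional functions and the value of the continuation\<close>

text \<open>Coordinates outside \<open>{1..m}\<close> are constantly \<open>undefined\<close> on
  extensional functions, hence continuous. This transfers openness and continuity from the whole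
  function type.\<close>

lemma continuous_map_complex_space_inclusion:
  "continuous_map (complex_space m) euclidean (\<lambda>s::nat \<Rightarrow> complex. s)"
proof -
  have "continuous_map (complex_space m) (product_topology (\<lambda>_. euclidean) UNIV) (\<lambda>s::nat \<Rightarrow> complex. s)"
    unfolding continuous_map_componentwise_UNIV
  proof
    fix k
    show "continuous_map (complex_space m) euclidean (\<lambda>s. s k :: complex)"
    proof (cases "k \<in> {1..m}")
      case True
      then show ?thesis by (rule continuous_map_product_projection)
    next
      case False
      have "continuous_map (complex_space m) euclidean (\<lambda>s::nat \<Rightarrow> complex. undefined :: complex)" by simp
      then show ?thesis
        by (rule continuous_map_eq) (use False in \<open>auto simp: PiE_iff extensional_def\<close>)
    qed
  qed
  then show ?thesis
    by (simp only: euclidean_product_topology)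
qed

lemma mhol_imp_holomorphic_several_on:
  assumes F: "mhol m F \<Omega>" and U: "openin (complex_space m) U" "U \<subseteq> \<Omega>"
  shows "holomorphic_several m F U"
proof -
  have "continuous_map (subtopology (complex_space m) U) euclidean (\<lambda>s::nat \<Rightarrow> complex. s)"
    by (rule continuous_map_from_subtopology[OF continuous_map_complex_space_inclusion])
  then have "continuous_map (subtopology (complex_space m) U) (top_of_set \<Omega>) (\<lambda>s::nat \<Rightarrow> complex. s)"
    using U(2) by (auto simp: continuous_map_in_subtopology)
  moreover have "continuous_map (top_of_set \<Omega>) euclidean F" using mholD(2)[OF F] by simp
  ultimately have "continuous_map (subtopology (complex_space m) U) euclidean (F \<circ> (\<lambda>s. s))"
    by (rule continuous_map_compose)
  then have "continuous_map (subtopology (complex_space m) U) euclidean F" by (simp add: comp_def)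
  then show ?thesis using U mholD(3)[OF F] by (auto simp: holomorphic_several_def)
qed

lemma openin_complex_space:
  assumes "open (\<Omega> :: (nat \<Rightarrow> complex) set)"
  shows "openin (complex_space m) (topspace (complex_space m) \<inter> \<Omega>)"
  using openin_continuous_map_preimage[OF continuous_map_complex_space_inclusion, of \<Omega>] assms
  by (simp add: Int_def)

text \<open>The complement \<open>D\<close> of the zero set is open and dense and contains the
  region, so the quotient on \<open>D\<close> is a continuation; by uniqueness its value at a point
  of \<open>D\<close> is the value of \<open>multizeta\<close>.\<close>

lemma multizeta_eq_quotient:
  assumes m: "m \<ge> 1" and E: "mhol m E UNIV"
    and region: "\<And>s. s \<in> conv_region m e \<Longrightarrow> E s = polar_factor e m s * multizeta_series m e \<eta> s"
    and s: "polar_factor e m s \<noteq> 0"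
  shows "multizeta m e \<eta> s = E s / polar_factor e m s"
proof -
  define \<Omega> where "\<Omega> = {s. polar_factor e m s \<noteq> 0}"
  define D where "D = topspace (complex_space m) \<inter> \<Omega>"
  have o: "open \<Omega>"
  proof -
    have "\<Omega> = polar_factor e m -` (- {0})" by (auto simp: \<Omega>_def)
    moreover have "open (polar_factor e m -` (- {0}))"
      by (rule open_vimage[OF _ mholD(2)[OF mhol_polar_factor]]) (simp add: open_Compl)
    ultimately show ?thesis by simp
  qed
  have oD: "openin (complex_space m) D" unfolding D_def by (rule openin_complex_space[OF o])
  have q: "mhol m (\<lambda>s. E s * inverse (polar_factor e m s)) \<Omega>"
    by (intro mhol_mult mhol_subset[OF E] o mhol_compose[where U = "- {0}" and g = inverse] mhol_subset[OF mhol_polar_factor])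
       (auto intro!: holomorphic_intros simp: \<Omega>_def)
  have "multizeta_continuation m e \<eta> (\<lambda>s. E s / polar_factor e m s) D"
    unfolding multizeta_continuation_def meromorphic_several_def
  proof (intro conjI ballI)
    show "holomorphic_several m (\<lambda>s. E s / polar_factor e m s) D"
      using mhol_imp_holomorphic_several_on[OF q oD] by (simp add: D_def divide_inverse)
    show "complex_space m closure_of D = topspace (complex_space m)"
      unfolding dense_intersects_open
    proof (intro allI impI)
      fix V assume V: "openin (complex_space m) V \<and> V \<noteq> {}"
      then obtain s where "s \<in> V" "polar_factor e m s \<noteq> 0" using polar_factor_nz_dense[OF m] by blast
      moreover have "V \<subseteq> topspace (complex_space m)" using V openin_subset by blast
      ultimately have "s \<in> D \<inter> V" unfolding D_def \<Omega>_def by blast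
      then show "D \<inter> V \<noteq> {}" by blast
    qed
    fix p assume p: "p \<in> topspace (complex_space m)"
    show "\<exists>U g h. p \<in> U \<and> holomorphic_several m g U \<and> holomorphic_several m h U \<and>
        (\<forall>V. openin (complex_space m) V \<and> V \<noteq> {} \<and> V \<subseteq> U \<longrightarrow> (\<exists>s\<in>V. h s \<noteq> 0)) \<and>
        (\<forall>s\<in>U \<inter> D. E s / polar_factor e m s * h s = g s)"
      \<comment> \<open>The local representation is global: \<open>U\<close> is the whole space,
        with numerator \<open>E\<close> and denominator the polar factor.\<close>
      by (intro exI[of _ "topspace (complex_space m)"] exI[of _ E] exI[of _ "polar_factor e m"] conjI p allI impI ballI
          mhol_imp_holomorphic_several_on[OF E] mhol_imp_holomorphic_several_on[OF mhol_polar_factor] openin_topspace)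
         (use polar_factor_nz_dense[OF m] in \<open>auto simp: D_def \<Omega>_def\<close>)
  next
    have reg: "s \<in> conv_region m e" if "s \<in> multizeta_region m e" for s
      using that by (simp add: multizeta_region_def conv_region_def)
    show "multizeta_region m e \<subseteq> D"
    proof
      fix s assume s: "s \<in> multizeta_region m e"
      then show "s \<in> D" using polar_factor_nz_region[OF reg[OF s]] by (simp add: D_def \<Omega>_def multizeta_region_def)
    qed
    fix s assume s: "s \<in> multizeta_region m e"
    show "E s / polar_factor e m s = multizeta_series m e \<eta> s"
      using region[OF reg[OF s]] polar_factor_nz_region[OF reg[OF s]] by simp
  qed
  moreover have r: "polar_factor e m (restrict s {1..m}) = polar_factor e m s" "E (restrict s {1..m}) = E s"
    by (rule polar_factor_depends depends_uptoD[OF mholD(4)[OF E]]; simp)+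
  moreover have "restrict s {1..m} \<in> D" using s r by (simp add: D_def \<Omega>_def)
  ultimately show ?thesis using multizeta_eqI by fastforce
qed

subsection \<open>The recursion over the number of variables\<close>

text \<open>The factor \<open>A powr (- s m)\<close> times \<open>A powr (- s (Suc m) - t)\<close>
  is the last factor of the series in \<open>m\<close> variables at this point. In the expansion
  \<open>t\<close> is \<open>- 1/d\<close>, \<open>0\<close> or a natural number.\<close>

definition merge_last :: "nat \<Rightarrow> complex \<Rightarrow> (nat \<Rightarrow> complex) \<Rightarrow> nat \<Rightarrow> complex" where
  "merge_last m t s = s(m := s m + s (Suc m) + t)"

lemma polar_factor_Suc:
  assumes "m \<ge> 1"
  shows "polar_factor e (Suc m) s = rGamma (s (Suc m) - 1 / of_nat (e (Suc m))) *
     (polar_factor e m (merge_last m 0 s) * polar_factor e m (merge_last m (- 1 / of_nat (e (Suc m))) s))"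
  using assms by (simp add: merge_last_def)

lemma mhol_merge_last: "mhol k F UNIV \<Longrightarrow> mhol (Suc k) (\<lambda>s. F (merge_last k t s)) UNIV"
  unfolding merge_last_def by (rule mhol_shift)

text \<open>The translate by \<open>- 1 / e (Suc m)\<close> is the extreme case: dropping the last
  variable lowers the bound on each tail sum by just this amount.\<close>

lemma conv_region_merge_last:
  assumes s: "s \<in> conv_region (Suc m) e" and t: "Re t \<ge> - 1 / real (e (Suc m))"
  shows "merge_last m t s \<in> conv_region m e"
  unfolding conv_region_def
proof (intro CollectI ballI)
  fix j assume j: "j \<in> {1..m}"
  have "(\<Sum>i\<in>{j..m}. 1 / real (e i)) = (\<Sum>i\<in>{j..Suc m}. 1 / real (e i)) - 1 / real (e (Suc m))" using j by simp
  also have "\<dots> \<le> (\<Sum>i\<in>{j..Suc m}. 1 / real (e i)) + Re t" using t by simp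
  also have "\<dots> < Re (\<Sum>i\<in>{j..Suc m}. s i) + Re t" using s j by (simp add: conv_region_def)
  also have "\<dots> = Re (\<Sum>i\<in>{j..m}. merge_last m t s i)"
    unfolding merge_last_def sum_shift_last[OF j] by simp
  finally show "(\<Sum>i\<in>{j..m}. 1 / real (e i)) < Re (\<Sum>i\<in>{j..m}. merge_last m t s i)" .
qed

text \<open>On \<open>half_box (m + 1) T\<close> the factors of a term grow at most like the power \<open>T\<close> of their bases.
  A derivative of order \<open>M = rem_order e m T\<close> gains the power \<open>M / e_{m+1} = T (m + 1) + m + 2\<close>,
  which is enough for convergence.\<close>

definition rem_order :: "(nat \<Rightarrow> nat) \<Rightarrow> nat \<Rightarrow> nat \<Rightarrow> nat" where
  "rem_order e m T = e (Suc m) * (T * Suc m + Suc m + 1)"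

definition rem_term :: "(nat \<Rightarrow> nat) \<Rightarrow> (nat \<Rightarrow> complex) \<Rightarrow> nat \<Rightarrow> nat \<Rightarrow> (nat \<Rightarrow> nat) \<times> nat \<Rightarrow> (nat \<Rightarrow> complex) \<Rightarrow> complex" where
  "rem_term e \<eta> m M x s = (\<Prod>j\<in>{1..m}. lin_form \<eta> e (fst x) j powr (- s j)) *
     em_rem (e (Suc m)) (\<eta> (Suc m)) M (s (Suc m)) (lin_form \<eta> e (fst x) m) (snd x)"

definition zeta_rem :: "(nat \<Rightarrow> nat) \<Rightarrow> (nat \<Rightarrow> complex) \<Rightarrow> nat \<Rightarrow> nat \<Rightarrow> (nat \<Rightarrow> complex) \<Rightarrow> complex" where
  "zeta_rem e \<eta> m M s = (\<Sum>\<^sub>\<infinity>x\<in>({1..m} \<rightarrow>\<^sub>E {1..}) \<times> UNIV. rem_term e \<eta> m M x s)"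

text \<open>With \<open>n = m + 1\<close> every tail sum of the exponents is at least
  \<open>- T n + (T n + n + 1) = n + 1\<close>, while the bound required by
  \<open>summable_lin_size\<close> is at most \<open>n\<close>.\<close>

lemma rem_majorant_summable:
  assumes e: "\<And>i. i \<in> {1..Suc m} \<Longrightarrow> e i \<ge> 1" and M: "M = rem_order e m T"
  shows "(\<lambda>x. (\<Prod>j\<in>{1..m}. lin_size e (fst x) j powr real T) *
     (lin_size e (fst x) m + real (snd x) ^ e (Suc m)) powr (real T - M / e (Suc m)))
     summable_on (({1..m} \<rightarrow>\<^sub>E UNIV) \<times> UNIV)"
proof -
  define n where "n = Suc m"
  \<comment> \<open>The worst exponents on \<open>half_box n T\<close>, with the gain
    \<open>M / e n\<close> from the remainder credited to the last one.\<close>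
  define \<sigma> where "\<sigma> = (\<lambda>_. - real T)(n := M / e n - real T)"
  have en: "e n \<ge> 1" using e[of n] by (simp add: n_def)
  have Me: "M / e n = real T * n + n + 1"
    using en by (simp add: M rem_order_def n_def field_simps)
  have "(\<lambda>a. \<Prod>j\<in>{1..n}. lin_size e a j powr (- \<sigma> j)) summable_on ({1..n} \<rightarrow>\<^sub>E UNIV)"
  proof (rule summable_lin_size)
    fix j assume j: "j \<in> {1..n}"
    have card: "real (card {j..n}) \<le> n" using j by simp
    have "(\<Sum>i\<in>{j..n}. 1 / real (e i)) \<le> (\<Sum>i\<in>{j..n}. 1)"
    proof (rule sum_mono)
      fix i assume "i \<in> {j..n}"
      then have "e i \<ge> 1" using e[of i] j by (simp add: n_def)
      then show "1 / real (e i) \<le> 1" by simp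
    qed
    also have "\<dots> = real (card {j..n})" by simp
    also have "\<dots> \<le> n" by (rule card)
    also have "\<dots> < - real T * real (card {j..n}) + M / e n"
      using mult_left_mono[OF card, of "real T"] unfolding Me by simp
    also have "\<dots> = (\<Sum>i\<in>{j..n}. \<sigma> i)"
    proof -
      have ins: "{j..n} = insert n {j..<n}" using j by auto
      have "(\<Sum>i\<in>{j..<n}. \<sigma> i) = (\<Sum>i\<in>{j..<n}. - real T)" by (rule sum.cong) (auto simp: \<sigma>_def)
      then show ?thesis unfolding ins using j by (simp add: \<sigma>_def algebra_simps)
    qed
    finally show "(\<Sum>i\<in>{j..n}. 1 / real (e i)) < (\<Sum>i\<in>{j..n}. \<sigma> i)" .
  qed (use e in \<open>simp add: n_def\<close>)
  then have "(\<lambda>x. \<Prod>j\<in>{1..n}. lin_size e ((\<lambda>(a, k). a(Suc m := k)) x) j powr (- \<sigma> j)) summable_on (({1..m} \<rightarrow>\<^sub>E UNIV) \<times> UNIV)"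
    unfolding n_def by (rule iffD2[OF summable_on_reindex_bij_betw[OF bij_betw_PiE_Suc]])
  moreover have "(\<Prod>j\<in>{1..n}. lin_size e ((\<lambda>(a, k). a(Suc m := k)) x) j powr (- \<sigma> j)) =
     (\<Prod>j\<in>{1..m}. lin_size e (fst x) j powr real T) *
     (lin_size e (fst x) m + real (snd x) ^ e (Suc m)) powr (real T - M / e (Suc m))" for x
  proof -
    have "(\<Prod>j\<in>{1..m}. lin_size e (fst x) j powr (- \<sigma> j)) = (\<Prod>j\<in>{1..m}. lin_size e (fst x) j powr real T)"
      by (rule prod.cong) (auto simp: \<sigma>_def n_def)
    then show ?thesis
      unfolding n_def case_prod_unfold prod_lin_size_upd by (simp only:) (simp add: \<sigma>_def n_def)
  qed
  ultimately show ?thesis by simp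
qed

text \<open>On \<open>V\<close> the moduli of all exponents are below \<open>Y\<close>, which makes
  the constants uniform; on the half-box the growth exponents are at most \<open>T\<close>, which
  makes the majorant independent of \<open>u\<close>.\<close>

lemma rem_term_bound:
  assumes e: "\<And>i. i \<in> {1..Suc m} \<Longrightarrow> e i \<ge> 1" and \<eta>: "\<And>i. i \<in> {1..Suc m} \<Longrightarrow> Re (\<eta> i) > 0"
    and m: "m \<ge> 1" and M: "M = rem_order e m T"
  shows "\<exists>V B. open V \<and> s \<in> V \<and> B summable_on (({1..m} \<rightarrow>\<^sub>E {1..}) \<times> UNIV) \<and>
      (\<forall>x\<in>({1..m} \<rightarrow>\<^sub>E {1..}) \<times> UNIV. \<forall>u\<in>V \<inter> half_box (Suc m) T. norm (rem_term e \<eta> m M x u) \<le> B x)"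
proof -
  obtain c H where c: "c > 0" "H > 0" "\<And>i. i \<in> {1..Suc m} \<Longrightarrow> c \<le> Re (\<eta> i)" "\<And>i. i \<in> {1..Suc m} \<Longrightarrow> norm (\<eta> i) \<le> H"
    using coeff_bounds[of "Suc m" \<eta>, OF \<eta>] by blast
  define d where "d = e (Suc m)"
  have d: "d \<ge> 1" using e[of "Suc m"] by (simp add: d_def)
  define Y where "Y = (\<Sum>j\<in>{1..Suc m}. norm (s j)) + 1"
  define V where "V = {u. \<forall>j\<in>{1..Suc m}. norm (u j :: complex) < Y}"
  have "V = (\<Inter>j\<in>{1..Suc m}. {u. norm (u j) < Y})" by (auto simp: V_def)
  also have "open \<dots>" by (intro open_INT ballI open_Collect_less continuous_intros) auto
  finally have oV: "open V" .
  have sV: "s \<in> V" unfolding V_def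
  proof (intro CollectI ballI)
    fix j assume "j \<in> {1..Suc m}"
    then have "norm (s j) \<le> (\<Sum>j\<in>{1..Suc m}. norm (s j))" by (intro member_le_sum) auto
    then show "norm (s j) < Y" by (simp add: Y_def)
  qed
  \<comment> \<open>\<open>em_rem_bound\<close> wants the same lower constant for the coefficient
    and for the outer form, and \<open>lin_form_bounds\<close> supplies only \<open>c / 2\<close>
    for the latter.\<close>
  have c2: "c / 2 > 0" "c / 2 \<le> Re (\<eta> (Suc m))" "norm (\<eta> (Suc m)) \<le> H"
    using c(1) c(3)[of "Suc m"] c(4)[of "Suc m"] by auto
  from em_rem_bound[OF d c2(1) c(2) c2(2,3), of Y M] obtain K where K: "K \<ge> 0"
    "\<And>w A \<Lambda> k. norm w \<le> Y \<Longrightarrow> \<Lambda> \<ge> 1 \<Longrightarrow> c / 2 * \<Lambda> \<le> Re A \<Longrightarrow> norm A \<le> H * \<Lambda> \<Longrightarrow> Re w + M / d \<ge> 0 \<Longrightarrow>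
      norm (em_rem d (\<eta> (Suc m)) M w A k) \<le> K * (\<Lambda> + real k ^ d) powr (- Re w - M / d)" by blast
  define P where "P = exp (Y * (pi + \<bar>ln (c / 2)\<bar> + \<bar>ln H\<bar>)) ^ m"
  have P0: "P \<ge> 0" by (simp add: P_def)
  define B where "B = (\<lambda>x. (P * K) * ((\<Prod>j\<in>{1..m}. lin_size e (fst x) j powr real T) *
     (lin_size e (fst x) m + real (snd x) ^ d) powr (real T - M / d)))"
  have Me: "M / d = real T * Suc m + Suc m + 1"
    using d by (simp add: M rem_order_def d_def field_simps)
  have "B summable_on (({1..m} \<rightarrow>\<^sub>E UNIV) \<times> UNIV)"
    unfolding B_def d_def by (rule summable_on_cmult_right[OF rem_majorant_summable[OF e M]])
  then have sB: "B summable_on (({1..m} \<rightarrow>\<^sub>E {1..}) \<times> UNIV)"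
    by (rule summable_on_subset) (intro Sigma_mono PiE_mono, auto)
  have bd: "norm (rem_term e \<eta> m M x u) \<le> B x" if x: "x \<in> ({1..m} \<rightarrow>\<^sub>E {1..}) \<times> UNIV" and u: "u \<in> V \<inter> half_box (Suc m) T" for x u
  proof -
    obtain a k where ak: "x = (a, k)" by (cases x)
    have a: "a i \<ge> 1" if "i \<in> {1..m}" for i using x that by (auto simp: ak PiE_iff)
    have uY: "norm (u j) \<le> Y" if "j \<in> {1..Suc m}" for j
      using u that by (auto simp: V_def less_imp_le)
    have uT: "- Re (u j) \<le> real T" if "j \<in> {1..Suc m}" for j
    proof -
      have "- real T < Re (u j)" using u that unfolding half_box_def by blast
      then show ?thesis by linarith
    qed
    have cm: "c \<le> Re (\<eta> i)" "norm (\<eta> i) \<le> H" if "i \<in> {1..m}" for i using c(3)[of i] c(4)[of i] that by auto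
    have "norm (\<Prod>j\<in>{1..m}. lin_form \<eta> e a j powr (- u j)) \<le> P * (\<Prod>j\<in>{1..m}. lin_size e a j powr (- Re (u j)))"
      unfolding P_def by (rule prod_powr_bound[OF c(1,2) cm a]) (use uY in auto)
    also have "\<dots> \<le> P * (\<Prod>j\<in>{1..m}. lin_size e a j powr real T)"
      by (intro mult_left_mono P0 prod_mono conjI powr_mono lin_size_ge_1) (use uT in auto)
    finally have 1: "norm (\<Prod>j\<in>{1..m}. lin_form \<eta> e a j powr (- u j)) \<le> P * (\<Prod>j\<in>{1..m}. lin_size e a j powr real T)" .
    have mm: "m \<in> {1..m}" using m by simp
    have Re0: "Re (u (Suc m)) + M / d \<ge> 0"
    proof -
      have "real T \<le> real T * Suc m" by (simp add: mult_le_cancel_left1)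
      then show ?thesis unfolding Me using uT[of "Suc m"] by simp
    qed
    have "norm (em_rem d (\<eta> (Suc m)) M (u (Suc m)) (lin_form \<eta> e a m) k) \<le>
       K * (lin_size e a m + real k ^ d) powr (- Re (u (Suc m)) - M / d)"
      by (rule K(2)[OF uY lin_size_ge_1 lin_form_bounds[OF c(1) cm a mm] Re0]) simp
    also have "\<dots> \<le> K * (lin_size e a m + real k ^ d) powr (real T - M / d)"
    proof (intro mult_left_mono K(1) powr_mono)
      show "1 \<le> lin_size e a m + real k ^ d" using lin_size_ge_1[of e a m] by (simp add: add_increasing2)
    qed (use uT[of "Suc m"] in simp)
    finally have 2: "norm (em_rem d (\<eta> (Suc m)) M (u (Suc m)) (lin_form \<eta> e a m) k) \<le>
       K * (lin_size e a m + real k ^ d) powr (real T - M / d)" .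
    have "norm (rem_term e \<eta> m M x u) \<le> (P * (\<Prod>j\<in>{1..m}. lin_size e a j powr real T)) *
       (K * (lin_size e a m + real k ^ d) powr (real T - M / d))"
      unfolding rem_term_def norm_mult ak fst_conv snd_conv d_def[symmetric]
      by (rule mult_mono[OF 1 2]) (auto intro!: mult_nonneg_nonneg P0 prod_nonneg)
    then show ?thesis by (simp add: B_def ak mult_ac)
  qed
  show ?thesis
    by (intro exI[of _ V] exI[of _ B] conjI ballI oV sV sB) (rule bd)
qed

lemma rem_term_summable:
  assumes e: "\<And>i. i \<in> {1..Suc m} \<Longrightarrow> e i \<ge> 1" and \<eta>: "\<And>i. i \<in> {1..Suc m} \<Longrightarrow> Re (\<eta> i) > 0"
    and m: "m \<ge> 1" and M: "M = rem_order e m T" and s: "s \<in> half_box (Suc m) T"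
  shows "(\<lambda>x. rem_term e \<eta> m M x s) summable_on (({1..m} \<rightarrow>\<^sub>E {1..}) \<times> UNIV)"
proof -
  from rem_term_bound[of m e \<eta> M T s, OF e \<eta> m M] obtain V B where
    B: "s \<in> V" "B summable_on (({1..m} \<rightarrow>\<^sub>E {1..}) \<times> UNIV)"
      "\<forall>x\<in>({1..m} \<rightarrow>\<^sub>E {1..}) \<times> UNIV. \<forall>u\<in>V \<inter> half_box (Suc m) T. norm (rem_term e \<eta> m M x u) \<le> B x"
    by blast
  have "(\<lambda>x. norm (rem_term e \<eta> m M x s)) summable_on (({1..m} \<rightarrow>\<^sub>E {1..}) \<times> UNIV)"
    by (rule summable_on_comparison_test[OF B(2)]) (use B(1,3) s in auto)
  then show ?thesis by (rule abs_summable_summable)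
qed

lemma mhol_zeta_rem:
  assumes e: "\<And>i. i \<in> {1..Suc m} \<Longrightarrow> e i \<ge> 1" and \<eta>: "\<And>i. i \<in> {1..Suc m} \<Longrightarrow> Re (\<eta> i) > 0"
    and m: "m \<ge> 1" and M: "M = rem_order e m T"
  shows "mhol (Suc m) (zeta_rem e \<eta> m M) (half_box (Suc m) T)"
proof -
  have d: "e (Suc m) \<ge> 1" using e[of "Suc m"] by simp
  have \<gamma>: "Re (\<eta> (Suc m)) > 0" using \<eta>[of "Suc m"] by simp
  have "mhol (Suc m) (\<lambda>s. \<Sum>\<^sub>\<infinity>x\<in>({1..m} \<rightarrow>\<^sub>E {1..}) \<times> UNIV. rem_term e \<eta> m M x s) (half_box (Suc m) T)"
  proof (rule mhol_infsum[OF open_half_box])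
    fix x :: "(nat \<Rightarrow> nat) \<times> nat" assume x: "x \<in> ({1..m} \<rightarrow>\<^sub>E {1..}) \<times> UNIV"
    have a: "fst x i \<ge> 1" if "i \<in> {1..m}" for i using x that by (auto simp: PiE_iff)
    have \<eta>m: "Re (\<eta> i) > 0" if "i \<in> {1..m}" for i using \<eta>[of i] that by simp
    have pos: "Re (lin_form \<eta> e (fst x) j) > 0" if "j \<in> {1..m}" for j
      by (rule lin_form_nz[OF \<eta>m a that])
    have nz: "lin_form \<eta> e (fst x) j \<noteq> 0" if "j \<in> {1..m}" for j using pos[OF that] by auto
    have 1: "mhol (Suc m) (\<lambda>s. lin_form \<eta> e (fst x) j powr (- s j)) (half_box (Suc m) T)" if j: "j \<in> {1..m}" for j
    proof (rule mhol_compose[where U = UNIV and g = "\<lambda>z. lin_form \<eta> e (fst x) j powr (- z)"])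
      show "mhol (Suc m) (\<lambda>s. s j) (half_box (Suc m) T)" using j by (intro mhol_coord open_half_box) auto
      have "(\<lambda>z. lin_form \<eta> e (fst x) j powr (- z)) = (\<lambda>z. exp (- z * Ln (lin_form \<eta> e (fst x) j)))"
        using nz[OF j] by (simp add: powr_def)
      then show "(\<lambda>z. lin_form \<eta> e (fst x) j powr (- z)) holomorphic_on UNIV"
        by (simp add: holomorphic_intros)
    qed auto
    have mm: "m \<in> {1..m}" using m by simp
    have 2: "mhol (Suc m) (\<lambda>s. em_rem (e (Suc m)) (\<eta> (Suc m)) M (s (Suc m)) (lin_form \<eta> e (fst x) m) (snd x)) (half_box (Suc m) T)"
    proof (rule mhol_compose[where U = UNIV and g = "\<lambda>w. em_rem (e (Suc m)) (\<eta> (Suc m)) M w (lin_form \<eta> e (fst x) m) (snd x)"])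
      show "mhol (Suc m) (\<lambda>s. s (Suc m)) (half_box (Suc m) T)" by (intro mhol_coord open_half_box) auto
      show "(\<lambda>w. em_rem (e (Suc m)) (\<eta> (Suc m)) M w (lin_form \<eta> e (fst x) m) (snd x)) holomorphic_on UNIV"
        by (rule em_rem_holomorphic[OF d pos[OF mm] \<gamma>])
    qed auto
    show "mhol (Suc m) (rem_term e \<eta> m M x) (half_box (Suc m) T)"
      unfolding rem_term_def by (intro mhol_mult mhol_prod open_half_box 1 2)
  next
    fix s assume "s \<in> half_box (Suc m) T"
    show "\<exists>V B. open V \<and> s \<in> V \<and> B summable_on (({1..m} \<rightarrow>\<^sub>E {1..}) \<times> UNIV) \<and>
      (\<forall>x\<in>({1..m} \<rightarrow>\<^sub>E {1..}) \<times> UNIV. \<forall>u\<in>V \<inter> half_box (Suc m) T. norm (rem_term e \<eta> m M x u) \<le> B x)"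
      by (rule rem_term_bound[of m e \<eta> M T s, OF e \<eta> m M])
  qed
  then show ?thesis by (simp add: zeta_rem_def[abs_def])
qed

section \<open>Summation over the outer variables\<close>

lemma has_sum_merge_last:
  assumes e: "\<And>i. i \<in> {1..Suc m} \<Longrightarrow> e i \<ge> 1" and \<eta>: "\<And>i. i \<in> {1..Suc m} \<Longrightarrow> Re (\<eta> i) > 0"
    and m: "m \<ge> 1" and s: "s \<in> conv_region (Suc m) e" and t: "Re t \<ge> - 1 / real (e (Suc m))"
  shows "((\<lambda>a. (\<Prod>j\<in>{1..m}. lin_form \<eta> e a j powr (- s j)) * lin_form \<eta> e a m powr (- s (Suc m) - t))
     has_sum multizeta_series m e \<eta> (merge_last m t s)) ({1..m} \<rightarrow>\<^sub>E {1..})"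
proof -
  have "(\<lambda>a. \<Prod>j\<in>{1..m}. lin_form \<eta> e a j powr (- merge_last m t s j)) summable_on ({1..m} \<rightarrow>\<^sub>E {1..})"
    by (rule abs_summable_summable, rule multizeta_abs_summable)
       (use e \<eta> conv_region_merge_last[OF s t] in auto)
  then have "((\<lambda>a. \<Prod>j\<in>{1..m}. lin_form \<eta> e a j powr (- merge_last m t s j)) has_sum
     multizeta_series m e \<eta> (merge_last m t s)) ({1..m} \<rightarrow>\<^sub>E {1..})"
    unfolding multizeta_series_alt by (rule has_sum_infsum)
  moreover have "(\<Prod>j\<in>{1..m}. lin_form \<eta> e a j powr (- merge_last m t s j)) =
     (\<Prod>j\<in>{1..m}. lin_form \<eta> e a j powr (- s j)) * lin_form \<eta> e a m powr (- s (Suc m) - t)" for a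
  proof -
    obtain k where k: "m = Suc k" using m by (cases m) auto
    have "(\<Prod>j\<in>{1..m}. lin_form \<eta> e a j powr (- merge_last m t s j)) =
       (\<Prod>j\<in>{1..m - 1}. lin_form \<eta> e a j powr (- s j)) * lin_form \<eta> e a m powr (- (s m + s (Suc m) + t))"
      unfolding merge_last_def by (rule prod_upd_last[OF m, of "\<lambda>j z. lin_form \<eta> e a j powr (- z)"])
    also have "- (s m + s (Suc m) + t) = - s m + (- s (Suc m) - t)" by simp
    finally show ?thesis unfolding powr_add by (simp add: k)
  qed
  ultimately show ?thesis by (simp only:)
qed

lemma has_sum_diff_complex:
  fixes f g :: "'a \<Rightarrow> complex"
  assumes "(f has_sum a) A" "(g has_sum b) A"
  shows "((\<lambda>x. f x - g x) has_sum (a - b)) A"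
  using has_sum_add[OF assms(1) has_sum_cmult_right[OF assms(2), of "-1"]] by simp

lemma has_sum_sum_complex:
  fixes f :: "'i \<Rightarrow> 'a \<Rightarrow> complex"
  assumes "finite I" "\<And>i. i \<in> I \<Longrightarrow> (f i has_sum s i) A"
  shows "((\<lambda>x. \<Sum>i\<in>I. f i x) has_sum (\<Sum>i\<in>I. s i)) A"
  using assms
proof (induction I rule: finite_induct)
  case (insert i I)
  have "((\<lambda>x. f i x + (\<Sum>i\<in>I. f i x)) has_sum (s i + (\<Sum>i\<in>I. s i))) A"
    by (rule has_sum_add) (use insert in auto)
  then show ?case using insert.hyps by simp
qed simp

text \<open>Absolute convergence permits summing over the last variable first, where
  \<open>euler_maclaurin\<close> applies with the outer form as \<open>A\<close>. Every term of the
  expansion is summable on its own in this region, so it can be summed term by term.\<close>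

lemma multizeta_series_Suc:
  fixes T :: nat
  assumes e: "\<And>i. i \<in> {1..Suc m} \<Longrightarrow> e i \<ge> 1" and \<eta>: "\<And>i. i \<in> {1..Suc m} \<Longrightarrow> Re (\<eta> i) > 0"
    and m: "m \<ge> 1" and M: "M = rem_order e m T" and s: "s \<in> conv_region (Suc m) e" "s \<in> half_box (Suc m) T"
    and d_def: "d = e (Suc m)"
    and Z_def: "Z = (\<lambda>t. multizeta_series m e \<eta> (merge_last m t s))"
  shows "multizeta_series (Suc m) e \<eta> s =
    em_int d (\<eta> (Suc m)) (s (Suc m)) 1 * Z (- 1 / of_nat d) - Z 0 / 2 -
    (\<Sum>k\<in>{1..<M}. of_real (bernoulli_coeff (Suc k)) *
      (if d dvd k then \<eta> (Suc m) ^ (k div d) * (- s (Suc m) gchoose (k div d)) * fact k * Z (of_nat (k div d)) else 0)) -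
    (- 1) ^ M * zeta_rem e \<eta> m M s"
proof -
  define \<gamma> where "\<gamma> = \<eta> (Suc m)"
  define w where "w = s (Suc m)"
  define A where "A a = lin_form \<eta> e a m" for a
  define P where "P a = (\<Prod>j\<in>{1..m}. lin_form \<eta> e a j powr (- s j))" for a
  let ?X = "{1..m} \<rightarrow>\<^sub>E {1::nat..}"
  have d: "d \<ge> 1" using e[of "Suc m"] by (simp add: d_def)
  have \<gamma>: "Re \<gamma> > 0" using \<eta>[of "Suc m"] by (simp add: \<gamma>_def)
  have w: "Re w > 1 / d" using s(1) by (auto simp: conv_region_def w_def d_def dest!: bspec[of _ _ "Suc m"])
  have M1: "M \<ge> 1" using d by (simp add: M rem_order_def d_def)
  have wM: "Re w + M / d > 1 / d" using w by (smt (verit) divide_nonneg_nonneg of_nat_0_le_iff)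
  have mm: "m \<in> {1..m}" using m by simp
  have A: "Re (A a) > 0" if a: "a \<in> ?X" for a
    unfolding A_def by (rule lin_form_nz[OF _ _ mm]) (use \<eta> a in \<open>auto simp: PiE_iff\<close>)
  have Zs: "((\<lambda>a. P a * A a powr (- w - t)) has_sum Z t) ?X" if "Re t \<ge> - 1 / real d" for t
    unfolding P_def A_def w_def Z_def
    using has_sum_merge_last[of m e \<eta>, OF e \<eta> m s(1)] that by (simp add: d_def)
  define F where "F = (\<lambda>x. P (fst x) * (A (fst x) + \<gamma> * of_nat (snd x) ^ d) powr (- w))"
  have Fx: "F x = (\<Prod>j\<in>{1..Suc m}. lin_form \<eta> e ((\<lambda>(a, k). a(Suc m := k)) x) j powr (- s j))" for x
  proof -
    have "(\<Prod>j\<in>{1..m}. lin_form \<eta> e ((fst x)(Suc m := snd x)) j powr (- s j)) = P (fst x)"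
      unfolding P_def by (rule prod.cong) (auto simp: lin_form_upd)
    then show ?thesis
      by (simp add: F_def case_prod_unfold lin_form_Suc A_def \<gamma>_def w_def d_def)
  qed
  have "(\<lambda>a. \<Prod>j\<in>{1..Suc m}. lin_form \<eta> e a j powr (- s j)) summable_on ({1..Suc m} \<rightarrow>\<^sub>E {1..})"
    by (rule abs_summable_summable, rule multizeta_abs_summable[of "Suc m" e \<eta>, OF e \<eta> s(1)])
  then have "((\<lambda>a. \<Prod>j\<in>{1..Suc m}. lin_form \<eta> e a j powr (- s j)) has_sum multizeta_series (Suc m) e \<eta> s) ({1..Suc m} \<rightarrow>\<^sub>E {1..})"
    unfolding multizeta_series_alt by (rule has_sum_infsum)
  then have "((\<lambda>x. \<Prod>j\<in>{1..Suc m}. lin_form \<eta> e ((\<lambda>(a, k). a(Suc m := k)) x) j powr (- s j)) has_sum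
      multizeta_series (Suc m) e \<eta> s) (?X \<times> {1..})"
    by (rule iffD2[OF has_sum_reindex_bij_betw[OF bij_betw_PiE_Suc]])
  then have F: "(F has_sum multizeta_series (Suc m) e \<eta> s) (?X \<times> {1..})"
    unfolding Fx[symmetric] .
  define V where "V a = em_int d \<gamma> w (A a) - A a powr (- w) / 2 -
      (\<Sum>k\<in>{1..<M}. of_real (bernoulli_coeff (Suc k)) * em_fun d \<gamma> w (A a) k 0) -
     (- 1) ^ M * (\<Sum>\<^sub>\<infinity>k. em_rem d \<gamma> M w (A a) k)" for a
  have "((\<lambda>a. P a * V a) has_sum multizeta_series (Suc m) e \<eta> s) ?X"
  proof (rule has_sum_SigmaD[OF F])
    fix a assume a: "a \<in> ?X"
    show "((\<lambda>k. F (a, k)) has_sum P a * V a) {1..}"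
      unfolding F_def fst_conv snd_conv V_def
      by (intro has_sum_cmult_right euler_maclaurin[OF d A[OF a] \<gamma> M1 w])
  qed
  moreover
  have R: "((\<lambda>a. P a * (\<Sum>\<^sub>\<infinity>k. em_rem d \<gamma> M w (A a) k)) has_sum zeta_rem e \<eta> m M s) ?X"
  proof (rule has_sum_SigmaD)
    show "((\<lambda>x. rem_term e \<eta> m M x s) has_sum zeta_rem e \<eta> m M s) (?X \<times> UNIV)"
      unfolding zeta_rem_def by (rule has_sum_infsum[OF rem_term_summable[of m e \<eta>, OF e \<eta> m M s(2)]])
    fix a assume a: "a \<in> ?X"
    show "((\<lambda>k. rem_term e \<eta> m M (a, k) s) has_sum P a * (\<Sum>\<^sub>\<infinity>k. em_rem d \<gamma> M w (A a) k)) UNIV"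
      unfolding rem_term_def fst_conv snd_conv P_def[symmetric] A_def[symmetric] d_def[symmetric] \<gamma>_def[symmetric] w_def[symmetric]
      by (intro has_sum_cmult_right has_sum_infsum em_rem_summable d A[OF a] \<gamma> wM)
  qed
  \<comment> \<open>The same summand as \<open>P a * V a\<close>, regrouped so that each term is a
    constant times a summand of some translate of the series in \<open>m\<close> variables.\<close>
  define U where "U a = em_int d \<gamma> w 1 * (P a * A a powr (- w - - 1 / of_nat d)) - 1 / 2 * (P a * A a powr (- w - 0)) -
      (\<Sum>k\<in>{1..<M}. of_real (bernoulli_coeff (Suc k)) * (if d dvd k then \<gamma> ^ (k div d) * (- w gchoose (k div d)) * fact k else 0) *
        (P a * A a powr (- w - of_nat (k div d)))) -
     (- 1) ^ M * (P a * (\<Sum>\<^sub>\<infinity>k. em_rem d \<gamma> M w (A a) k))" for a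
  have "(U has_sum (em_int d \<gamma> w 1 * Z (- 1 / of_nat d) - 1 / 2 * Z 0 -
      (\<Sum>k\<in>{1..<M}. of_real (bernoulli_coeff (Suc k)) * (if d dvd k then \<gamma> ^ (k div d) * (- w gchoose (k div d)) * fact k else 0) *
        Z (of_nat (k div d))) -
     (- 1) ^ M * zeta_rem e \<eta> m M s)) ?X"
    unfolding U_def
  proof (intro has_sum_diff_complex has_sum_cmult_right has_sum_sum_complex R)
    have "Re (- 1 / of_nat d) = - 1 / real d"
      by (metis Re_complex_of_real of_real_1 of_real_divide of_real_minus of_real_of_nat_eq)
    then show "((\<lambda>a. P a * A a powr (- w - - 1 / of_nat d)) has_sum Z (- 1 / of_nat d)) ?X"
      by (intro Zs) simp
  next
    show "((\<lambda>a. P a * A a powr (- w - 0)) has_sum Z 0) ?X" by (rule Zs) simp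
    show "((\<lambda>a. P a * A a powr (- w - of_nat (k div d))) has_sum Z (of_nat (k div d))) ?X" for k
      by (rule Zs) (simp add: order_trans[of _ 0])
  qed simp
  moreover have "P a * V a = U a" if a: "a \<in> ?X" for a
  proof -
    \<comment> \<open>The scaling law is what makes the main term a pure power of
      \<open>A a\<close>, hence again a series of the same kind, with
      \<open>t = - 1/d\<close>.\<close>
    have sc: "em_int d \<gamma> w (A a) = em_int d \<gamma> w 1 * A a powr (- w - - 1 / of_nat d)"
    proof -
      have "1 / of_nat d - w = - w - - 1 / of_nat d" by simp
      then show ?thesis using em_int_scaling[OF d A[OF a] \<gamma> w] by (simp only:)
    qed
    have "(\<Sum>k\<in>{1..<M}. P a * (of_real (bernoulli_coeff (Suc k)) * em_fun d \<gamma> w (A a) k 0)) =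
      (\<Sum>k\<in>{1..<M}. of_real (bernoulli_coeff (Suc k)) * (if d dvd k then \<gamma> ^ (k div d) * (- w gchoose (k div d)) * fact k else 0) *
        (P a * A a powr (- w - of_nat (k div d))))"
      unfolding em_fun_at_0[OF d] by (rule sum.cong) (simp_all add: mult_ac)
    then show ?thesis unfolding V_def U_def sc by (simp add: right_diff_distrib sum_distrib_left mult_ac)
  qed
  ultimately have "(U has_sum multizeta_series (Suc m) e \<eta> s) ?X"
    using has_sum_cong[of ?X "\<lambda>a. P a * V a" U] by simp
  then have "multizeta_series (Suc m) e \<eta> s = em_int d \<gamma> w 1 * Z (- 1 / of_nat d) - 1 / 2 * Z 0 -
      (\<Sum>k\<in>{1..<M}. of_real (bernoulli_coeff (Suc k)) * (if d dvd k then \<gamma> ^ (k div d) * (- w gchoose (k div d)) * fact k else 0) *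
        Z (of_nat (k div d))) -
     (- 1) ^ M * zeta_rem e \<eta> m M s"
    by (rule has_sum_unique) fact
  moreover have "(\<Sum>k\<in>{1..<M}. of_real (bernoulli_coeff (Suc k)) * (if d dvd k then \<gamma> ^ (k div d) * (- w gchoose (k div d)) * fact k else 0) *
        Z (of_nat (k div d))) = (\<Sum>k\<in>{1..<M}. of_real (bernoulli_coeff (Suc k)) *
      (if d dvd k then \<gamma> ^ (k div d) * (- w gchoose (k div d)) * fact k * Z (of_nat (k div d)) else 0))"
    by (rule sum.cong) auto
  ultimately show ?thesis unfolding \<gamma>_def w_def by simp
qed

text \<open>The Euler-Maclaurin expansion in the last summation variable, multiplied by the polar factor of
  \<open>m + 1\<close> variables. Here \<open>E\<close> is the entire completion of the function of \<open>m\<close> variables, and \<open>q l\<close>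
  is the quotient of the polar factor by its shift by \<open>l\<close> in the last variable.\<close>

definition zeta_step :: "(nat \<Rightarrow> nat) \<Rightarrow> (nat \<Rightarrow> complex) \<Rightarrow> nat \<Rightarrow> ((nat \<Rightarrow> complex) \<Rightarrow> complex) \<Rightarrow>
    (nat \<Rightarrow> (nat \<Rightarrow> complex) \<Rightarrow> complex) \<Rightarrow> nat \<Rightarrow> (nat \<Rightarrow> complex) \<Rightarrow> complex" where
  "zeta_step e \<eta> m E q T s = (let d = e (Suc m); \<gamma> = \<eta> (Suc m); w = s (Suc m); M = rem_order e m T; t = - 1 / of_nat d in
     em_main d \<gamma> (Suc T) w * (polar_factor e m (merge_last m 0 s) * E (merge_last m t s)) -
     1 / 2 * (rGamma (w - 1 / of_nat d) * polar_factor e m (merge_last m t s) * E (merge_last m 0 s)) -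
     (\<Sum>k\<in>{1..<M}. (of_real (bernoulli_coeff (Suc k)) * (if d dvd k then \<gamma> ^ (k div d) * fact k else 0)) * ((- w gchoose (k div d)) *
        (rGamma (w - 1 / of_nat d) * polar_factor e m (merge_last m t s) *
          (q (k div d) (merge_last m 0 s) * E (merge_last m (of_nat (k div d)) s))))) -
     (- 1) ^ M * (polar_factor e (Suc m) s * zeta_rem e \<eta> m M s))"

lemma merge_last_add: "(merge_last m 0 s)(m := merge_last m 0 s m + of_nat l) = merge_last m (of_nat l) s"
  by (simp add: merge_last_def)

lemma mhol_coord_compose:
  assumes "g holomorphic_on U" "open U" "i \<in> {1..m}" "open \<Omega>" "\<And>s. s \<in> \<Omega> \<Longrightarrow> s i \<in> U"
  shows "mhol m (\<lambda>s. g (s i)) \<Omega>"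
  by (rule mhol_compose[where F = "\<lambda>s. s i" and g = g and U = U])
     (use assms mhol_coord[OF assms(4,3)] in auto)

lemma mhol_zeta_step:
  assumes e: "\<And>i. i \<in> {1..Suc m} \<Longrightarrow> e i \<ge> 1" and \<eta>: "\<And>i. i \<in> {1..Suc m} \<Longrightarrow> Re (\<eta> i) > 0"
    and m: "m \<ge> 1" and E: "mhol m E UNIV" and q: "\<And>l. mhol m (q l) UNIV"
  shows "mhol (Suc m) (zeta_step e \<eta> m E q T) (half_box (Suc m) T)"
proof -
  let ?\<Omega> = "half_box (Suc m) T"
  have d: "e (Suc m) \<ge> 1" using e[of "Suc m"] by simp
  have \<gamma>: "Re (\<eta> (Suc m)) > 0" using \<eta>[of "Suc m"] by simp
  have o: "open ?\<Omega>" by (rule open_half_box)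
  have n: "Suc m \<in> {1..Suc m}" by simp
  have main: "mhol (Suc m) (\<lambda>s. em_main (e (Suc m)) (\<eta> (Suc m)) (Suc T) (s (Suc m))) ?\<Omega>"
    by (rule mhol_coord_compose[OF em_main_holomorphic[OF d \<gamma>] open_halfspace_Re_gt n o])
       (auto simp: half_box_def)
  have rg: "mhol (Suc m) (\<lambda>s. rGamma (s (Suc m) - 1 / of_nat (e (Suc m)))) ?\<Omega>"
    by (rule mhol_coord_compose[where g = "\<lambda>w. rGamma (w - 1 / of_nat (e (Suc m)))" and U = UNIV, OF _ open_UNIV n o])
       (auto intro!: holomorphic_intros)
  have gb: "mhol (Suc m) (\<lambda>s. - s (Suc m) gchoose l) ?\<Omega>" for l
    by (rule mhol_coord_compose[OF holomorphic_gbinomial open_UNIV n o]) simp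
  have ml: "mhol (Suc m) (\<lambda>s. F (merge_last m t s)) ?\<Omega>" if "mhol m F UNIV" for F t
    by (rule mhol_subset[OF mhol_merge_last[OF that] o]) simp
  have hS: "mhol (Suc m) (polar_factor e (Suc m)) ?\<Omega>" by (rule mhol_subset[OF mhol_polar_factor o]) simp
  have R: "mhol (Suc m) (zeta_rem e \<eta> m (rem_order e m T)) ?\<Omega>"
    by (rule mhol_zeta_rem[of m e \<eta> _ T, OF e \<eta> m refl])
  show ?thesis
    unfolding zeta_step_def[abs_def] Let_def
    by (intro mhol_diff mhol_cmult mhol_mult mhol_sum main rg gb ml[OF mhol_polar_factor] ml[OF E] ml[OF q] hS R o)
qed

text \<open>The polar factor is \<open>r * h 0 * h t\<close>. Each term of the expansion takes from
  it what turns its own series into a value of \<open>E\<close> (\<open>h t\<close> for the main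
  term, \<open>h 0\<close> for all other translates), the main term takes \<open>r\<close> into
  \<open>em_main\<close> as well, and the rest remains as a factor.\<close>

lemma zeta_step_region:
  assumes e: "\<And>i. i \<in> {1..Suc m} \<Longrightarrow> e i \<ge> 1" and \<eta>: "\<And>i. i \<in> {1..Suc m} \<Longrightarrow> Re (\<eta> i) > 0"
    and m: "m \<ge> 1" and E: "\<And>s. s \<in> conv_region m e \<Longrightarrow> E s = polar_factor e m s * multizeta_series m e \<eta> s"
    and q: "\<And>l s. polar_factor e m s = q l s * polar_factor e m (s(m := s m + of_nat l))"
    and s: "s \<in> half_box (Suc m) T \<inter> conv_region (Suc m) e"
  shows "zeta_step e \<eta> m E q T s = polar_factor e (Suc m) s * multizeta_series (Suc m) e \<eta> s"
proof -
  define d where "d = e (Suc m)"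
  define \<gamma> where "\<gamma> = \<eta> (Suc m)"
  define w where "w = s (Suc m)"
  define M where "M = rem_order e m T"
  define t where "t = - 1 / complex_of_nat d"
  define h where "h u = polar_factor e m (merge_last m u s)" for u
  define Z where "Z = (\<lambda>u. multizeta_series m e \<eta> (merge_last m u s))"
  define r where "r = rGamma (w - 1 / of_nat d)"
  have d: "d \<ge> 1" using e[of "Suc m"] by (simp add: d_def)
  have \<gamma>: "Re \<gamma> > 0" using \<eta>[of "Suc m"] by (simp add: \<gamma>_def)
  have s': "s \<in> conv_region (Suc m) e" "s \<in> half_box (Suc m) T" using s by auto
  have w: "Re w > 1 / d" using s'(1) by (auto simp: conv_region_def w_def d_def dest!: bspec[of _ _ "Suc m"])
  have Ret: "Re t = - 1 / real d"
    unfolding t_def by (metis Re_complex_of_real of_real_1 of_real_divide of_real_minus of_real_of_nat_eq)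
  have EZ: "E (merge_last m u s) = h u * Z u" if "Re u \<ge> - 1 / real d" for u
    unfolding h_def Z_def by (rule E[OF conv_region_merge_last[OF s'(1)]]) (use that in \<open>simp add: d_def\<close>)
  have E0: "E (merge_last m 0 s) = h 0 * Z 0" by (rule EZ) simp
  have Et: "E (merge_last m t s) = h t * Z t" by (rule EZ) (simp add: Ret)
  \<comment> \<open>\<open>E\<close> at the translate by \<open>l\<close> carries only
    \<open>h (of_nat l)\<close>; the factor \<open>q l\<close> completes it to
    \<open>h 0\<close>.\<close>
  have El: "q l (merge_last m 0 s) * E (merge_last m (of_nat l) s) = h 0 * Z (of_nat l)" for l
  proof -
    have "E (merge_last m (of_nat l) s) = h (of_nat l) * Z (of_nat l)"
      by (rule EZ) (simp add: order_trans[of _ 0])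
    moreover have "h 0 = q l (merge_last m 0 s) * h (of_nat l)"
      unfolding h_def using q[of "merge_last m 0 s" l] unfolding merge_last_add .
    ultimately show ?thesis by simp
  qed
  have hS: "polar_factor e (Suc m) s = r * (h 0 * h t)"
    unfolding polar_factor_Suc[OF m] by (simp add: r_def h_def t_def w_def d_def)
  have "zeta_step e \<eta> m E q T s =
     r * em_int d \<gamma> w 1 * (h 0 * (h t * Z t)) - 1 / 2 * (r * h t * (h 0 * Z 0)) -
     (\<Sum>k\<in>{1..<M}. (of_real (bernoulli_coeff (Suc k)) * (if d dvd k then \<gamma> ^ (k div d) * fact k else 0)) * ((- w gchoose (k div d)) *
        (r * h t * (h 0 * Z (of_nat (k div d)))))) -
     (- 1) ^ M * (r * (h 0 * h t) * zeta_rem e \<eta> m M s)"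
    unfolding zeta_step_def Let_def d_def[symmetric] \<gamma>_def[symmetric] w_def[symmetric] M_def[symmetric] t_def[symmetric]
      h_def[symmetric] r_def[symmetric] El E0 Et hS em_main_eq[OF d \<gamma> w] ..
  also have "\<dots> = r * (h 0 * h t) * (em_int d \<gamma> w 1 * Z t - Z 0 / 2 -
    (\<Sum>k\<in>{1..<M}. of_real (bernoulli_coeff (Suc k)) *
      (if d dvd k then \<gamma> ^ (k div d) * (- w gchoose (k div d)) * fact k * Z (of_nat (k div d)) else 0)) -
    (- 1) ^ M * zeta_rem e \<eta> m M s)"
  proof -
    have "(\<Sum>k\<in>{1..<M}. (of_real (bernoulli_coeff (Suc k)) * (if d dvd k then \<gamma> ^ (k div d) * fact k else 0)) * ((- w gchoose (k div d)) *
        (r * h t * (h 0 * Z (of_nat (k div d)))))) = r * (h 0 * h t) * (\<Sum>k\<in>{1..<M}. of_real (bernoulli_coeff (Suc k)) *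
      (if d dvd k then \<gamma> ^ (k div d) * (- w gchoose (k div d)) * fact k * Z (of_nat (k div d)) else 0))"
      unfolding sum_distrib_left by (rule sum.cong) (simp_all add: mult_ac)
    then show ?thesis by (simp add: algebra_simps)
  qed
  also have "\<dots> = polar_factor e (Suc m) s * multizeta_series (Suc m) e \<eta> s"
    by (simp only: hS multizeta_series_Suc[of m e \<eta> M T s d Z, OF e \<eta> m M_def s' d_def Z_def, folded \<gamma>_def w_def t_def])
  finally show ?thesis .
qed

text \<open>The third conclusion keeps the expansion available at every point, not only in the
  region of convergence; the values at integers are read off from it.\<close>

lemma multizeta_entire_Suc:
  assumes e: "\<And>i. i \<in> {1..Suc m} \<Longrightarrow> e i \<ge> 1" and \<eta>: "\<And>i. i \<in> {1..Suc m} \<Longrightarrow> Re (\<eta> i) > 0"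
    and m: "m \<ge> 1" and E: "mhol m E UNIV" "\<And>s. s \<in> conv_region m e \<Longrightarrow> E s = polar_factor e m s * multizeta_series m e \<eta> s"
    and q: "\<And>l. mhol m (q l) UNIV" "\<And>l s. polar_factor e m s = q l s * polar_factor e m (s(m := s m + of_nat l))"
  shows "\<exists>E'. mhol (Suc m) E' UNIV \<and>
    (\<forall>s\<in>conv_region (Suc m) e. E' s = polar_factor e (Suc m) s * multizeta_series (Suc m) e \<eta> s) \<and>
    (\<forall>T. \<forall>s\<in>half_box (Suc m) T. E' s = zeta_step e \<eta> m E q T s)"
proof -
  have st: "mhol (Suc m) (zeta_step e \<eta> m E q T) (half_box (Suc m) T)" for T
    by (rule mhol_zeta_step[of m e \<eta>, OF e \<eta> m E(1) q(1)])
  have reg: "zeta_step e \<eta> m E q T s = polar_factor e (Suc m) s * multizeta_series (Suc m) e \<eta> s"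
    if "s \<in> half_box (Suc m) T \<inter> conv_region (Suc m) e" for T s
    by (rule zeta_step_region[of m e \<eta>, OF e \<eta> m E(2) q(2) that])
  obtain E' where E': "mhol (Suc m) E' UNIV"
    "\<And>s. s \<in> conv_region (Suc m) e \<Longrightarrow> E' s = polar_factor e (Suc m) s * multizeta_series (Suc m) e \<eta> s"
    "\<And>T F s. mhol (Suc m) F (half_box (Suc m) T) \<Longrightarrow>
       (\<And>s. s \<in> half_box (Suc m) T \<inter> conv_region (Suc m) e \<Longrightarrow> F s = polar_factor e (Suc m) s * multizeta_series (Suc m) e \<eta> s) \<Longrightarrow>
       s \<in> half_box (Suc m) T \<Longrightarrow> F s = E' s"
    by (rule mhol_glue[of "Suc m" e "\<lambda>s. polar_factor e (Suc m) s * multizeta_series (Suc m) e \<eta> s"])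
       (use st reg in blast)+
  show ?thesis
    by (intro exI[of _ E'] conjI ballI allI E'(1,2)) (assumption | rule E'(3)[OF st reg, symmetric])+
qed

subsection \<open>One variable\<close>

lemma has_sum_zeta:
  fixes w :: complex
  assumes w: "Re w > 1" and M: "M \<ge> 1"
  shows "((\<lambda>k. of_nat k powr (- w)) has_sum (1 + (1 / (w - 1) - 1 / 2 -
     (\<Sum>k\<in>{1..<M}. of_real (bernoulli_coeff (Suc k)) * em_fun 1 1 w 1 k 0) - (- 1) ^ M * (\<Sum>\<^sub>\<infinity>m. em_rem 1 1 M w 1 m)))) {1..}"
proof -
  let ?X = "1 / (w - 1) - 1 / 2 -
     (\<Sum>k\<in>{1..<M}. of_real (bernoulli_coeff (Suc k)) * em_fun 1 1 w 1 k 0) - (- 1) ^ M * (\<Sum>\<^sub>\<infinity>m. em_rem 1 1 M w 1 m)"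
  have "((\<lambda>k. (1 + 1 * of_nat k ^ 1) powr (- w)) has_sum
     (em_int 1 1 w 1 - 1 powr (- w) / 2 - (\<Sum>k\<in>{1..<M}. of_real (bernoulli_coeff (Suc k)) * em_fun 1 1 w 1 k 0) -
     (- 1) ^ M * (\<Sum>\<^sub>\<infinity>m. em_rem 1 1 M w 1 m))) {1..}"
    by (rule euler_maclaurin[OF _ _ _ M]) (use w in simp_all)
  then have "((\<lambda>k. of_nat (Suc k) powr (- w)) has_sum ?X) {1..}"
    using em_int_riemann[OF w] by simp
  moreover have "bij_betw Suc {1..} {2..}"
    by (rule bij_betwI[where g = "\<lambda>n. n - 1"]) auto
  ultimately have "((\<lambda>k. of_nat k powr (- w)) has_sum ?X) {2..}"
    using has_sum_reindex_bij_betw[of Suc "{1..}" "{2..}" "\<lambda>k. of_nat k powr (- w)" ?X] by simp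
  then have "((\<lambda>k. of_nat k powr (- w)) has_sum (of_nat 1 powr (- w) + ?X)) (insert 1 {2..})"
    by (intro has_sum_insert) auto
  moreover have "insert 1 {2..} = {1::nat..}" by auto
  ultimately show ?thesis by simp
qed

text \<open>The principal logarithm of a product splits because the factor \<open>k^d\<close> is
  real and positive.\<close>

lemma powr_monomial:
  assumes \<gamma>: "Re \<gamma> > 0" and k: "k \<ge> 1"
  shows "(\<gamma> * of_nat k ^ d) powr (- z) = \<gamma> powr (- z) * of_nat k powr (- (of_nat d * z))"
proof -
  have \<gamma>0: "\<gamma> \<noteq> 0" using \<gamma> by auto
  have k0: "of_nat k \<noteq> (0::complex)" "real k > 0" using k by auto
  have "Ln (\<gamma> * of_nat k ^ d) = Ln (of_real (real k ^ d) * \<gamma>)" by (simp add: mult.commute)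
  also have "\<dots> = of_real (ln (real k ^ d)) + Ln \<gamma>"
    using Ln_times_of_real[of "real k ^ d" \<gamma>] Ln_of_real[of "real k ^ d"] k0 \<gamma>0 by (simp del: of_real_power)
  also have "of_real (ln (real k ^ d)) = of_nat d * Ln (of_nat k)"
    using k0 Ln_of_real[of "real k"] by (simp add: ln_realpow)
  finally show ?thesis
    using \<gamma>0 k0 by (simp add: powr_def algebra_simps flip: exp_add)
qed

lemma multizeta_series_1:
  assumes "Re (\<eta> 1) > 0"
  shows "multizeta_series 1 e \<eta> s =
    \<eta> 1 powr (- s 1) * (\<Sum>\<^sub>\<infinity>k\<in>{1..}. of_nat k powr (- (of_nat (e 1) * s 1)))"
proof -
  have bij: "bij_betw (\<lambda>k i. if i = 1 then k else undefined) {1::nat..} ({1::nat..1} \<rightarrow>\<^sub>E {1..})"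
    by (rule bij_betwI[where g = "\<lambda>a. a 1"]) (auto simp: PiE_iff extensional_def fun_eq_iff)
  have "multizeta_series 1 e \<eta> s = (\<Sum>\<^sub>\<infinity>a\<in>{1..1::nat} \<rightarrow>\<^sub>E {1..}. (\<eta> 1 * of_nat (a 1) ^ e 1) powr (- s 1))"
    unfolding multizeta_series_def by (intro infsum_cong) simp
  also have "\<dots> = (\<Sum>\<^sub>\<infinity>k\<in>{1..}. (\<eta> 1 * of_nat k ^ e 1) powr (- s 1))"
    by (subst infsum_reindex_bij_betw[OF bij, symmetric]) simp
  also have "\<dots> = (\<Sum>\<^sub>\<infinity>k\<in>{1..}. \<eta> 1 powr (- s 1) * of_nat k powr (- (of_nat (e 1) * s 1)))"
    by (intro infsum_cong powr_monomial assms) auto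
  also have "\<dots> = \<eta> 1 powr (- s 1) * (\<Sum>\<^sub>\<infinity>k\<in>{1..}. of_nat k powr (- (of_nat (e 1) * s 1)))"
    by (rule infsum_cmult_right')
  finally show ?thesis .
qed

text \<open>Up to the entire factor \<open>\<gamma> powr (- z)\<close> the series is the Riemann
  zeta function at \<open>d z\<close>, whose pole at \<open>z = 1/d\<close> is cancelled by
  \<open>rGamma (z - 1/d)\<close>.\<close>

lemma multizeta_entire_1:
  assumes e: "e 1 \<ge> 1" and \<eta>: "Re (\<eta> 1) > 0"
  obtains E where "mhol 1 E UNIV" "\<And>s. s \<in> conv_region 1 e \<Longrightarrow> E s = polar_factor e 1 s * multizeta_series 1 e \<eta> s"
proof (rule mhol_glue[of 1 e "\<lambda>s. polar_factor e 1 s * multizeta_series 1 e \<eta> s"])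
  fix T :: nat
  define d where "d = e 1"
  define \<gamma> where "\<gamma> = \<eta> 1"
  have d: "d \<ge> 1" using e by (simp add: d_def)
  have \<gamma>: "Re \<gamma> > 0" using \<eta> by (simp add: \<gamma>_def)
  \<comment> \<open>For \<open>Re z > -T\<close> one has \<open>Re (d z) > - d T\<close>, and the
    remainder sum is holomorphic for \<open>Re w > 1 - M = - d T - 1\<close>.\<close>
  define M where "M = d * T + 2"
  have M1: "M \<ge> 1" by (simp add: M_def)
  define R where "R w = (\<Sum>\<^sub>\<infinity>m. em_rem 1 1 M w 1 m)" for w
  \<comment> \<open>The pole is removed by hand: with \<open>w = d z\<close> one has
    \<open>w - 1 = d (z - 1/d)\<close>, so \<open>rGamma (z - 1/d) / (w - 1)\<close> equals
    \<open>rGamma (z - 1/d + 1) / d\<close>, which is entire. The constant \<open>1/2\<close> is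
    \<open>1 - 1/2\<close>.\<close>
  define g where "g z = \<gamma> powr (- z) * (rGamma (z - 1 / of_nat d) * (1 / 2 -
     (\<Sum>k\<in>{1..<M}. of_real (bernoulli_coeff (Suc k)) * em_fun 1 1 (of_nat d * z) 1 k 0) - (- 1) ^ M * R (of_nat d * z)) +
     1 / of_nat d * rGamma (z - 1 / of_nat d + 1))" for z
  have "g holomorphic_on {z. Re z > - real T}"
  proof -
    have 1: "(\<lambda>z. \<gamma> powr (- z)) holomorphic_on {z. Re z > - real T}"
    proof -
      have "\<gamma> \<noteq> 0" using \<gamma> by auto
      then have "(\<lambda>z. \<gamma> powr (- z)) = (\<lambda>z. exp (- z * Ln \<gamma>))" by (simp add: powr_def)
      then show ?thesis by (simp add: holomorphic_intros)
    qed
    have 2: "(\<lambda>z. em_fun 1 1 (of_nat d * z) 1 k 0) holomorphic_on {z. Re z > - real T}" for k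
    proof -
      have "(\<lambda>z. em_fun 1 1 (of_nat d * z) 1 k 0) = (\<lambda>z. (- (of_nat d * z) gchoose k) * fact k)"
        by (subst em_fun_at_0) (auto simp: fun_eq_iff)
      moreover have "(\<lambda>z. (- (of_nat d * z) :: complex) gchoose k) holomorphic_on {z. Re z > - real T}"
        by (rule holomorphic_on_compose_gen[of "\<lambda>z. of_nat d * z" _ "\<lambda>w. - w gchoose k" UNIV, unfolded o_def])
           (auto intro!: holomorphic_intros holomorphic_gbinomial)
      ultimately show ?thesis by (simp add: holomorphic_intros)
    qed
    have 3: "(\<lambda>z. R (of_nat d * z)) holomorphic_on {z. Re z > - real T}"
    proof (rule holomorphic_on_compose_gen[of "\<lambda>z. of_nat d * z" _ R, unfolded o_def])
      show "R holomorphic_on {w. Re w > 1 / real 1 - real M / real 1}"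
        unfolding R_def by (rule em_rem_sum_holomorphic) simp_all
      show "(\<lambda>z. of_nat d * z) ` {z. - real T < Re z} \<subseteq> {w. 1 / real 1 - real M / real 1 < Re w}"
      proof safe
        fix z assume "- real T < Re z"
        then have "real d * (- real T) \<le> real d * Re z" by (intro mult_left_mono) auto
        then show "1 / real 1 - real M / real 1 < Re (of_nat d * z)" by (simp add: M_def)
      qed
    qed (intro holomorphic_intros)
    show ?thesis unfolding g_def by (intro holomorphic_intros 1 2 3)
  qed
  then have "mhol 1 (\<lambda>s. g (s 1)) (half_box 1 T)"
    by (rule mhol_coord_compose[OF _ open_halfspace_Re_gt _ open_half_box]) (auto simp: half_box_def)
  moreover have "g (s 1) = polar_factor e 1 s * multizeta_series 1 e \<eta> s" if "s \<in> half_box 1 T \<inter> conv_region 1 e" for s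
  proof -
    define z where "z = s 1"
    have z: "Re z > 1 / d" using that by (simp add: conv_region_def z_def d_def)
    define w where "w = of_nat d * z"
    have w: "Re w > 1" using z d by (simp add: w_def field_simps)
    define u where "u = z - 1 / of_nat d"
    have wu: "w - 1 = of_nat d * u" using d by (simp add: w_def u_def field_simps)
    have u0: "u \<noteq> 0" using wu w by auto
    have h: "polar_factor e 1 s = rGamma u" by (simp add: u_def z_def d_def)
    define v where "v = 1 / (w - 1)"
    have vu: "1 / of_nat d * rGamma (u + 1) = rGamma u * v"
      unfolding v_def wu rGamma_plus1[of u, symmetric] using u0 d by (simp add: field_simps)
    have ser: "multizeta_series 1 e \<eta> s = \<gamma> powr (- z) * (1 + (v - 1 / 2 -
       (\<Sum>k\<in>{1..<M}. of_real (bernoulli_coeff (Suc k)) * em_fun 1 1 w 1 k 0) - (- 1) ^ M * R w))"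
      unfolding multizeta_series_1[where \<eta> = \<eta>, OF \<eta>] d_def[symmetric] \<gamma>_def[symmetric] z_def[symmetric] w_def[symmetric] R_def v_def
      by (subst infsumI[OF has_sum_zeta[OF w M1]]) simp
    have gs: "g (s 1) = \<gamma> powr (- z) * (rGamma u * (1 / 2 -
     (\<Sum>k\<in>{1..<M}. of_real (bernoulli_coeff (Suc k)) * em_fun 1 1 w 1 k 0) - (- 1) ^ M * R w) + 1 / of_nat d * rGamma (u + 1))"
      by (simp only: g_def z_def[symmetric] w_def[symmetric] u_def[symmetric])
    show ?thesis unfolding h gs ser vu by (simp add: algebra_simps)
  qed
  ultimately show "\<exists>E. mhol 1 E (half_box 1 T) \<and> (\<forall>s\<in>half_box 1 T \<inter> conv_region 1 e.
      E s = polar_factor e 1 s * multizeta_series 1 e \<eta> s)" by blast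
qed (rule that)

lemma polar_factor_shift_factor:
  assumes "m \<ge> 1"
  obtains q where "\<And>l. mhol m (q l) UNIV" "\<And>l s. polar_factor e m s = q l s * polar_factor e m (s(m := s m + of_nat l))"
proof -
  have "\<forall>l. \<exists>q. mhol m q UNIV \<and> (\<forall>s. polar_factor e m s = q s * polar_factor e m (s(m := s m + of_nat l)))"
    using polar_factor_shift[OF assms] by blast
  from choice[OF this] obtain q where
    "\<forall>l. mhol m (q l) UNIV \<and> (\<forall>s. polar_factor e m s = q l s * polar_factor e m (s(m := s m + of_nat l)))" by blast
  then show thesis by (intro that) auto
qed

lemma multizeta_entire:
  assumes "m \<ge> 1" "\<And>i. i \<in> {1..m} \<Longrightarrow> e i \<ge> 1" "\<And>i. i \<in> {1..m} \<Longrightarrow> Re (\<eta> i) > 0"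
  shows "\<exists>E. mhol m E UNIV \<and> (\<forall>s\<in>conv_region m e. E s = polar_factor e m s * multizeta_series m e \<eta> s)"
  using assms
proof (induction m rule: nat_induct_at_least)
  case base
  obtain E where "mhol 1 E UNIV" "\<And>s. s \<in> conv_region 1 e \<Longrightarrow> E s = polar_factor e 1 s * multizeta_series 1 e \<eta> s"
    by (rule multizeta_entire_1[of e \<eta>]) (use base in simp_all)
  then show ?case by blast
next
  case (Suc m)
  have "\<exists>E. mhol m E UNIV \<and> (\<forall>s\<in>conv_region m e. E s = polar_factor e m s * multizeta_series m e \<eta> s)"
    by (rule Suc.IH) (use Suc.prems in auto)
  then obtain E where E: "mhol m E UNIV" "\<And>s. s \<in> conv_region m e \<Longrightarrow> E s = polar_factor e m s * multizeta_series m e \<eta> s"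
    by blast
  obtain q where q: "\<And>l. mhol m (q l) UNIV" "\<And>l s. polar_factor e m s = q l s * polar_factor e m (s(m := s m + of_nat l))"
    by (rule polar_factor_shift_factor[OF Suc.hyps(1)]) blast
  have "\<exists>E'. mhol (Suc m) E' UNIV \<and>
    (\<forall>s\<in>conv_region (Suc m) e. E' s = polar_factor e (Suc m) s * multizeta_series (Suc m) e \<eta> s) \<and>
    (\<forall>T. \<forall>s\<in>half_box (Suc m) T. E' s = zeta_step e \<eta> m E q T s)"
    by (rule multizeta_entire_Suc[of m e \<eta> E q, OF Suc.prems Suc.hyps(1) E q])
  then show ?case
    by (elim exE conjE) (intro exI conjI, assumption+)
qed

subsection \<open>Values at integers\<close>

text \<open>At an integer point all tail sums are integers, so a zero would make
  \<open>1 / e j + \<dots>\<close> an integer; being nonnegative, it would be a natural number,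
  against the hypothesis.\<close>

lemma polar_factor_integer_nz:
  assumes s: "\<And>j. j \<in> {1..m} \<Longrightarrow> s j \<in> \<int>"
    and hyp: "\<And>j (\<epsilon> :: nat \<Rightarrow> nat). j \<in> {1..m} \<Longrightarrow> \<epsilon> \<in> {j+1..m} \<rightarrow> {0, 1} \<Longrightarrow>
           1 / real (e j) + (\<Sum>k\<in>{j+1..m}. real (\<epsilon> k) / real (e k)) \<notin> \<nat>"
  shows "polar_factor e m s \<noteq> 0"
proof
  assume "polar_factor e m s = 0"
  from polar_factor_eq_0[OF this] obtain j \<epsilon> i where j: "j \<in> {1..m}" and \<epsilon>: "\<epsilon> \<in> {j+1..m} \<rightarrow> {0, 1::nat}"
    and i: "(\<Sum>k\<in>{j..m}. s k) = of_real (1 / real (e j) + (\<Sum>k\<in>{j+1..m}. real (\<epsilon> k) / real (e k)) - real i)" by blast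
  define x where "x = 1 / real (e j) + (\<Sum>k\<in>{j+1..m}. real (\<epsilon> k) / real (e k))"
  have "(\<Sum>k\<in>{j..m}. s k) \<in> \<int>" using s j by (intro Ints_sum) auto
  then obtain z where "(\<Sum>k\<in>{j..m}. s k) = of_int z" by (auto elim: Ints_cases)
  then have "complex_of_real (x - real i) = of_real (of_int z)" using i by (simp add: x_def)
  then have x: "x = of_int (z + int i)" unfolding of_real_eq_iff by simp
  have "x \<ge> 0" unfolding x_def by (intro add_nonneg_nonneg sum_nonneg) auto
  then have "x = of_nat (nat (z + int i))" using x by simp
  then have "x \<in> \<nat>" by simp
  then show False using hyp[OF j \<epsilon>] by (simp add: x_def)
qed

lemma zeta_rem_eq_0:
  assumes "s (Suc m) = - of_nat P" "M > e (Suc m) * P"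
  shows "zeta_rem e \<eta> m M s = 0"
  unfolding zeta_rem_def rem_term_def assms(1) em_rem_def em_fun_eq_0[OF assms(2)] by simp

text \<open>\<open>zeta_step\<close> is evaluated at the point itself and divided by the polar
  factor. Nonvanishing of that product passes to its factors \<open>h 0\<close> and
  \<open>h t\<close>, and through \<open>h 0 = q l * h l\<close> to every translate by
  \<open>l\<close>, so all values on the right are regular as well.\<close>

lemma multizeta_at_integers:
  fixes d :: "nat \<Rightarrow> nat" and \<gamma> :: "nat \<Rightarrow> complex" and s :: "nat \<Rightarrow> complex"
  assumes m: "m \<ge> 1" and d: "\<And>j. j \<in> {1..Suc m} \<Longrightarrow> d j \<ge> 1" and \<gamma>: "\<And>j. j \<in> {1..Suc m} \<Longrightarrow> Re (\<gamma> j) > 0"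
    and hyp: "\<And>j (\<epsilon> :: nat \<Rightarrow> nat). j \<in> {1..Suc m} \<Longrightarrow> \<epsilon> \<in> {j+1..Suc m} \<rightarrow> {0, 1} \<Longrightarrow>
           1 / real (d j) + (\<Sum>k\<in>{j+1..Suc m}. real (\<epsilon> k) / real (d k)) \<notin> \<nat>"
    and s: "\<And>j. s j \<in> \<int>" "s (Suc m) = - of_nat P"
  obtains M where "M > d (Suc m) * P"
    "multizeta (Suc m) d \<gamma> s = - (1 / 2) * multizeta m d \<gamma> (merge_last m 0 s) -
      (\<Sum>k\<in>{1..<M}. (of_real (bernoulli_coeff (Suc k)) * (if d (Suc m) dvd k then \<gamma> (Suc m) ^ (k div d (Suc m)) * fact k else 0)) *
        ((of_nat P gchoose (k div d (Suc m))) * multizeta m d \<gamma> (merge_last m (of_nat (k div d (Suc m))) s)))"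
proof -
  have dm: "d j \<ge> 1" and \<gamma>m: "Re (\<gamma> j) > 0" if "j \<in> {1..m}" for j using d[of j] \<gamma>[of j] that by auto
  have hypm: "1 / real (d j) + (\<Sum>k\<in>{j+1..m}. real (\<epsilon> k) / real (d k)) \<notin> \<nat>"
    if j: "j \<in> {1..m}" and \<epsilon>: "\<epsilon> \<in> {j+1..m} \<rightarrow> {0, 1}" for j and \<epsilon> :: "nat \<Rightarrow> nat"
  proof -
    have "(\<Sum>k\<in>{j+1..m}. real ((\<epsilon>(Suc m := 0)) k) / real (d k)) = (\<Sum>k\<in>{j+1..m}. real (\<epsilon> k) / real (d k))"
      by (rule sum.cong) auto
    then have "(\<Sum>k\<in>{j+1..Suc m}. real ((\<epsilon>(Suc m := 0)) k) / real (d k)) = (\<Sum>k\<in>{j+1..m}. real (\<epsilon> k) / real (d k))"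
      using j by simp
    moreover have "\<epsilon>(Suc m := 0) \<in> {j+1..Suc m} \<rightarrow> {0, 1}" using \<epsilon> by (auto simp: Pi_iff)
    ultimately show ?thesis using hyp[of j "\<epsilon>(Suc m := 0)"] j by simp
  qed
  obtain E where E: "mhol m E UNIV" "\<And>u. u \<in> conv_region m d \<Longrightarrow> E u = polar_factor d m u * multizeta_series m d \<gamma> u"
    using multizeta_entire[of m d \<gamma>, OF m dm \<gamma>m] by blast
  obtain q where q: "\<And>l. mhol m (q l) UNIV" "\<And>l u. polar_factor d m u = q l u * polar_factor d m (u(m := u m + of_nat l))"
    by (rule polar_factor_shift_factor[OF m]) blast
  obtain E' where E': "mhol (Suc m) E' UNIV"
    "\<And>u. u \<in> conv_region (Suc m) d \<Longrightarrow> E' u = polar_factor d (Suc m) u * multizeta_series (Suc m) d \<gamma> u"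
    "\<And>T u. u \<in> half_box (Suc m) T \<Longrightarrow> E' u = zeta_step d \<gamma> m E q T u"
    using multizeta_entire_Suc[of m d \<gamma> E q, OF d \<gamma> m E q] by blast
  obtain T where T: "s \<in> half_box (Suc m) T" using half_box_ex by blast
  \<comment> \<open>The half-box is open, so \<open>-P > -T\<close> strictly. This one inequality
    makes the main term vanish and puts the remainder order above the degree
    \<open>D * P\<close>.\<close>
  have PT: "P < T" using T s(2) by (auto simp: half_box_def dest!: bspec[of _ _ "Suc m"])
  define D where "D = d (Suc m)"
  have D: "D \<ge> 1" using d[of "Suc m"] by (simp add: D_def)
  define M where "M = rem_order d m T"
  have MP: "M > D * P"
  proof -
    have "P < T * Suc m + Suc m + 1" using PT by (simp add: trans_less_add1)
    then have "D * P < D * (T * Suc m + Suc m + 1)" using D by (intro mult_less_mono2) auto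
    then show ?thesis by (simp only: M_def rem_order_def D_def)
  qed
  define t where "t = - 1 / complex_of_nat D"
  define h where "h u = polar_factor d m (merge_last m u s)" for u
  define r where "r = rGamma (- of_nat P - 1 / complex_of_nat D)"
  have hn: "polar_factor d (Suc m) s = r * (h 0 * h t)"
    unfolding polar_factor_Suc[OF m] by (simp add: r_def h_def t_def D_def s(2))
  have "polar_factor d (Suc m) s \<noteq> 0" by (rule polar_factor_integer_nz[OF s(1) hyp])
  then have nz: "r \<noteq> 0" "h 0 \<noteq> 0" "h t \<noteq> 0" unfolding hn by auto
  have hl: "h 0 = q l (merge_last m 0 s) * h (of_nat l)" for l
    unfolding h_def using q(2)[of "merge_last m 0 s" l] unfolding merge_last_add .
  have hl0: "h (of_nat l) \<noteq> 0" "q l (merge_last m 0 s) \<noteq> 0" for l using nz(2) hl[of l] by auto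
  have mz: "multizeta m d \<gamma> (merge_last m (of_nat l) s) = E (merge_last m (of_nat l) s) / h (of_nat l)" for l
    using multizeta_eq_quotient[OF m E] hl0(1)[of l] by (simp add: h_def)
  have mz0: "multizeta m d \<gamma> (merge_last m 0 s) = E (merge_last m 0 s) / h 0"
    using mz[of 0] by simp
  have main: "em_main D (\<gamma> (Suc m)) (Suc T) (- of_nat P) = 0" by (rule em_main_eq_0) (use PT in simp)
  have rem: "zeta_rem d \<gamma> m M s = 0" by (rule zeta_rem_eq_0[where s = s and m = m, OF s(2)]) (use MP in \<open>simp add: D_def\<close>)
  have "multizeta (Suc m) d \<gamma> s = E' s / polar_factor d (Suc m) s"
    by (rule multizeta_eq_quotient[OF _ E'(1,2)]) (use nz hn in auto)
  also have "E' s = - (1 / 2) * (r * h t * E (merge_last m 0 s)) -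
     (\<Sum>k\<in>{1..<M}. (of_real (bernoulli_coeff (Suc k)) * (if D dvd k then \<gamma> (Suc m) ^ (k div D) * fact k else 0)) * ((of_nat P gchoose (k div D)) *
        (r * h t * (q (k div D) (merge_last m 0 s) * E (merge_last m (of_nat (k div D)) s)))))"
    unfolding E'(3)[OF T] zeta_step_def Let_def D_def[symmetric] M_def[symmetric] s(2) main rem t_def[symmetric]
      h_def[symmetric] r_def[symmetric] by simp
  also have "\<dots> / polar_factor d (Suc m) s = - (1 / 2) * multizeta m d \<gamma> (merge_last m 0 s) -
      (\<Sum>k\<in>{1..<M}. (of_real (bernoulli_coeff (Suc k)) * (if D dvd k then \<gamma> (Suc m) ^ (k div D) * fact k else 0)) *
        ((of_nat P gchoose (k div D)) * multizeta m d \<gamma> (merge_last m (of_nat (k div D)) s)))"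
  proof -
    \<comment> \<open>\<open>r\<close> and \<open>h t\<close> cancel at once; then
      \<open>h 0 = q l * h (of_nat l)\<close> cancels \<open>q l\<close> and leaves the quotient
      that defines the value in \<open>m\<close> variables.\<close>
    have key: "r * h t * (q l (merge_last m 0 s) * E (merge_last m (of_nat l) s)) / (r * (h 0 * h t)) =
       multizeta m d \<gamma> (merge_last m (of_nat l) s)" for l
    proof -
      have "r * h t * (q l (merge_last m 0 s) * E (merge_last m (of_nat l) s)) / (r * (h 0 * h t)) =
          q l (merge_last m 0 s) * E (merge_last m (of_nat l) s) / h 0"
        using nz by simp
      also have "\<dots> = multizeta m d \<gamma> (merge_last m (of_nat l) s)"
        unfolding mz hl[of l] using hl0(2)[of l] by simp
      finally show ?thesis .
    qed
    have key0: "r * h t * E (merge_last m 0 s) / (r * (h 0 * h t)) = multizeta m d \<gamma> (merge_last m 0 s)"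
      unfolding mz0 using nz by simp
    have split: "(- (1 / 2) * X - (\<Sum>k\<in>{1..<M}. a k * (b k * Y k))) / H =
        - (1 / 2) * (X / H) - (\<Sum>k\<in>{1..<M}. a k * (b k * (Y k / H)))" for X H :: complex and a b Y
      by (simp add: diff_divide_distrib sum_divide_distrib)
    show ?thesis unfolding hn split key key0 ..
  qed
  finally show thesis using that[of M] MP unfolding D_def by blast
qed

theorem theorem1:
  fixes n :: nat and d :: "nat \<Rightarrow> nat" and \<gamma> :: "nat \<Rightarrow> complex" and N :: "nat \<Rightarrow> int"
  assumes "n \<ge> 2"
    and "\<And>j. j \<in> {1..n} \<Longrightarrow> d j \<ge> 1"
    and "\<And>j. j \<in> {1..n} \<Longrightarrow> Re (\<gamma> j) > 0"
    and "\<And>j (\<epsilon> :: nat \<Rightarrow> nat). j \<in> {1..n} \<Longrightarrow> \<epsilon> \<in> {j+1..n} \<rightarrow> {0, 1} \<Longrightarrow>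
           1 / real (d j) + (\<Sum>k\<in>{j+1..n}. real (\<epsilon> k) / real (d k)) \<notin> \<nat>"
    and "N n \<le> 0"
  shows "multizeta n d \<gamma> (\<lambda>j. of_int (N j)) =
    - (1 / 2) * multizeta (n - 1) d \<gamma> ((\<lambda>j. of_int (N j))(n - 1 := of_int (N (n - 1) + N n)))
    - (\<Sum>k | 1 \<le> k \<and> int k \<le> (1 - int (d n) * N n) div 2 \<and> d n dvd 2 * k - 1.
         of_real (bernoulli (2 * k)) / of_nat (2 * k)
         * (of_int (- N n) gchoose ((2 * k - 1) div d n))
         * \<gamma> n ^ ((2 * k - 1) div d n)
         * multizeta (n - 1) d \<gamma> ((\<lambda>j. of_int (N j))
             (n - 1 := of_int (N (n - 1) + N n + int ((2 * k - 1) div d n)))))"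
proof -
  obtain m where m: "n = Suc m" "m \<ge> 1" using assms(1) by (cases n) auto
  define P where "P = nat (- N n)"
  have P: "N n = - int P" using assms(5) by (simp add: P_def)
  define D where "D = d n"
  have D: "D \<ge> 1" using assms(2)[of n] assms(1) by (simp add: D_def)
  define s where "s = (\<lambda>j. of_int (N j) :: complex)"
  have sI: "s j \<in> \<int>" for j by (simp add: s_def)
  have sn: "s (Suc m) = - of_nat P" using P by (simp add: s_def m(1))
  obtain M where M: "M > d (Suc m) * P"
    "multizeta (Suc m) d \<gamma> s = - (1 / 2) * multizeta m d \<gamma> (merge_last m 0 s) -
      (\<Sum>k\<in>{1..<M}. (of_real (bernoulli_coeff (Suc k)) * (if d (Suc m) dvd k then \<gamma> (Suc m) ^ (k div d (Suc m)) * fact k else 0)) *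
        ((of_nat P gchoose (k div d (Suc m))) * multizeta m d \<gamma> (merge_last m (of_nat (k div d (Suc m))) s)))"
    by (rule multizeta_at_integers[of m d \<gamma> s P, OF m(2) assms(2-4)[unfolded m(1)] sI sn]) blast
  have ml: "merge_last m (of_nat l) s = (\<lambda>j. of_int (N j))(n - 1 := of_int (N (n - 1) + N n + int l))" for l
    by (simp add: merge_last_def s_def m(1))
  define c where "c k = (of_real (bernoulli_coeff (Suc k)) * (if D dvd k then \<gamma> n ^ (k div D) * fact k else 0)) *
        ((of_nat P gchoose (k div D)) * multizeta m d \<gamma> (merge_last m (of_nat (k div D)) s))" for k
  define I where "I = {k. 1 \<le> k \<and> int k \<le> (1 - int (d n) * N n) div 2 \<and> d n dvd 2 * k - 1}"
  \<comment> \<open>The truncated difference \<open>2 * k - 1\<close> is harmless for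
    \<open>k \<ge> 1\<close>, and the rounded bound on \<open>k\<close> says that the derivative
    order \<open>2 k - 1\<close> does not exceed the degree \<open>D * P\<close>.\<close>
  have I_iff: "k \<in> I \<longleftrightarrow> 1 \<le> k \<and> 2 * k - 1 \<le> D * P \<and> D dvd 2 * k - 1" for k
  proof -
    have "1 - int (d n) * N n = int (1 + D * P)" by (simp add: P D_def)
    then have "int k \<le> (1 - int (d n) * N n) div 2 \<longleftrightarrow> 2 * k \<le> 1 + D * P" by linarith
    moreover have "2 * k \<le> 1 + D * P \<longleftrightarrow> 2 * k - 1 \<le> D * P" by linarith
    ultimately show ?thesis by (simp only: I_def mem_Collect_eq D_def)
  qed
  have "(\<Sum>k\<in>{1..<M}. c k) = (\<Sum>k\<in>(\<lambda>k. 2 * k - 1) ` I. c k)"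
  proof (rule sum.mono_neutral_right)
    show "(\<lambda>k. 2 * k - 1) ` I \<subseteq> {1..<M}"
      using M(1) by (auto simp: I_iff D_def m(1))
    \<comment> \<open>The sum runs over derivative orders, the theorem over Bernoulli indices
      \<open>2 k\<close>, so order \<open>2 k - 1\<close> corresponds to \<open>k\<close>. The other
      orders vanish: not divisible by \<open>D\<close> (no derivative at \<open>0\<close>), even
      (odd Bernoulli number), or beyond \<open>D * P\<close> (binomial coefficient
      \<open>0\<close>).\<close>
    show "\<forall>k\<in>{1..<M} - (\<lambda>k. 2 * k - 1) ` I. c k = 0"
    proof
      fix k assume k: "k \<in> {1..<M} - (\<lambda>k. 2 * k - 1) ` I"
      show "c k = 0"
      proof (cases "D dvd k \<and> odd k")
        case False
        then have "\<not> D dvd k \<or> bernoulli_coeff (Suc k) = 0" using bernoulli_coeff_odd[of "Suc k"] k by auto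
        then show ?thesis by (auto simp: c_def)
      next
        case True
        then obtain j where j: "k = 2 * j - 1" "j \<ge> 1" by (auto elim!: oddE intro: that[of "Suc _"])
        then have "j \<notin> I" using k by auto
        then have "k > D * P" using True j by (auto simp: I_iff)
        moreover obtain l where l: "k = D * l" using True by auto
        ultimately have "l > P" by simp
        then have "(of_nat P gchoose l :: complex) = 0" by (simp add: binomial_eq_0 flip: binomial_gbinomial)
        then show ?thesis using l D by (simp add: c_def)
      qed
    qed
  qed simp
  also have "\<dots> = (\<Sum>k\<in>I. c (2 * k - 1))"
    by (subst sum.reindex) (auto simp: inj_on_def I_iff)
  also have "\<dots> = (\<Sum>k\<in>I. of_real (bernoulli (2 * k)) / of_nat (2 * k)
         * (of_int (- N n) gchoose ((2 * k - 1) div d n))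
         * \<gamma> n ^ ((2 * k - 1) div d n)
         * multizeta (n - 1) d \<gamma> ((\<lambda>j. of_int (N j))
             (n - 1 := of_int (N (n - 1) + N n + int ((2 * k - 1) div d n)))))"
  proof (rule sum.cong)
    fix k assume "k \<in> I"
    then have k: "k \<ge> 1" "D dvd 2 * k - 1" by (auto simp: I_iff)
    have S: "Suc (2 * k - 1) = 2 * k" using k by simp
    have "(fact (2 * k) :: real) = of_nat (2 * k) * fact (2 * k - 1)"
      using fact_Suc[of "2 * k - 1"] unfolding S .
    then have "bernoulli (2 * k) = real (2 * k) * (fact (2 * k - 1) * bernoulli_coeff (2 * k))"
      by (simp add: bernoulli_def bernoulli_coeff_def)
    \<comment> \<open>The order \<open>2 k - 1\<close> derivative contributes its factorial, which
      turns \<open>B_{2k} / (2k)!\<close> into \<open>B_{2k} / (2k)\<close>.\<close>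
    then have B: "complex_of_real (bernoulli (2 * k)) / of_nat (2 * k) = of_real (bernoulli_coeff (2 * k)) * fact (2 * k - 1)"
      using k by simp
    have "of_int (- N n) = (of_nat P :: complex)" using P by simp
    then show "c (2 * k - 1) = of_real (bernoulli (2 * k)) / of_nat (2 * k)
         * (of_int (- N n) gchoose ((2 * k - 1) div d n))
         * \<gamma> n ^ ((2 * k - 1) div d n)
         * multizeta (n - 1) d \<gamma> ((\<lambda>j. of_int (N j))
             (n - 1 := of_int (N (n - 1) + N n + int ((2 * k - 1) div d n))))"
      unfolding B c_def S ml using k(2) by (simp only: if_True D_def) (simp add: m(1) mult_ac)
  qed simp
  finally have "(\<Sum>k\<in>{1..<M}. c k) = \<dots>" .
  moreover have "multizeta n d \<gamma> s = - (1 / 2) * multizeta (n - 1) d \<gamma> (merge_last m (of_nat 0) s) - (\<Sum>k\<in>{1..<M}. c k)"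
  proof -
    have "n - 1 = m" using m(1) by simp
    then show ?thesis unfolding c_def using M(2) by (simp only: m(1)[symmetric] D_def[symmetric] of_nat_0)
  qed
  ultimately show ?thesis unfolding ml by (simp add: s_def I_def)
qed

end
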